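(* Let $A$ be a commutative $\mathbb{Q}$-algebra, $m\ge 1$, and let $\Gamma\in\mathcal{A}^{pb(m)}_3(A)$ be group-like. Suppose $\Gamma$ satisfies the pentagon equation $d_4\Gamma\cdot d_2\Gamma\cdot d_0\Gamma=d_1\Gamma\cdot d_3\Gamma$ (in $\mathcal{A}^{pb(m)}_4(A)$) and the classical hexagon equation $1=\Gamma\cdot(\Gamma^{-1})^{132}\cdot\Gamma^{312}$. Then $\Gamma$ satisfies the semi-classical hexagon equation $$t^{13}+t^{23}=\Gamma\cdot\left(t^{23}\cdot(\Gamma^{-1})^{132}+(\Gamma^{-1})^{132}\cdot t^{13}\right)\cdot\Gamma^{312},$$ and hence also the cabling equation $t^{12}+t^{13}=\Gamma^{-1}\cdot t^{12}\cdot\Gamma+(\Gamma^{-1}\cdot t^{12}\cdot\Gamma)^{132}$ (all equations in $\mathcal{A}^{pb(m)}_3(A)$, i.e. modulo degrees $>m$).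
   Context: $\mathcal{A}^{pb}_n(A)$ is the associative $A$-algebra generated by $t^{ij}=t^{ji}$, $1\le i\ne j\le n$, modulo $[t^{ij},t^{kl}]=0$ ($i,j,k,l$ distinct) and $[t^{ij},t^{ik}+t^{jk}]=0$ ($i,j,k$ distinct); graded by $\deg t^{ij}=1$; $\mathcal{A}^{pb(m)}_n(A)$ is its quotient by elements of degree $>m$. The coproduct $\Box$ is determined by $\Box t^{ij}=t^{ij}\otimes1+1\otimes t^{ij}$, and $\Gamma$ is group-like if $\Box\Gamma=\Gamma\otimes\Gamma$. The algebra homomorphisms $d_i:\mathcal{A}^{pb}_n\to\mathcal{A}^{pb}_{n+1}$, $0\le i\le n+1$, are $d_0(t^{jk})=t^{(j+1)(k+1)}$, $d_{n+1}(t^{jk})=t^{jk}$, and for $1\le i\le n$ (with $\phi(l)=l$ for $l<i$, $\phi(l)=l+1$ for $l>i$) $d_i(t^{jk})=t^{\phi(j)\phi(k)}$ if $i\notin\{j,k\}$ and $d_i(t^{ik})=t^{i\phi(k)}+t^{(i+1)\phi(k)}$. In particular $d_1t^{12}=t^{13}+t^{23}$ and $d_2t^{12}=t^{12}+t^{13}$. For a permutation $\sigma$ of $\{1,2,3\}$ written $\sigma(1)\sigma(2)\sigma(3)$, $X^{\sigma}$ is the image of $X\in\mathcal{A}^{pb}_3$ under the automorphism $t^{ij}\mapsto t^{\sigma(i)\sigma(j)}$. *)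

theory Defs
  imports Main "HOL-Library.Function_Algebras"
begin

text \<open>A generator t^{ij} (i < j) is encoded as the pair (i,j).  Elements of the
free associative A-algebra (and its degree completion) are coefficient functions
on words in the generators; sum, difference, zero are pointwise (Function_Algebras),
the algebra product is concatenation-convolution nc_mul.\<close>

type_synonym gen = "nat \<times> nat"
type_synonym 'a nc = "gen list \<Rightarrow> 'a"
type_synonym 'a nct = "gen list \<times> gen list \<Rightarrow> 'a"

definition nc_mul :: "'a::comm_ring_1 nc \<Rightarrow> 'a nc \<Rightarrow> 'a nc" where
  "nc_mul f g = (\<lambda>w. \<Sum>k\<le>length w. f (take k w) * g (drop k w))"

definition nc_one :: "'a::comm_ring_1 nc" where
  "nc_one = (\<lambda>w. if w = [] then 1 else 0)"

definition nc_gen :: "gen \<Rightarrow> 'a::comm_ring_1 nc" where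
  "nc_gen x = (\<lambda>w. if w = [x] then 1 else 0)"

definition T :: "nat \<Rightarrow> nat \<Rightarrow> 'a::comm_ring_1 nc" where
  "T i j = nc_gen (min i j, max i j)"

definition gens :: "nat \<Rightarrow> gen set" where
  "gens n = {(i, j). 1 \<le> i \<and> i < j \<and> j \<le> n}"

definition valid :: "nat \<Rightarrow> 'a::zero nc \<Rightarrow> bool" where
  "valid n f \<longleftrightarrow> (\<forall>w. f w \<noteq> 0 \<longrightarrow> set w \<subseteq> gens n)"

definition nc_poly :: "'a::zero nc \<Rightarrow> bool" where
  "nc_poly f \<longleftrightarrow> finite {w. f w \<noteq> 0}"

definition comm :: "'a::comm_ring_1 nc \<Rightarrow> 'a nc \<Rightarrow> 'a nc" where
  "comm f g = nc_mul f g - nc_mul g f"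

definition pb_rels :: "nat \<Rightarrow> 'a::comm_ring_1 nc set" where
  "pb_rels n =
     {comm (T i j) (T k l) | i j k l. distinct [i, j, k, l] \<and> {i, j, k, l} \<subseteq> {1..n}}
   \<union> {comm (T i j) (T i k + T j k) | i j k. distinct [i, j, k] \<and> {i, j, k} \<subseteq> {1..n}}"

text \<open>Two-sided ideal generated by the defining relations of A^{pb}_n together with
all elements of degree > m; the quotient is A^{pb(m)}_n(A).\<close>
inductive_set pb_ideal :: "nat \<Rightarrow> nat \<Rightarrow> 'a::comm_ring_1 nc set" for n m where
  deg: "valid n f \<Longrightarrow> (\<forall>w. length w \<le> m \<longrightarrow> f w = 0) \<Longrightarrow> f \<in> pb_ideal n m"
| rel: "r \<in> pb_rels n \<Longrightarrow> r \<in> pb_ideal n m"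
| add: "f \<in> pb_ideal n m \<Longrightarrow> g \<in> pb_ideal n m \<Longrightarrow> f + g \<in> pb_ideal n m"
| lmul: "valid n a \<Longrightarrow> f \<in> pb_ideal n m \<Longrightarrow> nc_mul a f \<in> pb_ideal n m"
| rmul: "valid n a \<Longrightarrow> f \<in> pb_ideal n m \<Longrightarrow> nc_mul f a \<in> pb_ideal n m"

definition pb_eq :: "nat \<Rightarrow> nat \<Rightarrow> 'a::comm_ring_1 nc \<Rightarrow> 'a nc \<Rightarrow> bool" where
  "pb_eq n m f g \<longleftrightarrow> f - g \<in> pb_ideal n m"

definition tens :: "'a::comm_ring_1 nc \<Rightarrow> 'a nc \<Rightarrow> 'a nct" where
  "tens f g = (\<lambda>(u, v). f u * g v)"

definition t_mul :: "'a::comm_ring_1 nct \<Rightarrow> 'a nct \<Rightarrow> 'a nct" where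
  "t_mul F G = (\<lambda>(u, v). \<Sum>i\<le>length u. \<Sum>j\<le>length v.
       F (take i u, take j v) * G (drop i u, drop j v))"

definition t_one :: "'a::comm_ring_1 nct" where
  "t_one = (\<lambda>(u, v). if u = [] \<and> v = [] then 1 else 0)"

definition t_valid :: "nat \<Rightarrow> 'a::zero nct \<Rightarrow> bool" where
  "t_valid n F \<longleftrightarrow> (\<forall>u v. F (u, v) \<noteq> 0 \<longrightarrow> set u \<subseteq> gens n \<and> set v \<subseteq> gens n)"

text \<open>Kernel of (free) (x) (free) -> A^{pb(m)}_n (x) A^{pb(m)}_n modulo total degree > m.\<close>
inductive_set pb_tideal :: "nat \<Rightarrow> nat \<Rightarrow> 'a::comm_ring_1 nct set" for n m where
  tdeg: "t_valid n F \<Longrightarrow> (\<forall>u v. length u + length v \<le> m \<longrightarrow> F (u, v) = 0) \<Longrightarrow> F \<in> pb_tideal n m"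
| tl: "r \<in> pb_ideal n m \<Longrightarrow> valid n a \<Longrightarrow> tens r a \<in> pb_tideal n m"
| tr: "valid n a \<Longrightarrow> r \<in> pb_ideal n m \<Longrightarrow> tens a r \<in> pb_tideal n m"
| tadd: "F \<in> pb_tideal n m \<Longrightarrow> G \<in> pb_tideal n m \<Longrightarrow> F + G \<in> pb_tideal n m"

definition w_img :: "('b \<Rightarrow> 'b \<Rightarrow> 'b) \<Rightarrow> 'b \<Rightarrow> (gen \<Rightarrow> 'b) \<Rightarrow> gen list \<Rightarrow> 'b" where
  "w_img mul one \<phi> w = foldr (\<lambda>x acc. mul (\<phi> x) acc) w one"

definition p_subst :: "(('c \<Rightarrow> 'a) \<Rightarrow> ('c \<Rightarrow> 'a) \<Rightarrow> ('c \<Rightarrow> 'a)) \<Rightarrow> ('c \<Rightarrow> 'a) \<Rightarrow>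
    (gen \<Rightarrow> 'c \<Rightarrow> 'a) \<Rightarrow> 'a::comm_ring_1 nc \<Rightarrow> 'c \<Rightarrow> 'a" where
  "p_subst mul one \<phi> f = (\<Sum>w\<in>{w. f w \<noteq> 0}. (\<lambda>z. f w * w_img mul one \<phi> w z))"

definition nc_subst :: "(gen \<Rightarrow> 'a nc) \<Rightarrow> 'a::comm_ring_1 nc \<Rightarrow> 'a nc" where
  "nc_subst \<phi> f = p_subst nc_mul nc_one \<phi> f"

definition box :: "'a::comm_ring_1 nc \<Rightarrow> 'a nct" where
  "box f = p_subst t_mul t_one (\<lambda>x. tens (nc_gen x) nc_one + tens nc_one (nc_gen x)) f"

definition grouplike :: "nat \<Rightarrow> nat \<Rightarrow> 'a::comm_ring_1 nc \<Rightarrow> bool" where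
  "grouplike n m g \<longleftrightarrow> box g - tens g g \<in> pb_tideal n m"

definition relabel :: "(nat \<Rightarrow> nat) \<Rightarrow> 'a::comm_ring_1 nc \<Rightarrow> 'a nc" where
  "relabel \<sigma> f = nc_subst (\<lambda>(i, j). T (\<sigma> i) (\<sigma> j)) f"

definition \<sigma>132 :: "nat \<Rightarrow> nat" where
  "\<sigma>132 l = (if l = 2 then 3 else if l = 3 then 2 else l)"

definition \<sigma>312 :: "nat \<Rightarrow> nat" where
  "\<sigma>312 l = (if l = 1 then 3 else if l = 2 then 1 else if l = 3 then 2 else l)"

definition cof_phi :: "nat \<Rightarrow> nat \<Rightarrow> nat" where
  "cof_phi i l = (if l < i then l else l + 1)"

definition dgen :: "nat \<Rightarrow> nat \<Rightarrow> gen \<Rightarrow> 'a::comm_ring_1 nc" where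
  "dgen n i x = (case x of (a, b) \<Rightarrow>
     if i = 0 then T (a + 1) (b + 1)
     else if i = n + 1 then T a b
     else if a = i then T i (cof_phi i b) + T (i + 1) (cof_phi i b)
     else if b = i then T i (cof_phi i a) + T (i + 1) (cof_phi i a)
     else T (cof_phi i a) (cof_phi i b))"

definition cof :: "nat \<Rightarrow> nat \<Rightarrow> 'a::comm_ring_1 nc \<Rightarrow> 'a nc" where
  "cof n i f = nc_subst (dgen n i) f"

end

theory Submission
  imports Defs "HOL.Modules"
begin

text \<open>
  The hexagon gives \<open>\<Gamma>\<^sup>3\<^sup>2\<^sup>1 = \<Gamma>\<^sup>-\<^sup>1\<close>, so both claims say that the cabling defect
  \<open>C = t\<^sup>1\<^sup>2 + t\<^sup>1\<^sup>3 - \<Gamma>\<^sup>-\<^sup>1 t\<^sup>1\<^sup>2 \<Gamma> - (\<Gamma>\<^sup>-\<^sup>1 t\<^sup>1\<^sup>2 \<Gamma>)\<^sup>1\<^sup>3\<^sup>2\<close> vanishes.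
  This is shown one degree at a time. If \<open>C\<close> vanishes below degree \<open>k\<close>, decomposing \<open>t\<^sup>1\<^sup>2 + t\<^sup>1\<^sup>3 + t\<^sup>1\<^sup>4\<close> in two
  ways, with the pentagons for the orders 1234, 1432, 1342, 1324 and the hexagon, shows that in degree \<open>k\<close>
  \<open>C(1;2,34) + C(1;3,4) = C(1;23,4) + C(1;2,3)\<close>; also \<open>C\<close> is symmetric in its last two strands.

  The degree \<open>k\<close> part of \<open>C\<close> is \<open>\<Sum>\<^sub>u c\<^sub>u u(t\<^sup>1\<^sup>2, t\<^sup>1\<^sup>3) (t\<^sup>2\<^sup>3)\<^bsup>k-|u|\<^esup>\<close>, summed over words \<open>u\<close>
  in two letters. The four-strand algebra acts on the free algebra in \<open>x\<^sub>2, x\<^sub>3, x\<^sub>4\<close>, the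
  generators \<open>t\<^sup>1\<^sup>j\<close> by left multiplication and the others by derivations. Acting on 1 turns
  the cocycle equation into equations between the \<open>c\<^sub>u\<close>: for \<open>|u| < k\<close> they depend on \<open>|u|\<close> only;
  for \<open>|u| = k\<close> they vanish on powers of a letter and agree on the words with exactly one
  occurrence of the second letter, which determine the rest. As \<open>C\<close> is zero in the commutative
  quotient, the common value vanishes too, after division by \<open>k\<close> in the second case.
\<close>

section \<open>Noncommutative power series\<close>

text \<open>The cocycle equation is linear because every conjugating factor has constant term 1: it
  fixes the lowest-degree part of a defect, so modulo the next degree conjugations drop out. The
  obstacle is that the algebras are given by relations, so coefficients cannot be read off a
  representative. The normal forms are only shown to span; equations for their coefficients come
  from explicit modules. The four-strand module reflects that t12, t13, t14 generate a free Lie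
  ideal on which the generators on strands 2, 3, 4 act by derivations. Derivations kill 1, which
  would hide every normal form containing t23. Adding a scalar to t24 keeps all relations, since
  they are commutators, but destroys homogeneity; hence operators are taken degree by degree. For N
  >= 2 the cocycle equation has nonzero symmetric solutions in degree N, such as (t12 + t13)^N -
  t12^N - t13^N, whose coefficients are 1 on all words of length N except powers of a letter. They
  are excluded only by the commutative quotient, where conjugation does nothing: there t12^(N-1) t13
  has coefficient N, and this is why integers must be invertible.\<close>

typedef 'a ser = "UNIV :: 'a nc set" morphisms coef Ser ..

setup_lifting type_definition_ser

lemma coef_Ser [simp]: "coef (Ser f) = f"
  by (simp add: Ser_inverse)

lemma ser_eqI: "(\<And>w. coef x w = coef y w) \<Longrightarrow> x = y"
  by (metis coef_inject ext)

lemma nc_mul_Nil [simp]: "nc_mul f g [] = f [] * g []"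
  by (simp add: nc_mul_def)

text \<open>Splitting off the first letter turns convolution into a recursion, so associativity and
  the unit laws need list induction only and no rearrangement of double sums.\<close>

lemma nc_mul_Cons [simp]:
  "nc_mul f g (a # w) = f [] * g (a # w) + nc_mul (\<lambda>u. f (a # u)) g w"
  by (simp add: nc_mul_def sum.atMost_Suc_shift del: sum.atMost_Suc)

lemma nc_mul_add_left: "nc_mul (\<lambda>w. f w + g w) h w = nc_mul f h w + nc_mul g h w"
  by (simp add: nc_mul_def algebra_simps sum.distrib)

lemma nc_mul_add_right: "nc_mul h (\<lambda>w. f w + g w) w = nc_mul h f w + nc_mul h g w"
  by (simp add: nc_mul_def algebra_simps sum.distrib)

lemma nc_mul_scale_left: "nc_mul (\<lambda>w. c * f w) h w = c * nc_mul f h w"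
  by (simp add: nc_mul_def sum_distrib_left mult.assoc)

lemma nc_mul_assoc: "nc_mul (nc_mul f g) h w = nc_mul f (nc_mul g h) w"
  by (induction w arbitrary: f)
    (simp_all add: nc_mul_add_left nc_mul_scale_left algebra_simps)

lemma nc_mul_zero_left: "nc_mul (\<lambda>w. 0) f w = 0"
  by (simp add: nc_mul_def)

lemma nc_mul_one_left: "nc_mul nc_one f w = f w"
  by (cases w) (simp_all add: nc_one_def nc_mul_zero_left)

lemma nc_mul_one_right: "nc_mul f nc_one w = f w"
  by (induction w arbitrary: f) (simp_all add: nc_one_def)

instantiation ser :: (comm_ring_1) ring_1
begin

lift_definition zero_ser :: "'a ser" is "\<lambda>_. 0" .
lift_definition one_ser :: "'a ser" is nc_one .
lift_definition plus_ser :: "'a ser \<Rightarrow> 'a ser \<Rightarrow> 'a ser" is "\<lambda>f g w. f w + g w" .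
lift_definition minus_ser :: "'a ser \<Rightarrow> 'a ser \<Rightarrow> 'a ser" is "\<lambda>f g w. f w - g w" .
lift_definition uminus_ser :: "'a ser \<Rightarrow> 'a ser" is "\<lambda>f w. - f w" .
lift_definition times_ser :: "'a ser \<Rightarrow> 'a ser \<Rightarrow> 'a ser" is nc_mul .

instance
proof
  fix a b c :: "'a ser"
  show "a * b * c = a * (b * c)" by transfer (simp add: fun_eq_iff nc_mul_assoc)
  show "(a + b) * c = a * c + b * c" by transfer (simp add: fun_eq_iff nc_mul_add_left)
  show "a * (b + c) = a * b + a * c" by transfer (simp add: fun_eq_iff nc_mul_add_right)
  show "1 * a = a" by transfer (simp add: fun_eq_iff nc_mul_one_left)
  show "a * 1 = a" by transfer (simp add: fun_eq_iff nc_mul_one_right)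
  show "(0 :: 'a ser) \<noteq> 1" by transfer (auto simp: fun_eq_iff nc_one_def)
qed (transfer, simp add: fun_eq_iff algebra_simps)+

end

lemma coef_simps [simp]:
  "coef 0 w = 0" "coef 1 w = (if w = [] then 1 else 0)"
  "coef (x + y) w = coef x w + coef y w" "coef (x - y) w = coef x w - coef y w"
  "coef (- x) w = - coef x w"
  "coef (x * y) [] = coef x [] * coef y []"
  by (transfer, simp add: nc_one_def)+

lemma coef_mult: "coef (x * y) w = (\<Sum>k\<le>length w. coef x (take k w) * coef y (drop k w))"
  by transfer (simp add: nc_mul_def)

lemma coef_sum [simp]: "coef (sum f A) w = (\<Sum>a\<in>A. coef (f a) w)"
  by (induction A rule: infinite_finite_induct) simp_all

lemma Ser_simps:
  "Ser (nc_mul f g) = Ser f * Ser g" "Ser nc_one = 1" "Ser (f + g) = Ser f + Ser g"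
  "Ser (f - g) = Ser f - Ser g" "Ser 0 = 0"
  by (simp_all add: times_ser.abs_eq eq_onp_def one_ser_def plus_ser.abs_eq minus_ser.abs_eq
    zero_ser_def plus_fun_def fun_diff_def zero_fun_def)

lift_definition const_ser :: "'a::comm_ring_1 \<Rightarrow> 'a ser" is "\<lambda>c w. if w = [] then c else 0" .

text \<open>Left quotient by a letter (Brzozowski derivative). Together with the constant term it
  determines a series, which makes recursion and coinduction on series possible.\<close>

lift_definition lquot :: "gen \<Rightarrow> 'a ser \<Rightarrow> 'a ser" is "\<lambda>a f w. f (a # w)" .

lift_definition ser_gen :: "gen \<Rightarrow> 'a::comm_ring_1 ser" is nc_gen .

lemma coef_const_ser: "coef (const_ser c) w = (if w = [] then c else 0)"
  by transfer simp

lemma coef_lquot [simp]: "coef (lquot a x) w = coef x (a # w)"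
  by transfer simp

lemma coef_ser_gen: "coef (ser_gen a) w = (if w = [a] then 1 else 0)"
  by transfer (simp add: nc_gen_def)

lemma lquot_mult: "lquot a (x * y) = const_ser (coef x []) * lquot a y + lquot a x * y"
proof (transfer, rule ext)
  fix a w and x y :: "'a nc"
  have "nc_mul (\<lambda>u. if u = [] then x [] else 0) (\<lambda>w. y (a # w)) w = x [] * y (a # w)"
    by (cases w) (simp_all add: nc_mul_zero_left)
  then show "nc_mul x y (a # w) = nc_mul (\<lambda>w. if w = [] then x [] else 0) (\<lambda>w. y (a # w)) w
      + nc_mul (\<lambda>w. x (a # w)) y w"
    by simp
qed

lemma lquot_simps [simp]:
  "lquot a (x + y) = lquot a x + lquot a y" "lquot a (x - y) = lquot a x - lquot a y"
  "lquot a 0 = 0" "lquot a 1 = 0" "lquot a (const_ser c) = 0"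
  "lquot a (ser_gen b) = (if a = b then 1 else 0)"
  by (rule ser_eqI; simp add: coef_const_ser coef_ser_gen)+

lemma nc_mul_const_left: "nc_mul (\<lambda>w. if w = [] then c else 0) f w = c * f w"
  by (cases w) (simp_all add: nc_mul_zero_left)

lemma nc_mul_const_right: "nc_mul f (\<lambda>w. if w = [] then c else 0) w = c * f w"
  by (induction w arbitrary: f) (simp_all add: mult.commute)

lemma coef_const_ser_mult [simp]: "coef (const_ser c * x) w = c * coef x w"
  by (simp only: times_ser.rep_eq const_ser.rep_eq nc_mul_const_left)

lemma coef_mult_const_ser [simp]: "coef (x * const_ser c) w = c * coef x w"
  by (simp only: times_ser.rep_eq const_ser.rep_eq nc_mul_const_right)

lemma const_ser_commute: "x * const_ser c = const_ser c * x"
  by (rule ser_eqI) simp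

lemma const_ser_1 [simp]: "const_ser 1 = 1" and const_ser_0 [simp]: "const_ser 0 = 0"
  and const_ser_add: "const_ser (b + c) = const_ser b + const_ser c" and const_ser_mult:
      "const_ser (b * c) = const_ser b * const_ser c"
  by (rule ser_eqI; simp add: coef_const_ser)+

definition linear_form :: "'a::comm_ring_1 ser \<Rightarrow> bool" where
  "linear_form x \<longleftrightarrow> (\<forall>w. length w \<noteq> 1 \<longrightarrow> coef x w = 0)"

lemma linear_form_ser_gen: "linear_form (ser_gen a)"
  by (auto simp: linear_form_def coef_ser_gen)

lemma linear_form_sum: "(\<And>i. i \<in> A \<Longrightarrow> linear_form (f i)) \<Longrightarrow> linear_form (sum f A)"
  by (auto simp: linear_form_def)

lemma lquot_linear_form: "linear_form x \<Longrightarrow> lquot a x = const_ser (coef x [a])"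
  by (rule ser_eqI) (auto simp: linear_form_def coef_const_ser)

lemma const_linear_form [simp]: "linear_form x \<Longrightarrow> coef x [] = 0"
  by (simp add: linear_form_def)

lemma finite_gens [simp]: "finite (gens n)"
  by (rule finite_subset[of _ "{..n} \<times> {..n}"]) (auto simp: gens_def)

definition vanish :: "nat \<Rightarrow> 'a::comm_ring_1 ser \<Rightarrow> bool" where
  "vanish m x \<longleftrightarrow> (\<forall>w. length w \<le> m \<longrightarrow> coef x w = 0)"

lemma ser_decomp:
  assumes "valid n (coef x)"
  shows "x = const_ser (coef x []) + (\<Sum>a\<in>gens n. ser_gen a * lquot a x)"
proof (rule ser_eqI)
  fix w
  have *: "coef (ser_gen a * lquot a x) (b # u) = (if a = b then coef x (b # u) else 0)" for a b u
  proof -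
    have "coef (ser_gen a * lquot a x) (b # u) = coef (lquot b (ser_gen a * lquot a x)) u"
      by simp
    also have "\<dots> = (if a = b then coef x (b # u) else 0)"
      by (subst lquot_mult) (simp add: coef_ser_gen)
    finally show ?thesis .
  qed
  show "coef x w = coef (const_ser (coef x []) + (\<Sum>a\<in>gens n. ser_gen a * lquot a x)) w"
  proof (cases w)
    case Nil
    then show ?thesis by (simp add: coef_const_ser coef_ser_gen)
  next
    case (Cons b u)
    have "b \<notin> gens n \<Longrightarrow> coef x (b # u) = 0"
      using assms by (auto simp: valid_def)
    then show ?thesis
      using Cons by (auto simp: coef_const_ser *)
  qed
qed

section \<open>Substitution of linear forms\<close>

text \<open>Recursion on the output word. Linear forms preserve length, so the output letter
  \<open>b\<close> arises only from the first input letter \<open>a\<close>, and each coefficient is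
  a finite sum whatever the support of \<open>x\<close>. Only the degree one coefficients of
  \<open>\<phi>\<close> enter.\<close>

primrec subst_coef :: "nat \<Rightarrow> (gen \<Rightarrow> 'a::comm_ring_1 ser) \<Rightarrow> gen list \<Rightarrow> 'a ser \<Rightarrow> 'a" where
  "subst_coef n \<phi> [] x = coef x []"
| "subst_coef n \<phi> (b # w) x = (\<Sum>a\<in>gens n. coef (\<phi> a) [b] * subst_coef n \<phi> w (lquot a x))"

text \<open>Substitution of linear forms for the letters; unlike \<open>nc_subst\<close> it is also
  meaningful for series with infinite support.\<close>
definition subst_lin :: "nat \<Rightarrow> (gen \<Rightarrow> 'a::comm_ring_1 ser) \<Rightarrow> 'a ser \<Rightarrow> 'a ser" where
  "subst_lin n \<phi> x = Ser (\<lambda>w. subst_coef n \<phi> w x)"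

lemma coef_subst_lin: "coef (subst_lin n \<phi> x) w = subst_coef n \<phi> w x"
  by (simp add: subst_lin_def)

lemma const_subst_lin [simp]: "coef (subst_lin n \<phi> x) [] = coef x []"
  by (simp add: coef_subst_lin)

lemma lquot_subst_lin: "lquot b (subst_lin n \<phi> x) = (\<Sum>a\<in>gens n. const_ser (coef (\<phi> a) [b]) *
    subst_lin n \<phi> (lquot a x))"
  by (rule ser_eqI) (simp add: coef_subst_lin)

lemma ser_coinduct:
  assumes "coef x [] = coef y []" "\<And>a. lquot a x = lquot a y"
  shows "x = y"
proof (rule ser_eqI)
  fix w show "coef x w = coef y w"
    using assms(1) arg_cong[OF assms(2), of "\<lambda>z. coef z (tl w)" "hd w"] by (cases w) auto
qed

lemma subst_coef_0 [simp]: "subst_coef n \<phi> w 0 = 0"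
  by (induction w) simp_all

lemma subst_coef_add: "subst_coef n \<phi> w (x + y) = subst_coef n \<phi> w x + subst_coef n \<phi> w y"
  by (induction w arbitrary: x y) (simp_all add: algebra_simps sum.distrib)

lemma subst_coef_diff: "subst_coef n \<phi> w (x - y) = subst_coef n \<phi> w x - subst_coef n \<phi> w y"
  by (induction w arbitrary: x y) (simp_all add: right_diff_distrib sum_subtractf)

lemma subst_coef_const_ser_mult: "subst_coef n \<phi> w (const_ser c * x) = c * subst_coef n \<phi> w x"
  by (induction w arbitrary: x)
    (simp_all add: lquot_mult coef_const_ser algebra_simps sum_distrib_left)

lemma subst_lin_0 [simp]: "subst_lin n \<phi> 0 = 0"
  and subst_lin_add [simp]: "subst_lin n \<phi> (x + y) = subst_lin n \<phi> x + subst_lin n \<phi> y"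
  and subst_lin_diff [simp]: "subst_lin n \<phi> (x - y) = subst_lin n \<phi> x - subst_lin n \<phi> y"
  and subst_lin_const_ser_mult [simp]: "subst_lin n \<phi> (const_ser c * x) = const_ser c * subst_lin
      n \<phi> x"
  by (rule ser_eqI; simp add: coef_subst_lin subst_coef_add subst_coef_diff
      subst_coef_const_ser_mult)+

lemma subst_lin_const_ser [simp]: "subst_lin n \<phi> (const_ser c) = const_ser c"
  by (rule ser_coinduct) (simp_all add: lquot_subst_lin)

lemma subst_lin_1 [simp]: "subst_lin n \<phi> 1 = 1"
  using subst_lin_const_ser[of n \<phi> 1] by simp

lemma subst_lin_sum [simp]: "subst_lin n \<phi> (sum f A) = (\<Sum>i\<in>A. subst_lin n \<phi> (f i))"
  by (induction A rule: infinite_finite_induct) simp_all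

lemma subst_lin_ser_gen:
  assumes "a \<in> gens n" "linear_form (\<phi> a)"
  shows "subst_lin n \<phi> (ser_gen a) = \<phi> a"
proof (rule ser_coinduct)
  fix b
  have "lquot b (subst_lin n \<phi> (ser_gen a)) = (\<Sum>a'\<in>gens n. if a' = a then const_ser (coef (\<phi> a)
      [b]) else 0)"
    unfolding lquot_subst_lin by (intro sum.cong) auto
  then show "lquot b (subst_lin n \<phi> (ser_gen a)) = lquot b (\<phi> a)"
    using assms by (simp add: lquot_linear_form)
qed (use assms in \<open>simp add: coef_ser_gen\<close>)

lemma coef_mult_Cons: "coef (x * y) (a # w) = coef x [] * coef y (a # w) + coef (lquot a x * y) w"
  by transfer simp

lemma subst_lin_mult [simp]: "subst_lin n \<phi> (x * y) = subst_lin n \<phi> x * subst_lin n \<phi> y"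
proof (rule ser_eqI)
  fix w show "coef (subst_lin n \<phi> (x * y)) w = coef (subst_lin n \<phi> x * subst_lin n \<phi> y) w"
  proof (induction w arbitrary: x)
    case (Cons b w)
    have IH: "subst_coef n \<phi> w (z * y) = coef (subst_lin n \<phi> z * subst_lin n \<phi> y) w" for z
      using Cons by (simp add: coef_subst_lin)
    show ?case
      by (simp add: coef_mult_Cons lquot_subst_lin sum_distrib_right mult.assoc)
        (simp add: coef_subst_lin lquot_mult subst_coef_add subst_coef_const_ser_mult IH
            algebra_simps sum.distrib
          sum_distrib_left)
  qed (simp add: coef_subst_lin)
qed

lemma subst_lin_power [simp]: "subst_lin n \<phi> (x ^ k) = subst_lin n \<phi> x ^ k"
  by (induction k) simp_all

lemma subst_lin_subst_lin:
  "subst_lin n2 \<psi> (subst_lin n1 \<phi> x) = subst_lin n1 (\<lambda>a. subst_lin n2 \<psi> (\<phi> a)) x"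
proof (rule ser_eqI)
  fix w show "coef (subst_lin n2 \<psi> (subst_lin n1 \<phi> x)) w = coef (subst_lin n1 (\<lambda>a. subst_lin n2 \<psi>
      (\<phi> a)) x) w"
  proof (induction w arbitrary: x)
    case (Cons b w)
    have subst_coef_sum: "subst_coef n2 \<psi> w (sum f A) = (\<Sum>i\<in>A. subst_coef n2 \<psi> w (f i))" for f A
      by (induction A rule: infinite_finite_induct) (simp_all add: subst_coef_add)
    have "coef (subst_lin n2 \<psi> (subst_lin n1 \<phi> x)) (b # w) = (\<Sum>c\<in>gens n2. \<Sum>a\<in>gens n1.
      coef (\<psi> c) [b] * (coef (\<phi> a) [c] * subst_coef n2 \<psi> w (subst_lin n1 \<phi> (lquot a x))))"
      by (simp add: coef_subst_lin lquot_subst_lin subst_coef_sum subst_coef_const_ser_mult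
          sum_distrib_left)
    also have "\<dots> = (\<Sum>a\<in>gens n1. \<Sum>c\<in>gens n2.
      coef (\<psi> c) [b] * (coef (\<phi> a) [c] * subst_coef n2 \<psi> w (subst_lin n1 \<phi> (lquot a x))))"
      by (rule sum.swap)
    also have "\<dots> = coef (subst_lin n1 (\<lambda>a. subst_lin n2 \<psi> (\<phi> a)) x) (b # w)"
      using Cons by (simp add: coef_subst_lin sum_distrib_left sum_distrib_right mult.assoc)
    finally show ?case .
  qed (simp add: coef_subst_lin)
qed

lemma subst_lin_cong:
  assumes "\<And>a. a \<in> gens n \<Longrightarrow> \<phi> a = \<psi> a"
  shows "subst_lin n \<phi> x = subst_lin n \<psi> x"
proof (rule ser_eqI)
  fix w show "coef (subst_lin n \<phi> x) w = coef (subst_lin n \<psi> x) w"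
    unfolding coef_subst_lin by (induction w arbitrary: x) (simp_all add: assms)
qed

text \<open>Substituting every generator for itself is thus the projection onto words on
  \<open>n\<close> strands. It is also a ring homomorphism, which is what makes \<open>J\<close> a
  two-sided ideal among all series.\<close>

lemma subst_lin_ser_gen_id: "subst_lin n ser_gen (x :: 'a::comm_ring_1 ser) = Ser (\<lambda>w. if set w \<subseteq>
    gens n then coef x w else 0)"
proof (rule ser_eqI)
  fix w show "coef (subst_lin n ser_gen x) w = coef (Ser (\<lambda>w. if set w \<subseteq> gens n then coef x w else
      0)) w"
  proof (induction w arbitrary: x)
    case (Cons b w)
    have IH: "subst_coef n ser_gen w x = (if set w \<subseteq> gens n then coef x w else 0)" for x :: "'a ser"
      using Cons[of x] unfolding coef_subst_lin coef_Ser .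
    have "coef (subst_lin n ser_gen x) (b # w) = (\<Sum>a\<in>gens n. if a = b then subst_coef n ser_gen w
        (lquot a x) else 0)"
      unfolding coef_subst_lin subst_coef.simps by (intro sum.cong) (auto simp: coef_ser_gen)
    then show ?case by (simp add: IH)
  qed simp
qed

lemma subst_lin_ser_gen_valid: "valid n (coef x) \<Longrightarrow> subst_lin n ser_gen x = x"
  unfolding subst_lin_ser_gen_id by (rule ser_eqI) (auto simp: valid_def)

lemma vanish_subst_lin: "vanish m x \<Longrightarrow> vanish m (subst_lin n \<phi> x)"
proof -
  assume "vanish m x"
  have "\<forall>u. length u = length w \<longrightarrow> coef y u = 0 \<Longrightarrow> subst_coef n \<phi> w y = 0" for w y
    by (induction w arbitrary: y) auto
  then show ?thesis
    using \<open>vanish m x\<close> by (simp add: vanish_def coef_subst_lin)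
qed

lemma valid_subst_lin:
  assumes "\<And>a. a \<in> gens n \<Longrightarrow> valid n' (coef (\<phi> a))"
  shows "valid n' (coef (subst_lin n \<phi> x))"
proof -
  have "subst_coef n \<phi> w x = 0" if "\<not> set w \<subseteq> gens n'" for w
    using that
  proof (induction w arbitrary: x)
    case (Cons b w)
    show ?case
    proof (cases "b \<in> gens n'")
      case True
      then show ?thesis using Cons by simp
    next
      case False
      then have "coef (\<phi> a) [b] = 0" if "a \<in> gens n" for a
        using assms[OF that] by (auto simp: valid_def)
      then show ?thesis by simp
    qed
  qed simp
  then show ?thesis by (auto simp: valid_def coef_subst_lin)
qed

section \<open>The defining ideals and cabling\<close>

definition eqv :: "'r::ring_1 \<Rightarrow> 'r set \<Rightarrow> 'r \<Rightarrow> bool" (\<open>(_/ \<simeq>\<^bsub>_\<^esub> _)\<close> [51, 0, 51] 50) where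
  "x \<simeq>\<^bsub>I\<^esub> y \<longleftrightarrow> x - y \<in> I"

locale two_sided_ideal =
  fixes I :: "'r::ring_1 set"
  assumes zero: "0 \<in> I"
    and add: "x \<in> I \<Longrightarrow> y \<in> I \<Longrightarrow> x + y \<in> I"
    and lmul: "x \<in> I \<Longrightarrow> a * x \<in> I"
    and rmul: "x \<in> I \<Longrightarrow> x * a \<in> I"
begin

lemma neg: "x \<in> I \<Longrightarrow> - x \<in> I"
  using lmul[of x "-1"] by simp

lemma diff: "x \<in> I \<Longrightarrow> y \<in> I \<Longrightarrow> x - y \<in> I"
  using add[of x "- y"] neg[of y] by simp

lemma sum: "(\<And>i. i \<in> A \<Longrightarrow> f i \<in> I) \<Longrightarrow> sum f A \<in> I"
  by (induction A rule: infinite_finite_induct) (auto intro: zero add)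

lemma eqv_refl [simp, intro]: "x \<simeq>\<^bsub>I\<^esub> x"
  by (simp add: eqv_def zero)

lemma eqv_sym: "x \<simeq>\<^bsub>I\<^esub> y \<Longrightarrow> y \<simeq>\<^bsub>I\<^esub> x"
  unfolding eqv_def using neg by fastforce

lemma eqv_trans [trans]: "x \<simeq>\<^bsub>I\<^esub> y \<Longrightarrow> y \<simeq>\<^bsub>I\<^esub> z \<Longrightarrow> x \<simeq>\<^bsub>I\<^esub> z"
  unfolding eqv_def using add by fastforce

lemma eqv_add: "x \<simeq>\<^bsub>I\<^esub> y \<Longrightarrow> x' \<simeq>\<^bsub>I\<^esub> y' \<Longrightarrow> x + x' \<simeq>\<^bsub>I\<^esub> y + y'"
  unfolding eqv_def using add[of "x - y" "x' - y'"] by (simp add: algebra_simps)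

lemma eqv_diff: "x \<simeq>\<^bsub>I\<^esub> y \<Longrightarrow> x' \<simeq>\<^bsub>I\<^esub> y' \<Longrightarrow> x - x' \<simeq>\<^bsub>I\<^esub> y - y'"
  unfolding eqv_def using diff[of "x - y" "x' - y'"] by (simp add: algebra_simps)

lemma eqv_lmul: "x \<simeq>\<^bsub>I\<^esub> y \<Longrightarrow> a * x \<simeq>\<^bsub>I\<^esub> a * y"
  unfolding eqv_def using lmul[of "x - y" a] by (simp add: algebra_simps)

lemma eqv_rmul: "x \<simeq>\<^bsub>I\<^esub> y \<Longrightarrow> x * a \<simeq>\<^bsub>I\<^esub> y * a"
  unfolding eqv_def using rmul[of "x - y" a] by (simp add: algebra_simps)

lemma eqv_mult: "x \<simeq>\<^bsub>I\<^esub> y \<Longrightarrow> x' \<simeq>\<^bsub>I\<^esub> y' \<Longrightarrow> x * x' \<simeq>\<^bsub>I\<^esub> y * y'"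
  using eqv_lmul eqv_rmul eqv_trans by blast

lemma eqv_cancel:
  assumes "v * v' \<simeq>\<^bsub>I\<^esub> 1"
  shows "x * v * v' \<simeq>\<^bsub>I\<^esub> x"
  using eqv_lmul[OF assms, of x] by (simp add: mult.assoc)

text \<open>The inverse of \<open>v\<close> is \<open>u' * x\<close>, and \<open>x\<close> can be
  moved past \<open>t\<close>. Every pentagon is applied through this lemma: a factor commuting with
  a generator drops out of the conjugation of that generator.\<close>

lemma conj_eqv:
  assumes u: "u' * u \<simeq>\<^bsub>I\<^esub> 1" and v: "v * v' \<simeq>\<^bsub>I\<^esub> 1"
    and uxv: "u \<simeq>\<^bsub>I\<^esub> x * v" and xt: "x * t \<simeq>\<^bsub>I\<^esub> t * x"
  shows "u' * t * u \<simeq>\<^bsub>I\<^esub> v' * t * v"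
proof -
  have "u' * x \<simeq>\<^bsub>I\<^esub> u' * x * v * v'"
    by (rule eqv_sym, rule eqv_cancel, rule v)
  also have "u' * x * v * v' = u' * (x * v) * v'"
    by (simp add: mult.assoc)
  also have "\<dots> \<simeq>\<^bsub>I\<^esub> u' * u * v'"
    by (intro eqv_rmul eqv_lmul eqv_sym[OF uxv])
  also have "\<dots> \<simeq>\<^bsub>I\<^esub> 1 * v'"
    by (intro eqv_rmul u)
  finally have *: "u' * x \<simeq>\<^bsub>I\<^esub> v'"
    by simp
  have "u' * t * u \<simeq>\<^bsub>I\<^esub> u' * t * (x * v)"
    by (intro eqv_lmul uxv)
  also have "\<dots> = u' * (t * x) * v"
    by (simp add: mult.assoc)
  also have "\<dots> \<simeq>\<^bsub>I\<^esub> u' * (x * t) * v"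
    by (intro eqv_rmul eqv_lmul eqv_sym[OF xt])
  also have "\<dots> = u' * x * (t * v)"
    by (simp add: mult.assoc)
  also have "\<dots> \<simeq>\<^bsub>I\<^esub> v' * (t * v)"
    by (intro eqv_rmul *)
  finally show ?thesis
    by (simp add: mult.assoc)
qed

end

text \<open>Looking only at words in the generators of \<open>n\<close> strands turns the ideal of the subalgebra
  into a two-sided ideal of the whole ring of series, so that validity need not be tracked.\<close>
definition J :: "nat \<Rightarrow> nat \<Rightarrow> 'a::comm_ring_1 ser set" where
  "J n m = {x. coef (subst_lin n ser_gen x) \<in> pb_ideal n m}"

lemma valid_ser_gen: "a \<in> gens n \<Longrightarrow> valid n (coef (ser_gen a))"
  by (auto simp: valid_def coef_ser_gen split: if_splits)

lemma valid_subst_lin_ser_gen [simp]: "valid n (coef (subst_lin n ser_gen x))"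
  by (rule valid_subst_lin) (rule valid_ser_gen)

lemma subst_lin_subst_lin_ser_gen [simp]:
  assumes "\<And>a. a \<in> gens n \<Longrightarrow> linear_form (\<phi> a)"
  shows "subst_lin n \<phi> (subst_lin n ser_gen x) = subst_lin n \<phi> x"
  unfolding subst_lin_subst_lin using assms by (intro subst_lin_cong subst_lin_ser_gen)

interpretation J: two_sided_ideal "J n m" for n m
proof
  have eqs: "coef 0 = 0" "coef (x + y) = coef x + coef y" "coef (x * y) = nc_mul (coef x) (coef y)"
    for x y :: "'a ser"
    by (simp_all add: fun_eq_iff times_ser.rep_eq)
  fix x y a :: "'a ser"
  show "0 \<in> J n m"
    by (auto simp: J_def intro!: pb_ideal.deg simp: valid_def)
  show "x \<in> J n m \<Longrightarrow> y \<in> J n m \<Longrightarrow> x + y \<in> J n m"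
    by (simp add: J_def eqs pb_ideal.add)
  show "x \<in> J n m \<Longrightarrow> a * x \<in> J n m" "x \<in> J n m \<Longrightarrow> x * a \<in> J n m"
    by (simp_all add: J_def eqs pb_ideal.lmul pb_ideal.rmul)
qed

lemma J_subst_lin_ser_gen_iff [simp]: "subst_lin n ser_gen x \<in> J n m \<longleftrightarrow> x \<in> J n m"
  by (simp add: J_def linear_form_ser_gen)

lemma pb_eq_iff:
  assumes "valid n f" "valid n g"
  shows "pb_eq n m f g \<longleftrightarrow> Ser f \<simeq>\<^bsub>J n m\<^esub> Ser g"
proof -
  have "coef (Ser f - Ser g) = f - g" by (simp add: fun_eq_iff)
  then show ?thesis using assms by (simp add: pb_eq_def eqv_def J_def subst_lin_ser_gen_valid)
qed

lemma J_vanish: "vanish m x \<Longrightarrow> x \<in> J n m"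
  using vanish_subst_lin[of m x n ser_gen] by (auto simp: J_def vanish_def intro!: pb_ideal.deg)

abbreviation tgen :: "nat \<Rightarrow> nat \<Rightarrow> 'a::comm_ring_1 ser" where
  "tgen i j \<equiv> ser_gen (min i j, max i j)"

lemma Ser_T: "Ser (T i j) = tgen i j"
  by (simp add: T_def ser_gen_def)

lemma tgen_commute: "tgen i j = tgen j i"
  by (simp add: min.commute max.commute)

lemma minmax_gens: "i \<noteq> j \<Longrightarrow> {i, j} \<subseteq> {1..n} \<Longrightarrow> (min i j, max i j) \<in> gens n"
  by (auto simp: gens_def min_def max_def)

lemma Ser_comm: "Ser (comm f g) = Ser f * Ser g - Ser g * Ser f"
  by (simp add: comm_def Ser_simps)

lemma Ser_rels:
  "(Ser ` pb_rels n :: 'a::comm_ring_1 ser set) =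
     {tgen i j * tgen k l - tgen k l * tgen i j | i j k l. distinct [i, j, k, l] \<and> {i, j, k, l} \<subseteq>
         {1..n}}
   \<union> {tgen i j * (tgen i k + tgen j k) - (tgen i k + tgen j k) * tgen i j | i j k.
        distinct [i, j, k] \<and> {i, j, k} \<subseteq> {1..n}}"
proof -
  have *: "Ser (comm (T i j) (T k l)) = tgen i j * tgen k l - tgen k l * (tgen i j :: 'a ser)"
    "Ser (comm (T i j) (T i k + T j k)) = tgen i j * (tgen i k + tgen j k) - (tgen i k + tgen j k)
        * (tgen i j :: 'a ser)"
    for i j k l
    by (simp_all only: Ser_comm Ser_T Ser_simps)
  have img4: "f ` {g i j k l | i j k l. P i j k l} = {f (g i j k l) | i j k l. P i j k l}"
    for f :: "'a nc \<Rightarrow> 'a ser" and g :: "nat \<Rightarrow> nat \<Rightarrow> nat \<Rightarrow> nat \<Rightarrow> 'a nc" and P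
    by blast
  have img3: "f ` {g i j k | i j k. P i j k} = {f (g i j k) | i j k. P i j k}"
    for f :: "'a nc \<Rightarrow> 'a ser" and g :: "nat \<Rightarrow> nat \<Rightarrow> nat \<Rightarrow> 'a nc" and P
    by blast
  show ?thesis
    unfolding pb_rels_def image_Un img3 img4 * ..
qed

lemma valid_rel:
  assumes "x \<in> Ser ` pb_rels n" shows "subst_lin n ser_gen x = x"
  using assms unfolding Ser_rels
  by (auto simp: subst_lin_ser_gen minmax_gens linear_form_ser_gen simp del: tgen_commute)

lemma J_rel: "x \<in> Ser ` pb_rels n \<Longrightarrow> x \<in> J n m"
  by (auto simp: J_def valid_rel intro: pb_ideal.rel)

lemma J_rel4:
  assumes "distinct [i, j, k, l]" "{i, j, k, l} \<subseteq> {1..n}"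
  shows "tgen i j * tgen k l - tgen k l * tgen i j \<in> J n m"
  by (rule J_rel, unfold Ser_rels, rule UnI1, rule CollectI,
      intro exI conjI, rule refl, fact+)

lemma J_rel3:
  assumes "distinct [i, j, k]" "{i, j, k} \<subseteq> {1..n}"
  shows "tgen i j * (tgen i k + tgen j k) - (tgen i k + tgen j k) * tgen i j \<in> J n m"
  by (rule J_rel, unfold Ser_rels, rule UnI2, rule CollectI,
      intro exI conjI, rule refl, fact+)

text \<open>Rule induction on \<open>pb_ideal\<close>, with the closure conditions packed into the
  ideal \<open>K\<close>. The conclusion is about the projection of \<open>x\<close> because
  \<open>J\<close> does not constrain words with other letters.\<close>

lemma J_induct:
  assumes x: "x \<in> J n m" and K: "two_sided_ideal K"
    and vanish: "\<And>x. vanish m x \<Longrightarrow> x \<in> K" and rel: "Ser ` pb_rels n \<subseteq> K"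
  shows "subst_lin n ser_gen x \<in> K"
proof -
  interpret K: two_sided_ideal K by fact
  have "Ser f \<in> K" if "f \<in> pb_ideal n m" for f
    using that
  proof induction
    case (deg f)
    then show ?case by (intro vanish) (simp add: vanish_def)
  next
    case (add f g)
    then show ?case by (simp only: Ser_simps K.add)
  qed (use rel in \<open>auto simp: Ser_simps K.lmul K.rmul\<close>)
  then show ?thesis
    using x by (force simp: J_def coef_inverse)
qed

lemma J_const: "x \<in> J n m \<Longrightarrow> coef x [] = 0"
proof -
  assume "x \<in> J n m"
  then have "subst_lin n ser_gen x \<in> {x. coef x [] = 0}"
  proof (rule J_induct)
    show "Ser ` pb_rels n \<subseteq> {x. coef x [] = 0}"
      unfolding Ser_rels by (auto simp: coef_ser_gen)
  qed (unfold_locales, auto simp: vanish_def)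
  then show ?thesis by simp
qed

lemma J_mono:
  fixes x :: "'a::comm_ring_1 ser"
  assumes "k \<le> m" "x \<in> J n m" shows "x \<in> J n k"
proof -
  have "subst_lin n ser_gen x \<in> J n k"
    using assms(2) J.two_sided_ideal_axioms
  proof (rule J_induct)
    show "x \<in> J n k" if "vanish m x" for x :: "'a ser"
      using that assms(1) by (intro J_vanish) (simp add: vanish_def)
  qed (intro subsetI J_rel)
  then show ?thesis by simp
qed

lemma vanish_mult:
  assumes "coef a [] = 0" "vanish k x"
  shows "vanish (Suc k) (a * x)" "vanish (Suc k) (x * a)"
proof -
  have "coef a (take i w) * coef x (drop i w) = 0" if "length w \<le> Suc k" for i w
    using assms that by (cases i) (auto simp: vanish_def)
  then show "vanish (Suc k) (a * x)"
    unfolding vanish_def coef_mult by (auto intro: sum.neutral)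
  have "coef x (take i w) * coef a (drop i w) = 0" if "length w \<le> Suc k" "i \<le> length w" for i w
    using assms that by (cases "i = length w") (auto simp: vanish_def)
  then show "vanish (Suc k) (x * a)"
    unfolding vanish_def coef_mult by (auto intro: sum.neutral)
qed

text \<open>Relators lie in \<open>J\<close> at every level, and a factor without constant term
  moves terms of degree above \<open>k\<close> to degree above \<open>Suc k\<close>. The series with
  both properties form a two-sided ideal, so generators suffice.\<close>

lemma J_raise:
  fixes x :: "'a::comm_ring_1 ser"
  assumes "x \<in> J n k" "coef a [] = 0"
  shows "a * x \<in> J n (Suc k)" "x * a \<in> J n (Suc k)"
proof -
  let ?K = "{x :: 'a ser. \<forall>a. coef a [] = 0 \<longrightarrow> a * x \<in> J n (Suc k) \<and> x * a \<in> J n (Suc k)}"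
  have "subst_lin n ser_gen x \<in> ?K"
    using assms(1)
  proof (rule J_induct)
    have lmul: "b * x \<in> ?K" if x: "x \<in> ?K" for b x :: "'a ser"
    proof (intro CollectI allI impI conjI)
      fix a :: "'a ser" assume a: "coef a [] = 0"
      then have "(a * b) * x \<in> J n (Suc k)"
        using x by simp
      then show "a * (b * x) \<in> J n (Suc k)" by (simp add: mult.assoc)
      have "b * (x * a) \<in> J n (Suc k)"
        using x a by (simp add: J.lmul)
      then show "b * x * a \<in> J n (Suc k)" by (simp add: mult.assoc)
    qed
    have rmul: "x * b \<in> ?K" if x: "x \<in> ?K" for b x :: "'a ser"
    proof (intro CollectI allI impI conjI)
      fix a :: "'a ser" assume a: "coef a [] = 0"
      then have "x * (b * a) \<in> J n (Suc k)"
        using x by simp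
      then show "x * b * a \<in> J n (Suc k)" by (simp add: mult.assoc)
      have "a * x * b \<in> J n (Suc k)"
        using x a by (simp add: J.rmul)
      then show "a * (x * b) \<in> J n (Suc k)"
        by (simp add: mult.assoc)
    qed
    show "two_sided_ideal ?K"
      by (rule two_sided_ideal.intro, simp add: J.zero, simp add: algebra_simps J.add,
          erule lmul, erule rmul)
    show "Ser ` pb_rels n \<subseteq> ?K"
      by (intro subsetI CollectI allI impI conjI J.lmul J.rmul J_rel)
    show "x \<in> ?K" if "vanish k x" for x
      using that by (intro CollectI allI impI conjI J_vanish vanish_mult)
  qed
  then have "a * subst_lin n ser_gen x \<in> J n (Suc k)" "subst_lin n ser_gen x * a \<in> J n (Suc k)"
    using assms(2) by auto
  then show "a * x \<in> J n (Suc k)" "x * a \<in> J n (Suc k)"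
    by (simp_all add: J_def linear_form_ser_gen)
qed

text \<open>The correction consists of products of \<open>x\<close> with \<open>u - 1\<close> and
  \<open>v - 1\<close>, which have no constant term.\<close>

lemma J_conj_raise:
  assumes "x \<in> J n k" "coef u [] = 1" "coef v [] = 1"
  shows "u * x * v \<simeq>\<^bsub>J n (Suc k)\<^esub> x"
proof -
  have "u * x * v - x = (u - 1) * x * v + x * (v - 1)"
    by (simp add: algebra_simps)
  also have "\<dots> \<in> J n (Suc k)"
    using assms by (intro J.add J.rmul J_raise) auto
  finally show ?thesis by (simp add: eqv_def)
qed

lemma subst_lin_J:
  assumes "\<And>a. a \<in> gens n' \<Longrightarrow> linear_form (\<phi> a)"
    and "\<And>r. r \<in> Ser ` pb_rels n' \<Longrightarrow> subst_lin n' \<phi> r \<in> J n m"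
    and "x \<in> J n' m"
  shows "subst_lin n' \<phi> x \<in> J n m"
proof -
  have "subst_lin n' ser_gen x \<in> {x. subst_lin n' \<phi> x \<in> J n m}"
    using assms(3)
  proof (rule J_induct)
    show "two_sided_ideal {x. subst_lin n' \<phi> x \<in> J n m}"
      by unfold_locales (auto simp: J.zero J.add J.lmul J.rmul)
    show "Ser ` pb_rels n' \<subseteq> {x. subst_lin n' \<phi> x \<in> J n m}"
      by (intro subsetI CollectI assms(2))
  qed (intro CollectI J_vanish vanish_subst_lin)
  then show ?thesis
    using assms(1) by simp
qed

section \<open>Bundles of strands and cabling\<close>

definition tsum :: "nat set \<Rightarrow> nat set \<Rightarrow> 'a::comm_ring_1 ser" where
  "tsum A B = (\<Sum>i\<in>A. \<Sum>j\<in>B. tgen i j)"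

lemma linear_form_tsum [simp]: "linear_form (tsum A B)"
  by (auto simp: tsum_def intro!: linear_form_sum linear_form_ser_gen)

lemma tsum_commute: "tsum A B = tsum B A"
  unfolding tsum_def by (subst sum.swap) (intro sum.cong refl tgen_commute)

lemma tsum_singleton: "tsum {i} {j} = tgen i j"
  by (simp add: tsum_def)

lemma valid_tsum:
  assumes "A \<subseteq> {1..n}" "B \<subseteq> {1..n}" "A \<inter> B = {}"
  shows "subst_lin n ser_gen (tsum A B) = tsum A B"
  unfolding tsum_def subst_lin_sum
  by (intro sum.cong refl subst_lin_ser_gen minmax_gens linear_form_ser_gen) (use assms in auto)

lemma comm_J:
  assumes "x * y - y * x \<in> J n m" "x * z - z * x \<in> J n m"
  shows "x * (y + z) - (y + z) * x \<in> J n m"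
  using J.add[OF assms] by (simp add: algebra_simps)

lemma comm_sum:
  "x * sum f A - sum f A * x = (\<Sum>i\<in>A. x * f i - f i * x)" for x :: "'r::ring_1"
  by (simp add: sum_distrib_left sum_distrib_right sum_subtractf)

lemma comm_sum_left:
  "sum f A * x - x * sum f A = (\<Sum>i\<in>A. f i * x - x * f i)" for x :: "'r::ring_1"
  by (simp add: sum_distrib_left sum_distrib_right sum_subtractf)

lemma tsum_disjoint_comm:
  assumes "A \<union> B \<union> C \<union> D \<subseteq> {1..n}"
    "A \<inter> B = {}" "A \<inter> C = {}" "A \<inter> D = {}" "B \<inter> C = {}" "B \<inter> D = {}" "C \<inter> D = {}"
  shows "tsum A B * tsum C D - tsum C D * tsum A B \<in> J n m"
proof -
  have "tgen i j * tgen k l - tgen k l * tgen i j \<in> J n m"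
    if "i \<in> A" "j \<in> B" "k \<in> C" "l \<in> D" for i j k l
  proof (rule J_rel4)
    have "i \<noteq> j" "i \<noteq> k" "i \<noteq> l" "j \<noteq> k" "j \<noteq> l" "k \<noteq> l"
      using that assms(2-) by blast+
    then show "distinct [i, j, k, l]" by simp
    show "{i, j, k, l} \<subseteq> {1..n}"
      using that assms(1) by blast
  qed
  then show ?thesis
    unfolding tsum_def comm_sum comm_sum_left by (intro J.sum)
qed

text \<open>For fixed \<open>i\<close> in \<open>A\<close> and \<open>j\<close> in \<open>B\<close>,
  the chords from \<open>i\<close> and \<open>j\<close> to each \<open>k\<close> in \<open>C\<close>
  form a defining relation, and the chords from the rest of \<open>A\<close> and \<open>B\<close> to
  \<open>C\<close> share no strand with \<open>i\<close>, \<open>j\<close>.\<close>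

lemma tsum_triple_comm:
  assumes "A \<union> B \<union> C \<subseteq> {1..n}" "A \<inter> B = {}" "A \<inter> C = {}" "B \<inter> C = {}"
  shows "tsum A B * (tsum A C + tsum B C) - (tsum A C + tsum B C) * tsum A B \<in> J n m"
proof -
  have "tgen i j * (tsum A C + tsum B C) - (tsum A C + tsum B C) * tgen i j \<in> J n m"
    if ij: "i \<in> A" "j \<in> B" for i j
  proof -
    have fin: "finite A" "finite B"
      using assms(1) finite_subset[of _ "{1..n}"] by auto
    have eq: "tsum A C + tsum B C = (\<Sum>k\<in>C. tgen i k + tgen j k) + (tsum (A - {i}) C + tsum (B -
        {j}) C)"
    proof -
      have A: "tsum A C = (\<Sum>k\<in>C. tgen i k) + tsum (A - {i}) C"
        and B: "tsum B C = (\<Sum>k\<in>C. tgen j k) + tsum (B - {j}) C"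
        unfolding tsum_def using ij fin by (simp_all only: sum.remove)
      show ?thesis
        unfolding A B sum.distrib by (simp only: add_ac)
    qed
    have "tgen i j * (\<Sum>k\<in>C. tgen i k + tgen j k) - (\<Sum>k\<in>C. tgen i k + tgen j k) * tgen i j \<in> J n m"
      unfolding comm_sum
    proof (intro J.sum)
      fix k
      assume "k \<in> C"
      then have "distinct [i, j, k]" "{i, j, k} \<subseteq> {1..n}"
        using assms ij by auto
      then show "tgen i j * (tgen i k + tgen j k) - (tgen i k + tgen j k) * tgen i j \<in> J n m"
        by (rule J_rel3)
    qed
    moreover have "tgen i j * tsum (A - {i}) C - tsum (A - {i}) C * tgen i j \<in> J n m"
      "tgen i j * tsum (B - {j}) C - tsum (B - {j}) C * tgen i j \<in> J n m"
      unfolding tsum_singleton[symmetric] using assms ij by (intro tsum_disjoint_comm; blast)+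
    ultimately show ?thesis
      unfolding eq by (intro comm_J)
  qed
  then show ?thesis
    unfolding tsum_def[of A B] comm_sum_left by (intro J.sum)
qed

text \<open>Replaces strand \<open>i\<close> by the bundle of strands \<open>bl i\<close>. Permutations and the maps \<open>d\<^sub>i\<close>
  are special cases.\<close>
definition cable :: "nat \<Rightarrow> (nat \<Rightarrow> nat set) \<Rightarrow> 'a::comm_ring_1 ser \<Rightarrow> 'a ser" where
  "cable n bl = subst_lin n (\<lambda>(i, j). tsum (bl i) (bl j))"

lemma cable_simps [simp]:
  "cable n bl (x + y) = cable n bl x + cable n bl y" "cable n bl (x - y) = cable n bl x - cable n
      bl y"
  "cable n bl (x * y) = cable n bl x * cable n bl y" "cable n bl 1 = 1" "cable n bl 0 = 0"
  "cable n bl (const_ser c) = const_ser c" "cable n bl (sum f A) = (\<Sum>a\<in>A. cable n bl (f a))"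
  "cable n bl (x ^ k) = cable n bl x ^ k" "coef (cable n bl x) [] = coef x []"
  by (simp_all add: cable_def)

lemma cable_tgen:
  assumes "i \<noteq> j" "{i, j} \<subseteq> {1..n}"
  shows "cable n bl (tgen i j) = tsum (bl i) (bl j)"
  unfolding cable_def using minmax_gens[OF assms] assms
  by (subst subst_lin_ser_gen) (auto simp: min_def max_def tsum_commute)

definition blocks :: "nat \<Rightarrow> nat \<Rightarrow> (nat \<Rightarrow> nat set) \<Rightarrow> bool" where
  "blocks n k bl \<longleftrightarrow> (\<forall>i\<in>{1..k}. bl i \<subseteq> {1..n}) \<and>
     (\<forall>i\<in>{1..k}. \<forall>j\<in>{1..k}. i \<noteq> j \<longrightarrow> bl i \<inter> bl j = {})"

lemma blocks_subset: "blocks n k bl \<Longrightarrow> i \<in> {1..k} \<Longrightarrow> bl i \<subseteq> {1..n}"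
  unfolding blocks_def by simp

lemma blocks_disjoint:
  "blocks n k bl \<Longrightarrow> i \<in> {1..k} \<Longrightarrow> j \<in> {1..k} \<Longrightarrow> i \<noteq> j \<Longrightarrow> bl i \<inter> bl j = {}"
  unfolding blocks_def by simp

text \<open>Disjoint bundles satisfy the same two kinds of relations as single strands, by
  \<open>tsum_disjoint_comm\<close> and \<open>tsum_triple_comm\<close>.\<close>

lemma cable_J:
  assumes bl: "blocks n n' bl" and x: "x \<in> J n' m"
  shows "cable n' bl x \<in> J n m"
  unfolding cable_def
proof (rule subst_lin_J[OF _ _ x])
  fix r :: "'a ser"
  assume "r \<in> Ser ` pb_rels n'"
  then consider (1) i j k l where "r = tgen i j * tgen k l - tgen k l * tgen i j"
      "distinct [i, j, k, l]" "{i, j, k, l} \<subseteq> {1..n'}"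
    | (2) i j k where "r = tgen i j * (tgen i k + tgen j k) - (tgen i k + tgen j k) * tgen i j"
      "distinct [i, j, k]" "{i, j, k} \<subseteq> {1..n'}"
    unfolding Ser_rels by (elim UnE CollectE exE conjE) (rule that(1) that(2); assumption)+
  then have "cable n' bl r \<in> J n m"
  proof cases
    case 1
    then have "cable n' bl r = tsum (bl i) (bl j) * tsum (bl k) (bl l) - tsum (bl k) (bl l) * tsum
        (bl i) (bl j)"
      by (simp add: cable_tgen)
    also have "\<dots> \<in> J n m"
      using 1 by (intro tsum_disjoint_comm Un_least blocks_subset[OF bl] blocks_disjoint[OF bl])
          simp_all
    finally show ?thesis .
  next
    case 2
    then have "cable n' bl r = tsum (bl i) (bl j) * (tsum (bl i) (bl k) + tsum (bl j) (bl k))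
        - (tsum (bl i) (bl k) + tsum (bl j) (bl k)) * tsum (bl i) (bl j)"
      by (simp add: cable_tgen)
    also have "\<dots> \<in> J n m"
      using 2 by (intro tsum_triple_comm Un_least blocks_subset[OF bl] blocks_disjoint[OF bl])
          simp_all
    finally show ?thesis .
  qed
  then show "subst_lin n' (\<lambda>(i, j). tsum (bl i) (bl j)) r \<in> J n m"
    by (simp add: cable_def)
qed (auto split: prod.splits)

lemma cable_tsum:
  fixes bl :: "nat \<Rightarrow> nat set"
  assumes bl: "blocks n' n bl" and AB: "A \<subseteq> {1..n}" "B \<subseteq> {1..n}" "A \<inter> B = {}"
  shows "cable n bl (tsum A B) = (tsum (\<Union>(bl ` A)) (\<Union>(bl ` B)) :: 'a::comm_ring_1 ser)"
proof -
  have fin: "finite (bl i)" if "i \<in> {1..n}" for i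
    using blocks_subset[OF bl that] finite_subset by blast
  have U: "(\<Sum>p\<in>\<Union>(bl ` A). f p) = (\<Sum>i\<in>A. \<Sum>p\<in>bl i. f p)" if "A \<subseteq> {1..n}" for A
    and f :: "nat \<Rightarrow> 'a ser"
  proof (rule sum.UNION_disjoint)
    show "finite A" using that finite_subset by blast
    show "\<forall>i\<in>A. finite (bl i)" using that fin by blast
    show "\<forall>i\<in>A. \<forall>j\<in>A. i \<noteq> j \<longrightarrow> bl i \<inter> bl j = {}"
      using that blocks_disjoint[OF bl] by blast
  qed
  have "cable n bl (tsum A B) = (\<Sum>i\<in>A. \<Sum>j\<in>B. tsum (bl i) (bl j) :: 'a ser)"
    unfolding tsum_def[of A B] cable_simps
    by (intro sum.cong refl cable_tgen) (use AB in auto)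
  also have "\<dots> = (\<Sum>i\<in>A. tsum (bl i) (\<Union>(bl ` B)))"
    unfolding tsum_def U[OF AB(2)] by (rule sum.cong, rule refl, rule sum.swap)
  also have "\<dots> = tsum (\<Union>(bl ` A)) (\<Union>(bl ` B))"
    unfolding tsum_def U[OF AB(1)] ..
  finally show ?thesis .
qed

lemma cable_cable:
  assumes "blocks n' n2 bl2" "blocks n2 n1 bl1"
  shows "cable n2 bl2 (cable n1 bl1 x) = cable n1 (\<lambda>i. \<Union>(bl2 ` bl1 i)) x"
proof -
  have "cable n2 bl2 (cable n1 bl1 x) = subst_lin n1 (\<lambda>a. cable n2 bl2 (case a of (i, j) \<Rightarrow> tsum
      (bl1 i) (bl1 j))) x"
    unfolding cable_def subst_lin_subst_lin ..
  also have "\<dots> = cable n1 (\<lambda>i. \<Union>(bl2 ` bl1 i)) x"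
    unfolding cable_def[of n1]
  proof (intro subst_lin_cong)
    fix a
    assume "a \<in> gens n1"
    then obtain i j where a: "a = (i, j)" "i \<in> {1..n1}" "j \<in> {1..n1}" "i \<noteq> j"
      by (auto simp: gens_def)
    note bl = blocks_subset[OF assms(2) a(2)] blocks_subset[OF assms(2) a(3)]
      blocks_disjoint[OF assms(2) a(2,3,4)]
    then show "cable n2 bl2 (case a of (i, j) \<Rightarrow> tsum (bl1 i) (bl1 j)) =
        (case a of (i, j) \<Rightarrow> tsum (\<Union> (bl2 ` bl1 i)) (\<Union> (bl2 ` bl1 j)))"
      using a assms(1) by (simp add: cable_tsum)
  qed
  finally show ?thesis .
qed

lemma cable_cong:
  assumes "\<And>i. i \<in> {1..n} \<Longrightarrow> bl i = bl' i"
  shows "cable n bl x = cable n bl' x"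
  unfolding cable_def using assms by (intro subst_lin_cong) (auto simp: gens_def)

lemma cable_id: "valid n (coef x) \<Longrightarrow> cable n (\<lambda>i. {i}) x = x"
proof -
  assume "valid n (coef x)"
  have "cable n (\<lambda>i. {i}) x = subst_lin n ser_gen x"
    unfolding cable_def by (intro subst_lin_cong) (auto simp: gens_def tsum_singleton min_def
        max_def)
  then show ?thesis
    using \<open>valid n (coef x)\<close> by (simp add: subst_lin_ser_gen_valid)
qed

text \<open>Finite support bounds the degree, so splitting off first letters terminates. An ideal
  need not be closed under infinite sums, so commutation modulo an ideal is proved through this
  induction.\<close>

lemma bounded_degree_induct [consumes 2, case_names const_ser lmul add]:
  assumes "nc_poly (coef x)" "valid n (coef x)"
    and "\<And>c. P (const_ser c)"
    and "\<And>a y. a \<in> gens n \<Longrightarrow> P y \<Longrightarrow> P (ser_gen a * y)"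
    and "\<And>y z. P y \<Longrightarrow> P z \<Longrightarrow> P (y + z)"
  shows "P x"
proof -
  have "finite (length ` {w. coef x w \<noteq> 0})"
    using assms(1) by (simp add: nc_poly_def)
  then obtain d where "\<forall>k\<in>length ` {w. coef x w \<noteq> 0}. k < d"
    using finite_nat_set_iff_bounded by blast
  then have "\<forall>w. d \<le> length w \<longrightarrow> coef x w = 0"
    by (metis (mono_tags, lifting) image_eqI leD mem_Collect_eq)
  then show ?thesis
    using assms(2)
  proof (induction d arbitrary: x)
    case 0
    then have "x = const_ser 0" by (intro ser_eqI) simp
    then show ?case using assms(3) by metis
  next
    case (Suc d)
    have "set u \<subseteq> gens n" if "coef x (a # u) \<noteq> 0" for a u
      using that Suc.prems(2) unfolding valid_def by (metis set_subset_Cons subset_trans)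
    then have "P (ser_gen a * lquot a x)" if "a \<in> gens n" for a
      using that Suc.prems by (intro assms(4) Suc.IH) (auto simp: valid_def)
    then have "P (\<Sum>a\<in>A. ser_gen a * lquot a x)" if "A \<subseteq> gens n" for A
      using that
      by (induction A rule: infinite_finite_induct)
        (use assms(3)[of 0] in \<open>auto intro: assms(5)\<close>)
    then have "P (const_ser (coef x []) + (\<Sum>a\<in>gens n. ser_gen a * lquot a x))"
      by (intro assms(3,5)) blast
    then show ?case
      using ser_decomp[OF Suc.prems(2)] by metis
  qed
qed

lemma subst_lin_commutes:
  assumes "two_sided_ideal I" "nc_poly (coef x)" "valid n (coef x)"
    and "\<And>a. a \<in> gens n \<Longrightarrow> linear_form (\<phi> a)"
    and "\<And>a. a \<in> gens n \<Longrightarrow> \<phi> a * z \<simeq>\<^bsub>I\<^esub> z * \<phi> a"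
  shows "subst_lin n \<phi> x * z \<simeq>\<^bsub>I\<^esub> z * subst_lin n \<phi> x"
proof -
  interpret I: two_sided_ideal I by fact
  from assms(2,3) show ?thesis
  proof (induction rule: bounded_degree_induct)
    case (const_ser c)
    then show ?case by (simp add: const_ser_commute)
  next
    case (lmul a y)
    have "\<phi> a * subst_lin n \<phi> y * z \<simeq>\<^bsub>I\<^esub> \<phi> a * (z * subst_lin n \<phi> y)"
      using lmul by (simp add: mult.assoc I.eqv_lmul)
    also have "\<dots> = \<phi> a * z * subst_lin n \<phi> y"
      by (simp add: mult.assoc)
    also have "\<dots> \<simeq>\<^bsub>I\<^esub> z * \<phi> a * subst_lin n \<phi> y"
      using lmul assms(5) by (simp add: I.eqv_rmul)
    finally show ?case
      using lmul assms(4) by (simp add: subst_lin_ser_gen mult.assoc)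
  next
    case (add y z)
    then show ?case by (simp add: algebra_simps I.eqv_add)
  qed
qed

section \<open>Three bundles: composition and centralisers\<close>

definition blocks3 :: "nat set \<Rightarrow> nat set \<Rightarrow> nat set \<Rightarrow> nat \<Rightarrow> nat set" where
  "blocks3 A B C i = (if i = 1 then A else if i = 2 then B else C)"

definition cable3 :: "nat set \<Rightarrow> nat set \<Rightarrow> nat set \<Rightarrow> 'a::comm_ring_1 ser \<Rightarrow> 'a ser" where
  "cable3 A B C = cable 3 (blocks3 A B C)"

definition disj3 :: "nat \<Rightarrow> nat set \<Rightarrow> nat set \<Rightarrow> nat set \<Rightarrow> bool" where
  "disj3 n A B C \<longleftrightarrow> A \<union> B \<union> C \<subseteq> {1..n} \<and> A \<inter> B = {} \<and> A \<inter> C = {} \<and> B \<inter> C = {}"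

lemma Icc3: "{1..3::nat} = {1, 2, 3}" and Icc4: "{1..4::nat} = {1, 2, 3, 4}"
  by auto

lemma blocks_blocks3: "disj3 n A B C \<Longrightarrow> blocks n 3 (blocks3 A B C)"
  unfolding blocks_def disj3_def Icc3 by (simp add: blocks3_def Int_commute)

lemma cable3_simps [simp]:
  "cable3 A B C (x + y) = cable3 A B C x + cable3 A B C y" "cable3 A B C (x - y) = cable3 A B C x
      - cable3 A B C y"
  "cable3 A B C (x * y) = cable3 A B C x * cable3 A B C y" "cable3 A B C 1 = 1" "cable3 A B C 0 = 0"
  "cable3 A B C (const_ser c) = const_ser c" "cable3 A B C (sum f S) = (\<Sum>a\<in>S. cable3 A B C (f a))"
  "cable3 A B C (x ^ k) = cable3 A B C x ^ k" "coef (cable3 A B C x) [] = coef x []"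
  by (simp_all add: cable3_def)

text \<open>Both numeral forms of the generator on strands 1 and 2 are listed, since rewriting
  matches them syntactically.\<close>

lemma cable3_tgen [simp]:
  "cable3 A B C (ser_gen (Suc 0, 2)) = tsum A B" "cable3 A B C (ser_gen (Suc 0, Suc (Suc 0))) =
      tsum A B" "cable3 A B C (ser_gen (Suc 0, 3)) = tsum A C"
  "cable3 A B C (ser_gen (2, 3)) = tsum B C"
  using cable_tgen[of 1 2 3 "blocks3 A B C"] cable_tgen[of 1 3 3 "blocks3 A B C"] cable_tgen[of 2
      3 3 "blocks3 A B C"]
  by (simp_all add: cable3_def blocks3_def eval_nat_numeral)

lemma cable3_J: "disj3 n A B C \<Longrightarrow> x \<in> J 3 m \<Longrightarrow> cable3 A B C x \<in> J n m"
  unfolding cable3_def by (intro cable_J blocks_blocks3)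

lemma cable3_eqv: "disj3 n A B C \<Longrightarrow> x \<simeq>\<^bsub>J 3 m\<^esub> y \<Longrightarrow> cable3 A B C x \<simeq>\<^bsub>J n m\<^esub> cable3 A B C y"
  using cable3_J[of n A B C "x - y" m] by (simp add: eqv_def)

lemma cable_cable3:
  assumes "blocks n' n bl" "disj3 n A B C"
  shows "cable n bl (cable3 A B C x) = cable3 (\<Union>(bl ` A)) (\<Union>(bl ` B)) (\<Union>(bl ` C)) x"
  unfolding cable3_def using assms by (subst cable_cable[OF _ blocks_blocks3]; (intro
      cable_cong)?) (auto simp: blocks3_def)

lemma cable3_cable3:
  assumes "disj3 n A B C" "disj3 3 A' B' C'"
  shows "cable3 A B C (cable3 A' B' C' x) =
    cable3 (\<Union>(blocks3 A B C ` A')) (\<Union>(blocks3 A B C ` B')) (\<Union>(blocks3 A B C ` C')) x"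
  using cable_cable3[OF blocks_blocks3[OF assms(1)] assms(2)] by (simp add: cable3_def)

lemma cable3_132:
  "disj3 n A B C \<Longrightarrow> cable3 A B C (cable3 {Suc 0} {3} {2} x) = cable3 A C B x"
  by (subst cable3_cable3[of n]) (simp_all add: disj3_def blocks3_def)

lemma cable3_312:
  "disj3 n A B C \<Longrightarrow> cable3 A B C (cable3 {3} {Suc 0} {2} x) = cable3 C A B x"
  by (subst cable3_cable3[of n]) (simp_all add: disj3_def blocks3_def)

lemma cable3_id:
  assumes "valid 3 (coef x)" shows "cable3 {Suc 0} {2} {3} x = x"
proof -
  have "cable3 {Suc 0} {2} {3} x = cable 3 (\<lambda>i. {i}) x"
    unfolding cable3_def by (rule cable_cong) (auto simp: blocks3_def)
  then show ?thesis using assms by (simp add: cable_id)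
qed

lemma tsum_Un:
  assumes "finite A" "finite B" "A \<inter> B = {}"
  shows "tsum (A \<union> B) C = tsum A C + tsum B C" "tsum C (A \<union> B) = tsum C A + tsum C B"
proof -
  show *: "tsum (A \<union> B) C = tsum A C + tsum B C"
    unfolding tsum_def using assms by (rule sum.union_disjoint)
  then show "tsum C (A \<union> B) = tsum C A + tsum C B"
    using tsum_commute by metis
qed

lemma cable3_commutes:
  assumes x: "nc_poly (coef x)" "valid 3 (coef x)"
    and z: "tsum A B * z \<simeq>\<^bsub>J n m\<^esub> z * tsum A B" "tsum A C * z \<simeq>\<^bsub>J n m\<^esub> z * tsum A C"
      "tsum B C * z \<simeq>\<^bsub>J n m\<^esub> z * tsum B C"
  shows "cable3 A B C x * z \<simeq>\<^bsub>J n m\<^esub> z * cable3 A B C x"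
  unfolding cable3_def cable_def
proof (rule subst_lin_commutes[OF J.two_sided_ideal_axioms x])
  fix a assume "a \<in> gens 3"
  then have "a \<in> {(1, 2), (1, 3), (2, 3)}"
    by (auto simp: gens_def)
  then show "(case a of (i, j) \<Rightarrow> tsum (blocks3 A B C i) (blocks3 A B C j)) * z
      \<simeq>\<^bsub>J n m\<^esub> z * (case a of (i, j) \<Rightarrow> tsum (blocks3 A B C i) (blocks3 A B C j))"
    using z by (auto simp: blocks3_def)
qed (auto split: prod.splits)

text \<open>A chord inside a bundle commutes with chords leaving the whole bundle (triple relation)
  and with chords elsewhere (disjointness). In a pentagon this frees the factor in which strand 1 is
  bundled with another strand.\<close>

lemma cable3_commutes_inside:
  fixes x :: "'a::comm_ring_1 ser"
  assumes x: "nc_poly (coef x)" "valid 3 (coef x)"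
    and AA: "A \<union> A' \<union> B \<union> C \<subseteq> {1..n}" "A \<inter> A' = {}" "A \<inter> B = {}" "A \<inter> C = {}"
      "A' \<inter> B = {}" "A' \<inter> C = {}" "B \<inter> C = {}"
  shows "cable3 (A \<union> A') B C x * tsum A A' \<simeq>\<^bsub>J n m\<^esub> tsum A A' * cable3 (A \<union> A') B C x"
proof (rule cable3_commutes[OF x])
  have fin: "finite A" "finite A'"
    using AA(1) finite_subset[of _ "{1..n}"] by simp_all
  have *: "tsum (A \<union> A') D * (tsum A A' :: 'a ser) \<simeq>\<^bsub>J n m\<^esub> tsum A A' * tsum (A \<union> A') D"
    if "D \<subseteq> {1..n}" "A \<inter> D = {}" "A' \<inter> D = {}" for D
    unfolding tsum_Un[OF fin AA(2)]
  proof (rule J.eqv_sym)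
    show "(tsum A A' :: 'a ser) * (tsum A D + tsum A' D) \<simeq>\<^bsub>J n m\<^esub> (tsum A D + tsum A' D) * tsum A
        A'"
      unfolding eqv_def by (rule tsum_triple_comm) (use that AA(1,2) in simp_all)
  qed
  from * show "tsum (A \<union> A') B * (tsum A A' :: 'a ser) \<simeq>\<^bsub>J n m\<^esub> tsum A A' * tsum (A \<union> A') B"
    "tsum (A \<union> A') C * (tsum A A' :: 'a ser) \<simeq>\<^bsub>J n m\<^esub> tsum A A' * tsum (A \<union> A') C"
    using AA by simp_all
  show "(tsum B C :: 'a ser) * tsum A A' \<simeq>\<^bsub>J n m\<^esub> tsum A A' * tsum B C"
    unfolding eqv_def by (rule tsum_disjoint_comm) (use AA in \<open>simp_all add: Int_commute\<close>)
qed

text \<open>A chord between two of the bundles commutes with the chords from \<open>D\<close> to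
  these two together (triple relation) and with those from \<open>D\<close> to the third
  (disjointness), hence with the total.\<close>

lemma cable3_commutes_outside:
  fixes x :: "'a::comm_ring_1 ser"
  assumes x: "nc_poly (coef x)" "valid 3 (coef x)"
    and D: "disj3 n A B C" "D \<subseteq> {1..n}" "D \<inter> A = {}" "D \<inter> B = {}" "D \<inter> C = {}"
  shows "cable3 A B C x * (tsum D A + tsum D B + tsum D C) \<simeq>\<^bsub>J n m\<^esub> (tsum D A + tsum D B + tsum D
      C) * cable3 A B C x"
proof (rule cable3_commutes[OF x])
  have *: "(tsum X Y :: 'a ser) * (tsum D X + tsum D Y + tsum D Z) \<simeq>\<^bsub>J n m\<^esub> (tsum D X + tsum D Y +
      tsum D Z) * tsum X Y"
    if "disj3 n X Y Z" "D \<inter> X = {}" "D \<inter> Y = {}" "D \<inter> Z = {}" for X Y Z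
  proof -
    have "tsum X Y * (tsum X D + tsum Y D) - (tsum X D + tsum Y D) * tsum X Y \<in> J n m"
      by (rule tsum_triple_comm) (use that D(2) in \<open>simp_all add: disj3_def Int_commute\<close>)
    moreover have "tsum X Y * tsum D Z - tsum D Z * tsum X Y \<in> J n m"
      by (rule tsum_disjoint_comm) (use that D(2) in \<open>simp_all add: disj3_def Int_commute\<close>)
    ultimately show ?thesis
      unfolding eqv_def tsum_commute[of D X] tsum_commute[of D Y] by (rule comm_J)
  qed
  show "(tsum A B :: 'a ser) * (tsum D A + tsum D B + tsum D C) \<simeq>\<^bsub>J n m\<^esub> (tsum D A + tsum D B +
      tsum D C) * tsum A B"
    using D by (intro *) auto
  show "(tsum A C :: 'a ser) * (tsum D A + tsum D B + tsum D C) \<simeq>\<^bsub>J n m\<^esub> (tsum D A + tsum D B +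
      tsum D C) * tsum A C"
    using *[of A C B] D by (simp add: disj3_def Int_commute Un_commute Un_left_commute add_ac)
  show "(tsum B C :: 'a ser) * (tsum D A + tsum D B + tsum D C) \<simeq>\<^bsub>J n m\<^esub> (tsum D A + tsum D B +
      tsum D C) * tsum B C"
    using *[of B C A] D by (simp add: disj3_def Int_commute Un_commute Un_left_commute add_ac)
qed

section \<open>The cabling defect\<close>

text \<open>\<open>g\<close> is Gamma and \<open>h\<close> its inverse. In \<open>pent\<close> the
  cablings are, in order, d_4, d_2, d_0 on the left and d_1, d_3 on the right.\<close>

locale pentagon_hexagon =
  fixes m :: nat and g h :: "'a::comm_ring_1 ser"
  assumes g: "nc_poly (coef g)" "valid 3 (coef g)" and h: "valid 3 (coef h)"
    and gh: "g * h \<simeq>\<^bsub>J 3 m\<^esub> 1" and hg: "h * g \<simeq>\<^bsub>J 3 m\<^esub> 1"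
    and pent: "cable3 {1} {2} {3} g * cable3 {1} {2, 3} {4} g * cable3 {2} {3} {4} g
      \<simeq>\<^bsub>J 4 m\<^esub> cable3 {1, 2} {3} {4} g * cable3 {1} {2} {3, 4} g"
    and hex: "g * cable3 {1} {3} {2} h * cable3 {3} {1} {2} g \<simeq>\<^bsub>J 3 m\<^esub> 1"
begin

abbreviation "G A B C \<equiv> cable3 A B C g"
abbreviation "H A B C \<equiv> cable3 A B C h"

text \<open>Elements of \<open>J\<close> have no constant term, so the constants satisfy ab = 1 and,
  by the hexagon, aba = 1.\<close>

lemma const_1: "coef g [] = 1" "coef h [] = 1"
proof -
  have "coef g [] * coef h [] = 1"
    using J_const gh by (fastforce simp: eqv_def)
  moreover have "coef g [] * coef h [] * coef g [] = 1"
    using J_const hex by (fastforce simp: eqv_def)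
  ultimately show "coef g [] = 1" "coef h [] = 1" by simp_all
qed

lemma GH:
  assumes "disj3 n A B C"
  shows "G A B C * H A B C \<simeq>\<^bsub>J n m\<^esub> 1" "H A B C * G A B C \<simeq>\<^bsub>J n m\<^esub> 1"
  using cable3_eqv[OF assms gh] cable3_eqv[OF assms hg] by simp_all

text \<open>The given pentagon is transported by the cabling that renames strands 1, 2, 3, 4 to
  \<open>a\<close>, \<open>b\<close>, \<open>c\<close>, \<open>d\<close>.\<close>

lemma pentagon:
  assumes "distinct [a, b, c, d]" "{a, b, c, d} \<subseteq> {1..4}"
  shows "G {a} {b} {c} * G {a} {b, c} {d} * G {b} {c} {d}
      \<simeq>\<^bsub>J 4 m\<^esub> G {a, b} {c} {d} * G {a} {b} {c, d}"
proof -
  define bl where "bl i = (if i = 1 then {a} else if i = 2 then {b} else if i = 3 then {c} else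
      {d})"
    for i :: nat
  have bl: "blocks 4 4 bl"
    using assms unfolding blocks_def Icc4 by (simp add: bl_def)
  note cable_bl = cable_cable3[OF bl, of _ _ _ g]
  from pent have "cable 4 bl (cable3 {1} {2} {3} g * cable3 {1} {2, 3} {4} g * cable3 {2} {3} {4} g)
      \<simeq>\<^bsub>J 4 m\<^esub> cable 4 bl (cable3 {1, 2} {3} {4} g * cable3 {1} {2} {3, 4} g)"
    unfolding eqv_def using cable_J[OF bl] by (metis cable_simps(2))
  then show ?thesis
    by (simp add: cable_bl disj3_def) (simp add: bl_def insert_commute)
qed

lemma hexagon:
  assumes "disj3 n A B C"
  shows "G A B C * H A C B * G C A B \<simeq>\<^bsub>J n m\<^esub> 1"
  using cable3_eqv[OF assms hex] by (simp add: cable3_132[OF assms] cable3_312[OF assms])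

lemma disj3_perms:
  assumes "disj3 n A B C"
  shows "disj3 n A C B" "disj3 n B A C" "disj3 n B C A" "disj3 n C A B" "disj3 n C B A"
  using assms by (simp_all add: disj3_def Int_commute)

lemma right_inverse_unique:
  assumes "x * u \<simeq>\<^bsub>J n m\<^esub> 1" "u * v \<simeq>\<^bsub>J n m\<^esub> 1"
  shows "x \<simeq>\<^bsub>J n m\<^esub> v"
proof -
  have "x \<simeq>\<^bsub>J n m\<^esub> x * u * v"
    by (rule J.eqv_sym, rule J.eqv_cancel, rule assms)
  also have "\<dots> \<simeq>\<^bsub>J n m\<^esub> 1 * v"
    by (intro J.eqv_rmul assms)
  finally show ?thesis by simp
qed

lemma unit_mult:
  assumes "u * u' \<simeq>\<^bsub>J n k\<^esub> 1" "v * v' \<simeq>\<^bsub>J n k\<^esub> 1"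
  shows "u * v * (v' * u') \<simeq>\<^bsub>J n k\<^esub> (1 :: 'a ser)"
proof -
  have "u * v * (v' * u') = u * v * v' * u'"
    by (simp add: mult.assoc)
  also have "\<dots> \<simeq>\<^bsub>J n k\<^esub> u * u'"
    by (intro J.eqv_rmul J.eqv_cancel assms)
  also note assms(1)
  finally show ?thesis .
qed

text \<open>By the hexagon for \<open>C\<close>, \<open>B\<close>, \<open>A\<close>, the series
  \<open>G C B A\<close> is inverse to \<open>H C A B * G A C B\<close>, so it equals
  \<open>H A C B * G C A B\<close>. By the hexagon for \<open>A\<close>, \<open>B\<close>,
  \<open>C\<close>, that product is inverse to \<open>G A B C\<close>.\<close>

lemma antisym:
  assumes "disj3 n A B C"
  shows "G A B C \<simeq>\<^bsub>J n m\<^esub> H C B A"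
proof -
  note perms = disj3_perms[OF assms]
  have "H C A B * G A C B * (H A C B * G C A B) \<simeq>\<^bsub>J n m\<^esub> 1"
    by (intro unit_mult GH perms)
  then have *: "G C B A * 1 \<simeq>\<^bsub>J n m\<^esub> G C B A * (H C A B * G A C B * (H A C B * G C A B))"
    by (rule J.eqv_lmul[OF J.eqv_sym])
  also have "\<dots> = G C B A * H C A B * G A C B * (H A C B * G C A B)"
    by (simp add: mult.assoc)
  also have "\<dots> \<simeq>\<^bsub>J n m\<^esub> 1 * (H A C B * G C A B)"
    by (intro J.eqv_rmul hexagon perms)
  finally have "H A C B * G C A B \<simeq>\<^bsub>J n m\<^esub> G C B A"
    using J.eqv_sym by simp
  then have "G A B C * G C B A \<simeq>\<^bsub>J n m\<^esub> G A B C * (H A C B * G C A B)"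
    by (rule J.eqv_lmul[OF J.eqv_sym])
  also have "\<dots> = G A B C * H A C B * G C A B"
    by (simp add: mult.assoc)
  also have "\<dots> \<simeq>\<^bsub>J n m\<^esub> 1"
    by (rule hexagon[OF assms])
  finally show ?thesis
    using GH(1)[OF perms(5)] by (rule right_inverse_unique)
qed

definition cabling_defect :: "'a ser" where
  "cabling_defect = tgen 1 2 + tgen 1 3 - h * tgen 1 2 * g - cable3 {1} {3} {2} (h * tgen 1 2 * g)"

lemma cable3_defect:
  assumes "disj3 n A B C"
  shows "cable3 A B C cabling_defect = tsum A B + tsum A C - H A B C * tsum A B * G A B C
    - H A C B * tsum A C * G A C B"
  by (simp add: cabling_defect_def cable3_132[OF assms] tsum_singleton)

lemma cable3_defect_132:
  assumes "disj3 n A B C"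
  shows "cable3 A C B cabling_defect = cable3 A B C cabling_defect"
  by (simp add: cable3_defect[OF assms] cable3_defect[OF disj3_perms(1)[OF assms]])

lemma defect_cocycle:
  assumes k: "Suc k \<le> m" and D: "cabling_defect \<in> J 3 k"
  shows "cable3 {1} {2} {3, 4} cabling_defect + cable3 {1} {3} {4} cabling_defect
    \<simeq>\<^bsub>J 4 (Suc k)\<^esub> cable3 {1} {2, 3} {4} cabling_defect + cable3 {1} {2} {3} cabling_defect"
proof -
  let ?I = "J 4 (Suc k)"
  have I: "x \<simeq>\<^bsub>?I\<^esub> y" if "x \<simeq>\<^bsub>J 4 m\<^esub> y" for x y :: "'a ser"
    using that unfolding eqv_def by (rule J_mono[OF k])
  have GHI: "G A B C * H A B C \<simeq>\<^bsub>?I\<^esub> 1" "H A B C * G A B C \<simeq>\<^bsub>?I\<^esub> 1"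
    if "disj3 4 A B C" for A B C
    using GH[OF that] I by auto
  \<comment> \<open>Unprimed letters are instances of Gamma, primed ones of its inverse. The aim is
    \<open>e12\<close>, \<open>e13\<close>, \<open>e14\<close>: splitting {2,3,4} as 2 | 34 or as 23
    | 4 conjugates t12, t13 and t14 in the same way, up to a final conjugation by
    \<open>r\<close>.\<close>
  define a b c d p q r s u z where defs:
    "a = G {1} {2} {3, 4}" "b = G {1} {3, 4} {2}" "c = G {1} {3} {4}" "d = G {1} {4} {3}"
    "p = G {1} {2, 3} {4}" "q = G {1} {4} {2, 3}" "r = G {2} {3} {4}"
    "s = G {1} {2} {3}" "u = G {1} {3} {2}" "z = G {1} {3} {2, 4}"
  define a' b' c' d' p' q' r' s' u' z' where defs':
    "a' = H {1} {2} {3, 4}" "b' = H {1} {3, 4} {2}" "c' = H {1} {3} {4}" "d' = H {1} {4} {3}"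
    "p' = H {1} {2, 3} {4}" "q' = H {1} {4} {2, 3}" "r' = H {2} {3} {4}"
    "s' = H {1} {2} {3}" "u' = H {1} {3} {2}" "z' = H {1} {3} {2, 4}"
  have inv: "a * a' \<simeq>\<^bsub>?I\<^esub> 1" "b * b' \<simeq>\<^bsub>?I\<^esub> 1" "c * c' \<simeq>\<^bsub>?I\<^esub> 1" "d * d' \<simeq>\<^bsub>?I\<^esub> 1"
    "p * p' \<simeq>\<^bsub>?I\<^esub> 1" "q * q' \<simeq>\<^bsub>?I\<^esub> 1" "r * r' \<simeq>\<^bsub>?I\<^esub> 1" "s * s' \<simeq>\<^bsub>?I\<^esub> 1"
    "u * u' \<simeq>\<^bsub>?I\<^esub> 1" "z * z' \<simeq>\<^bsub>?I\<^esub> 1" and inv': "a' * a \<simeq>\<^bsub>?I\<^esub> 1" "b' * b \<simeq>\<^bsub>?I\<^esub> 1"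
    "c' * c \<simeq>\<^bsub>?I\<^esub> 1" "d' * d \<simeq>\<^bsub>?I\<^esub> 1" "p' * p \<simeq>\<^bsub>?I\<^esub> 1" "q' * q \<simeq>\<^bsub>?I\<^esub> 1"
    "r' * r \<simeq>\<^bsub>?I\<^esub> 1" "s' * s \<simeq>\<^bsub>?I\<^esub> 1" "u' * u \<simeq>\<^bsub>?I\<^esub> 1" "z' * z \<simeq>\<^bsub>?I\<^esub> 1"
    unfolding defs defs' by (rule GHI; simp add: disj3_def)+
  have const: "coef b [] = 1" "coef b' [] = 1" "coef r [] = 1" "coef r' [] = 1" "coef p [] = 1"
      "coef p' [] = 1"
    unfolding defs defs' by (simp_all add: const_1)
  have *: "{1, 2} = {1} \<union> {2::nat}" "{1, 3} = {1} \<union> {3::nat}" "{1, 4} = {1} \<union> {4::nat}" by auto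
  have comm12: "G {1, 2} {3} {4} * tgen 1 2 \<simeq>\<^bsub>?I\<^esub> tgen 1 2 * G {1, 2} {3} {4}"
    unfolding * tsum_singleton[symmetric] by (rule cable3_commutes_inside[OF g]; simp)
  have comm13: "G {1, 3} {4} {2} * tgen 1 3 \<simeq>\<^bsub>?I\<^esub> tgen 1 3 * G {1, 3} {4} {2}"
    "G {1, 3} {2} {4} * tgen 1 3 \<simeq>\<^bsub>?I\<^esub> tgen 1 3 * G {1, 3} {2} {4}"
    unfolding * tsum_singleton[symmetric] by (rule cable3_commutes_inside[OF g]; simp)+
  have comm14: "G {1, 4} {3} {2} * tgen 1 4 \<simeq>\<^bsub>?I\<^esub> tgen 1 4 * G {1, 4} {3} {2}"
    unfolding * tsum_singleton[symmetric] by (rule cable3_commutes_inside[OF g]; simp)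
  have comm_t: "r * (tgen 1 2 + tgen 1 3 + tgen 1 4) \<simeq>\<^bsub>?I\<^esub> (tgen 1 2 + tgen 1 3 + tgen 1 4) * r"
    unfolding defs tsum_singleton[symmetric]
    by (rule cable3_commutes_outside[OF g]; simp add: disj3_def)

  \<comment> \<open>Pentagon 1234, whose factor \<open>G {1, 2} {3} {4}\<close> commutes with
    t12.\<close>
  have e12: "a' * tgen 1 2 * a \<simeq>\<^bsub>?I\<^esub> r' * (p' * (s' * tgen 1 2 * s) * p) * r"
  proof -
    have "r' * (p' * s') * tgen 1 2 * (s * p * r) \<simeq>\<^bsub>?I\<^esub> a' * tgen 1 2 * a"
    proof (rule J.conj_eqv)
      show "s * p * r \<simeq>\<^bsub>?I\<^esub> G {1, 2} {3} {4} * a"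
        unfolding defs by (rule I, rule pentagon) auto
    qed (use comm12 in \<open>intro unit_mult inv inv' | simp\<close>)+
    from J.eqv_sym[OF this] show ?thesis
      by (simp add: mult.assoc)
  qed
  \<comment> \<open>Reversal inverts, so the last factor on the left of pentagon 1432 can be moved
    to the right as \<open>r\<close>.\<close>
  have G432: "G {4} {3} {2} \<simeq>\<^bsub>?I\<^esub> r'"
    unfolding defs' by (rule I, rule antisym) (simp add: disj3_def)
  have e14: "b' * (d' * tgen 1 4 * d) * b \<simeq>\<^bsub>?I\<^esub> r' * (q' * tgen 1 4 * q) * r"
  proof -
    have "b' * d' * tgen 1 4 * (d * b) \<simeq>\<^bsub>?I\<^esub> r' * q' * tgen 1 4 * (q * r)"
    proof (rule J.conj_eqv)
      have "d * b \<simeq>\<^bsub>?I\<^esub> d * b * r' * r"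
        by (rule J.eqv_sym, rule J.eqv_cancel, rule inv')
      also have "\<dots> \<simeq>\<^bsub>?I\<^esub> d * b * G {4} {3} {2} * r"
        by (intro J.eqv_rmul J.eqv_lmul J.eqv_sym[OF G432])
      also have "d * b * G {4} {3} {2} * r \<simeq>\<^bsub>?I\<^esub> G {1, 4} {3} {2} * q * r"
      proof (rule J.eqv_rmul)
        show "d * b * G {4} {3} {2} \<simeq>\<^bsub>?I\<^esub> G {1, 4} {3} {2} * q"
          unfolding defs using I[OF pentagon[of 1 4 3 2]] by (simp add: insert_commute)
      qed
      finally show "d * b \<simeq>\<^bsub>?I\<^esub> G {1, 4} {3} {2} * (q * r)"
        by (simp add: mult.assoc)
    qed (use comm14 in \<open>intro unit_mult inv inv' | simp\<close>)+
    then show ?thesis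
      by (simp add: mult.assoc)
  qed
  \<comment> \<open>Strand 3 changes partner between the two splittings, so one pentagon is not
    enough. Pentagons 1342 and 1324 share the factor \<open>z\<close>; the hexagon on strands 3, 2,
    4 links their remaining factors \<open>e\<close> and \<open>f\<close>.\<close>
  have e13: "b' * (c' * tgen 1 3 * c) * b \<simeq>\<^bsub>?I\<^esub> r' * (p' * (u' * tgen 1 3 * u) * p) * r"
  proof -
    define e e' f f' where ef: "e = G {3} {4} {2}" "e' = H {3} {4} {2}"
      "f = G {3} {2} {4}" "f' = H {3} {2} {4}"
    have inve: "e * e' \<simeq>\<^bsub>?I\<^esub> 1" "e' * e \<simeq>\<^bsub>?I\<^esub> 1" "f * f' \<simeq>\<^bsub>?I\<^esub> 1" "f' * f \<simeq>\<^bsub>?I\<^esub> 1"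
      unfolding ef by (rule GHI; simp add: disj3_def)+
    have hexf: "e' \<simeq>\<^bsub>?I\<^esub> f' * r"
    proof -
      have "f * e' * r' \<simeq>\<^bsub>?I\<^esub> f * e' * G {4} {3} {2}"
        by (intro J.eqv_lmul J.eqv_sym[OF G432])
      also have "\<dots> \<simeq>\<^bsub>?I\<^esub> 1"
        unfolding ef by (rule I, rule hexagon) (simp add: disj3_def)
      finally have *: "f' * (f * e' * r') * r \<simeq>\<^bsub>?I\<^esub> f' * 1 * r"
        by (intro J.eqv_rmul J.eqv_lmul)
      have "f' * (f * e' * r') * r \<simeq>\<^bsub>?I\<^esub> e'"
      proof -
        have "f' * (f * e' * r') * r = (f' * f) * e' * r' * r"
          by (simp add: mult.assoc)
        also have "\<dots> \<simeq>\<^bsub>?I\<^esub> f' * f * e'"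
          by (intro J.eqv_cancel inv')
        also have "\<dots> \<simeq>\<^bsub>?I\<^esub> 1 * e'"
          by (intro J.eqv_rmul inve)
        finally show ?thesis by simp
      qed
      then show ?thesis
        using J.eqv_trans[OF J.eqv_sym *] by simp
    qed
    have "b' * c' * tgen 1 3 * (c * b) \<simeq>\<^bsub>?I\<^esub> e * z' * tgen 1 3 * (z * e')"
    proof (rule J.conj_eqv)
      have "c * b \<simeq>\<^bsub>?I\<^esub> c * b * e * e'"
        by (rule J.eqv_sym, rule J.eqv_cancel, rule inve)
      also have "c * b * e * e' \<simeq>\<^bsub>?I\<^esub> G {1, 3} {4} {2} * z * e'"
      proof (rule J.eqv_rmul)
        show "c * b * e \<simeq>\<^bsub>?I\<^esub> G {1, 3} {4} {2} * z"
          unfolding defs ef using I[OF pentagon[of 1 3 4 2]] by (simp add: insert_commute)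
      qed
      finally show "c * b \<simeq>\<^bsub>?I\<^esub> G {1, 3} {4} {2} * (z * e')"
        by (simp add: mult.assoc)
    qed (use comm13 in \<open>intro unit_mult inv inv' inve | simp\<close>)+
    also have "e * z' * tgen 1 3 * (z * e') \<simeq>\<^bsub>?I\<^esub> r' * f * z' * tgen 1 3 * (z * f' * r)"
    proof (rule J.conj_eqv)
      have "z * e' \<simeq>\<^bsub>?I\<^esub> z * (f' * r)"
        by (intro J.eqv_lmul hexf)
      then show "z * e' \<simeq>\<^bsub>?I\<^esub> 1 * (z * f' * r)"
        by (simp add: mult.assoc)
      show "z * f' * r * (r' * f * z') \<simeq>\<^bsub>?I\<^esub> 1"
        using unit_mult[OF unit_mult[OF inv(10) inve(4)] inv(7)] by (simp add: mult.assoc)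
    qed (intro unit_mult inv' inve | simp)+
    also have "r' * f * z' * tgen 1 3 * (z * f' * r) \<simeq>\<^bsub>?I\<^esub> r' * (p' * u') * tgen 1 3 * (u * p * r)"
    proof (rule J.eqv_sym, rule J.conj_eqv)
      have "u * p * r \<simeq>\<^bsub>?I\<^esub> u * p * f * f' * r"
        by (rule J.eqv_rmul, rule J.eqv_sym, rule J.eqv_cancel, rule inve)
      also have "u * p * f * f' * r \<simeq>\<^bsub>?I\<^esub> G {1, 3} {2} {4} * z * f' * r"
      proof (intro J.eqv_rmul)
        show "u * p * f \<simeq>\<^bsub>?I\<^esub> G {1, 3} {2} {4} * z"
          unfolding defs ef using I[OF pentagon[of 1 3 2 4]] by (simp add: insert_commute)
      qed
      finally show "u * p * r \<simeq>\<^bsub>?I\<^esub> G {1, 3} {2} {4} * (z * f' * r)"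
        by (simp add: mult.assoc)
      show "z * f' * r * (r' * f * z') \<simeq>\<^bsub>?I\<^esub> 1"
        using unit_mult[OF unit_mult[OF inv(10) inve(4)] inv(7)] by (simp add: mult.assoc)
    qed (use comm13 in \<open>intro unit_mult inv inv' inve | simp\<close>)+
    finally show ?thesis
      by (simp add: mult.assoc)
  qed

  have D134: "cable3 {1} {3} {4} cabling_defect \<in> J 4 k" "cable3 {1} {2, 3} {4} cabling_defect \<in> J
      4 k"
    "cable3 {1} {2} {3} cabling_defect \<in> J 4 k"
    by (rule cable3_J[OF _ D]; simp add: disj3_def)+
  have tsum_pair: "tsum {1} {3, 4} = tgen 1 3 + tgen 1 4" "tsum {1} {2, 3} = tgen 1 2 + tgen 1 3"
    by (simp_all add: tsum_def)
  \<comment> \<open>Conjugating the second defect by \<open>b\<close> costs nothing modulo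
    \<open>?I\<close>; afterwards its leading terms t13 + t14 cancel the conjugated t13 + t14 of the
    first defect.\<close>
  have "cable3 {1} {2} {3, 4} cabling_defect + cable3 {1} {3} {4} cabling_defect
    \<simeq>\<^bsub>?I\<^esub> cable3 {1} {2} {3, 4} cabling_defect + b' * cable3 {1} {3} {4} cabling_defect * b"
    using J_conj_raise[OF D134(1), of b' b] const by (intro J.eqv_add J.eqv_refl) (rule J.eqv_sym;
        simp)
  also have "\<dots> = tgen 1 2 + tgen 1 3 + tgen 1 4 - a' * tgen 1 2 * a - b' * (c' * tgen 1 3 * c) * b
      - b' * (d' * tgen 1 4 * d) * b"
    by (subst cable3_defect[of 4], simp add: disj3_def)+
      (simp add: tsum_pair[simplified] tsum_singleton defs[symmetric, simplified] defs'[symmetric,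
          simplified] algebra_simps)
  also have "\<dots> \<simeq>\<^bsub>?I\<^esub> r' * (tgen 1 2 + tgen 1 3 + tgen 1 4) * r - r' * (p' * (s' * tgen 1 2 * s) *
      p) * r
      - r' * (p' * (u' * tgen 1 3 * u) * p) * r - r' * (q' * tgen 1 4 * q) * r"
  proof (intro J.eqv_diff e12 e13 e14)
    have "r' * (tgen 1 2 + tgen 1 3 + tgen 1 4) * r \<simeq>\<^bsub>?I\<^esub> 1 * (tgen 1 2 + tgen 1 3 + tgen 1 4) * 1"
      by (rule J.conj_eqv[OF inv'(7), where x = r]) (use comm_t in simp_all)
    then show "tgen 1 2 + tgen 1 3 + tgen 1 4 \<simeq>\<^bsub>?I\<^esub> r' * (tgen 1 2 + tgen 1 3 + tgen 1 4) * r"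
      using J.eqv_sym by simp
  qed
  \<comment> \<open>The same telescoping read backwards: t12 + t13 conjugated by
    \<open>p * r\<close> occurs in the two defects with opposite signs.\<close>
  also have "\<dots> = r' * cable3 {1} {2, 3} {4} cabling_defect * r
      + r' * p' * cable3 {1} {2} {3} cabling_defect * (p * r)"
    by (subst cable3_defect[of 4], simp add: disj3_def)+
      (simp add: tsum_pair[simplified] tsum_singleton defs[symmetric, simplified] defs'[symmetric,
          simplified] algebra_simps)
  also have "\<dots> \<simeq>\<^bsub>?I\<^esub> cable3 {1} {2, 3} {4} cabling_defect + cable3 {1} {2} {3} cabling_defect"
    using J_conj_raise[OF D134(2), of r' r] J_conj_raise[OF D134(3), of "r' * p'" "p * r"] const
    by (intro J.eqv_add) simp_all
  finally show ?thesis .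
qed

text \<open>The defect is renamed by 312. Its conjugators are rewritten by
  \<open>g * H {1} {3} {2}\<close> = \<open>H {3} {1} {2}\<close> from the hexagon, and by reversal,
  which turns \<open>H {3} {2} {1}\<close> into \<open>g\<close> and \<open>G {3} {2} {1}\<close>
  into \<open>h\<close>, that is \<open>H {1} {3} {2} * G {3} {1} {2}\<close>.\<close>

lemma semiclassical:
  assumes "cabling_defect \<in> J 3 m"
  shows "tgen 1 3 + tgen 2 3 \<simeq>\<^bsub>J 3 m\<^esub>
    g * (tgen 2 3 * cable3 {1} {3} {2} h + cable3 {1} {3} {2} h * tgen 1 3) * cable3 {3} {1} {2} g"
proof -
  have D: "disj3 3 {1} {2} {3}" "disj3 3 {3} {1} {2}" "disj3 3 {3} {2} {1}"
    by (auto simp: disj3_def)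
  have g123: "G {1} {2} {3} = g" "H {1} {2} {3} = h"
    using cable3_id[OF g(2)] cable3_id[OF h] by simp_all
  have gH: "g * H {1} {3} {2} \<simeq>\<^bsub>J 3 m\<^esub> H {3} {1} {2}"
    by (rule right_inverse_unique[OF hex GH(1)[OF D(2)]])
  have HG: "H {1} {3} {2} * G {3} {1} {2} \<simeq>\<^bsub>J 3 m\<^esub> h"
  proof -
    have "H {1} {3} {2} * G {3} {1} {2} = 1 * (H {1} {3} {2} * G {3} {1} {2})"
      by simp
    also have "\<dots> \<simeq>\<^bsub>J 3 m\<^esub> h * g * (H {1} {3} {2} * G {3} {1} {2})"
      by (intro J.eqv_rmul J.eqv_sym[OF hg])
    also have "\<dots> = h * (g * H {1} {3} {2} * G {3} {1} {2})"
      by (simp add: mult.assoc)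
    also have "\<dots> \<simeq>\<^bsub>J 3 m\<^esub> h * 1"
      by (intro J.eqv_lmul hex)
    finally show ?thesis by simp
  qed
  have "cable3 {3} {1} {2} cabling_defect \<simeq>\<^bsub>J 3 m\<^esub> 0"
    using cable3_J[OF D(2) assms] by (simp add: eqv_def)
  then have "tgen 1 3 + tgen 2 3 - H {3} {1} {2} * tgen 1 3 * G {3} {1} {2}
      - H {3} {2} {1} * tgen 2 3 * G {3} {2} {1} \<simeq>\<^bsub>J 3 m\<^esub> 0"
    unfolding cable3_defect[OF D(2)] by (simp add: tsum_singleton)
  then have "tgen 1 3 + tgen 2 3 \<simeq>\<^bsub>J 3 m\<^esub> H {3} {2} {1} * tgen 2 3 * G {3} {2} {1}
      + H {3} {1} {2} * tgen 1 3 * G {3} {1} {2}"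
    by (simp add: eqv_def algebra_simps)
  also have "\<dots> \<simeq>\<^bsub>J 3 m\<^esub> g * tgen 2 3 * (H {1} {3} {2} * G {3} {1} {2})
      + g * H {1} {3} {2} * tgen 1 3 * G {3} {1} {2}"
  proof (intro J.eqv_add J.eqv_rmul J.eqv_sym[OF gH] J.eqv_mult)
    show "H {3} {2} {1} \<simeq>\<^bsub>J 3 m\<^esub> g"
      using antisym[OF D(1)] J.eqv_sym unfolding g123 by blast
    show "G {3} {2} {1} \<simeq>\<^bsub>J 3 m\<^esub> H {1} {3} {2} * G {3} {1} {2}"
      using antisym[OF D(3)] HG J.eqv_sym J.eqv_trans unfolding g123 by blast
  qed
  also have "\<dots> = g * (tgen 2 3 * H {1} {3} {2} + H {1} {3} {2} * tgen 1 3) * G {3} {1} {2}"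
    by (simp add: algebra_simps)
  finally show ?thesis .
qed

end

section \<open>Normal forms on three strands\<close>

lemma eqv_subst_lin_ser_gen: "x \<simeq>\<^bsub>J n m\<^esub> subst_lin n ser_gen x"
proof -
  have "subst_lin n ser_gen (x - subst_lin n ser_gen x) = 0"
    by (simp add: linear_form_ser_gen)
  then have "subst_lin n ser_gen (x - subst_lin n ser_gen x) \<in> J n m"
    using J.zero by metis
  then show ?thesis
    unfolding J_subst_lin_ser_gen_iff eqv_def .
qed

definition word_prod :: "bool list \<Rightarrow> 'a::comm_ring_1 ser" where
  "word_prod u = prod_list (map (\<lambda>b. if b then tgen 1 3 else tgen 1 2) u)"

lemma word_prod_simps [simp]: "word_prod [] = 1" "word_prod (b # u) = (if b then tgen 1 3 else
    tgen 1 2) * word_prod u"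
  by (simp_all add: word_prod_def)

definition words_upto :: "nat \<Rightarrow> bool list set" where
  "words_upto k = {u. length u \<le> k}"

lemma finite_words_upto [simp]: "finite (words_upto k)"
  using finite_lists_length_le[of "UNIV :: bool set" k] by (simp add: words_upto_def)

definition nform :: "nat \<Rightarrow> (bool list \<Rightarrow> 'a::comm_ring_1) \<Rightarrow> 'a ser" where
  "nform k c = (\<Sum>u\<in>words_upto k. const_ser (c u) * (word_prod u * tgen 2 3 ^ (k - length u)))"

definition nspan :: "nat \<Rightarrow> nat \<Rightarrow> 'a::comm_ring_1 ser set" where
  "nspan m k = {x. \<exists>c. x \<simeq>\<^bsub>J 3 m\<^esub> nform k c}"

lemma nspan_eqv: "x \<simeq>\<^bsub>J 3 m\<^esub> y \<Longrightarrow> y \<in> nspan m k \<Longrightarrow> x \<in> nspan m k"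
  unfolding nspan_def using J.eqv_trans by fast

lemma nspan_add: "x \<in> nspan m k \<Longrightarrow> y \<in> nspan m k \<Longrightarrow> x + y \<in> nspan m k"
proof -
  assume "x \<in> nspan m k" "y \<in> nspan m k"
  then obtain c d where "x \<simeq>\<^bsub>J 3 m\<^esub> nform k c" "y \<simeq>\<^bsub>J 3 m\<^esub> nform k d"
    unfolding nspan_def by fast
  then have "x + y \<simeq>\<^bsub>J 3 m\<^esub> nform k c + nform k d"
    by (rule J.eqv_add)
  also have "\<dots> = nform k (\<lambda>u. c u + d u)"
    by (simp add: nform_def const_ser_add distrib_right sum.distrib)
  finally show ?thesis unfolding nspan_def by fast
qed

lemma nspan_const_ser: "x \<in> nspan m k \<Longrightarrow> const_ser b * x \<in> nspan m k"
proof -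
  assume "x \<in> nspan m k"
  then obtain c where "x \<simeq>\<^bsub>J 3 m\<^esub> nform k c"
    unfolding nspan_def by fast
  then have "const_ser b * x \<simeq>\<^bsub>J 3 m\<^esub> const_ser b * nform k c"
    by (rule J.eqv_lmul)
  also have "\<dots> = nform k (\<lambda>u. b * c u)"
    by (simp add: nform_def const_ser_mult sum_distrib_left mult.assoc)
  finally show ?thesis unfolding nspan_def by fast
qed

lemma nspan_diff: "x \<in> nspan m k \<Longrightarrow> y \<in> nspan m k \<Longrightarrow> x - y \<in> nspan m k"
proof -
  assume *: "x \<in> nspan m k" "y \<in> nspan m k"
  have "x - y = x + const_ser (- 1) * y"
    by (rule ser_eqI) simp
  then show ?thesis
    using * by (simp only: nspan_add nspan_const_ser)
qed

lemma nspan_zero: "0 \<in> nspan m k"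
proof -
  have "nform k (\<lambda>_. 0) = 0"
    by (simp add: nform_def)
  then show ?thesis
    unfolding nspan_def by (intro CollectI exI) (erule subst, rule J.eqv_refl)
qed

lemma nspan_sum: "(\<And>i. i \<in> A \<Longrightarrow> f i \<in> nspan m k) \<Longrightarrow> sum f A \<in> nspan m k"
  by (induction A rule: infinite_finite_induct) (auto intro: nspan_zero nspan_add)

lemma nspan_word_prod:
  assumes "length u \<le> k" shows "word_prod u * tgen 2 3 ^ (k - length u) \<in> nspan m k"
proof -
  have "nform k (\<lambda>v. if v = u then 1 else 0) =
      (\<Sum>v\<in>words_upto k. if v = u then word_prod v * tgen 2 3 ^ (k - length v) else 0)"
    unfolding nform_def by (intro sum.cong) auto
  also have "\<dots> = word_prod u * tgen 2 3 ^ (k - length u)"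
    using assms by (subst sum.delta[OF finite_words_upto]) (simp add: words_upto_def)
  finally show ?thesis
    unfolding nspan_def by (intro CollectI exI) (erule subst, rule J.eqv_refl)
qed

lemma const_ser_left_commute: "y * (const_ser c * z) = const_ser c * (y * z)"
  by (simp only: mult.assoc[symmetric] const_ser_commute)

lemma nspan_lmul:
  assumes "\<And>u. length u \<le> k \<Longrightarrow> y * (word_prod u * tgen 2 3 ^ (k - length u)) \<in> nspan m k'"
    and "x \<in> nspan m k"
  shows "y * x \<in> nspan m k'"
proof -
  obtain c where "x \<simeq>\<^bsub>J 3 m\<^esub> nform k c"
    using assms(2) unfolding nspan_def by fast
  then have "y * x \<simeq>\<^bsub>J 3 m\<^esub> y * nform k c"
    by (rule J.eqv_lmul)
  moreover have "y * nform k c =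
      (\<Sum>u\<in>words_upto k. const_ser (c u) * (y * (word_prod u * tgen 2 3 ^ (k - length u))))"
    unfolding nform_def sum_distrib_left
    by (simp only: const_ser_left_commute)
  moreover have "\<dots> \<in> nspan m k'"
    by (intro nspan_sum nspan_const_ser assms(1)) (simp add: words_upto_def)
  ultimately show ?thesis
    using nspan_eqv by metis
qed

lemma nspan_gT12: "x \<in> nspan m k \<Longrightarrow> tgen 1 2 * (x :: 'a::comm_ring_1 ser) \<in> nspan m (Suc k)"
  and nspan_gT13: "x \<in> nspan m k \<Longrightarrow> tgen 1 3 * x \<in> nspan m (Suc k)"
proof -
  have *: "tgen 1 2 * (word_prod u * tgen 2 3 ^ (k - length u) :: 'a ser) \<in> nspan m (Suc k)"
    "tgen 1 3 * (word_prod u * tgen 2 3 ^ (k - length u) :: 'a ser) \<in> nspan m (Suc k)"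
    if "length u \<le> k" for u
    using that nspan_word_prod[of "False # u" "Suc k" m] nspan_word_prod[of "True # u" "Suc k" m]
    by (simp_all add: mult.assoc)
  show "x \<in> nspan m k \<Longrightarrow> tgen 1 2 * x \<in> nspan m (Suc k)"
    "x \<in> nspan m k \<Longrightarrow> tgen 1 3 * x \<in> nspan m (Suc k)"
    by (rule nspan_lmul[OF *(1)] nspan_lmul[OF *(2)]; assumption)+
qed

text \<open>Rewrite rules moving t23 to the right, from the triple relations at t12 and t13. The
  correction terms contain no t23, so pushing it through a word is an induction on that
  word.\<close>

lemma gT23_comm:
  "tgen 2 3 * tgen 1 2 \<simeq>\<^bsub>J 3 m\<^esub> tgen 1 2 * tgen 2 3 + (tgen 1 2 * tgen 1 3 - tgen 1 3 * tgen 1 2)"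
  "tgen 2 3 * tgen 1 3 \<simeq>\<^bsub>J 3 m\<^esub> tgen 1 3 * tgen 2 3 + (tgen 1 3 * tgen 1 2 - tgen 1 2 * tgen 1 3)"
proof -
  have "tgen 1 2 * (tgen 1 3 + tgen 2 3) - (tgen 1 3 + tgen 2 3) * tgen 1 2 \<in> J 3 m"
    by (rule J_rel3) auto
  from J.neg[OF this]
  show "tgen 2 3 * tgen 1 2 \<simeq>\<^bsub>J 3 m\<^esub> tgen 1 2 * tgen 2 3 + (tgen 1 2 * tgen 1 3 - tgen 1 3 * tgen
      1 2)"
    by (simp add: eqv_def algebra_simps)
  have "tgen 1 3 * (tgen 1 2 + tgen 3 2) - (tgen 1 2 + tgen 3 2) * tgen 1 3 \<in> J 3 m"
    by (rule J_rel3) auto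
  from J.neg[OF this]
  show "tgen 2 3 * tgen 1 3 \<simeq>\<^bsub>J 3 m\<^esub> tgen 1 3 * tgen 2 3 + (tgen 1 3 * tgen 1 2 - tgen 1 2 * tgen
      1 3)"
    by (simp add: eqv_def algebra_simps)
qed

lemma nspan_gT23_word_prod:
  "tgen 2 3 * (word_prod u * tgen 2 3 ^ i :: 'a::comm_ring_1 ser) \<in> nspan m (Suc (length u + i))"
proof (induction u)
  case Nil
  show ?case using nspan_word_prod[of "[]" "Suc i" m] by simp
next
  case (Cons b u)
  let ?x = "word_prod u * tgen 2 3 ^ i :: 'a ser" and ?y = "if b then tgen 1 3 else tgen 1 2 :: 'a
      ser"
    and ?z = "if b then tgen 1 2 else tgen 1 3 :: 'a ser"
  have x: "?x \<in> nspan m (length u + i)"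
    using nspan_word_prod[of u "length u + i" m] by simp
  have mul: "?y * v \<in> nspan m (Suc k)" "?z * v \<in> nspan m (Suc k)" if "v \<in> nspan m k" for v k
    using nspan_gT12[OF that] nspan_gT13[OF that] by (cases b; simp only: if_True if_False)+
  have "tgen 2 3 * ?y * ?x \<simeq>\<^bsub>J 3 m\<^esub> (?y * tgen 2 3 + (?y * ?z - ?z * ?y)) * ?x"
    using gT23_comm by (intro J.eqv_rmul) (cases b; simp only: if_True if_False)
  also have "\<dots> = ?y * (tgen 2 3 * ?x) + (?y * (?z * ?x) - ?z * (?y * ?x))"
    by (simp only: algebra_simps)
  finally have "tgen 2 3 * ?y * ?x \<in> nspan m (Suc (Suc (length u + i)))"
    by (rule nspan_eqv) (intro nspan_add nspan_diff mul Cons x)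
  then show ?case by (simp add: mult.assoc)
qed

lemma nspan_gT23: "x \<in> nspan m k \<Longrightarrow> tgen 2 3 * x \<in> nspan m (Suc k)"
proof (rule nspan_lmul)
  fix u :: "bool list" assume "length u \<le> k"
  then show "tgen 2 3 * (word_prod u * tgen 2 3 ^ (k - length u)) \<in> nspan m (Suc k)"
    using nspan_gT23_word_prod[of u "k - length u" m] by simp
qed

lemma gens_3: "gens 3 = {(1, 2), (1, 3), (2, 3)}"
  by (auto simp: gens_def)

lemma nspan_homogeneous:
  assumes "valid 3 (coef x)" "\<And>w. length w \<noteq> k \<Longrightarrow> coef x w = 0"
  shows "x \<in> nspan m k"
  using assms
proof (induction k arbitrary: x)
  case 0
  then have "x = const_ser (coef x []) * (word_prod [] * tgen 2 3 ^ (0 - length ([] :: bool list)))"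
    by (intro ser_eqI) (simp add: coef_const_ser)
  also have "\<dots> \<in> nspan m 0"
    by (intro nspan_const_ser nspan_word_prod) simp
  finally show ?case .
next
  case (Suc k)
  have "set u \<subseteq> gens 3" if "coef x (a # u) \<noteq> 0" for a u
    using that Suc.prems(1) unfolding valid_def by (metis set_subset_Cons subset_trans)
  then have "lquot a x \<in> nspan m k" for a
    using Suc.prems by (intro Suc.IH) (auto simp: valid_def)
  then have *: "ser_gen a * lquot a x \<in> nspan m (Suc k)" if "a \<in> gens 3" for a
    using that nspan_gT12[of "lquot (1, 2) x" m k] nspan_gT13[of "lquot (1, 3) x" m k]
      nspan_gT23[of "lquot (2, 3) x" m k] unfolding gens_3 by (auto simp: eval_nat_numeral)
  have "x = (\<Sum>a\<in>gens 3. ser_gen a * lquot a x)"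
    using ser_decomp[OF Suc.prems(1)] Suc.prems(2)[of "[]"] by simp
  also have "\<dots> \<in> nspan m (Suc k)"
    by (intro nspan_sum *)
  finally show ?case .
qed

text \<open>Modulo \<open>J 3 (Suc k)\<close> an element of \<open>J 3 k\<close> is governed by
  degree \<open>Suc k\<close> alone. The elements with a normal form form an ideal inside
  \<open>J 3 k\<close>, because multiplying by a series or by its constant term gives the same
  result modulo \<open>J 3 (Suc k)\<close>.\<close>

lemma J_nspan:
  fixes x :: "'a::comm_ring_1 ser"
  assumes "x \<in> J 3 k"
  shows "x \<in> nspan (Suc k) (Suc k)"
proof -
  let ?S = "nspan (Suc k) (Suc k) :: 'a ser set"
  let ?K = "{x. x \<in> J 3 k \<and> x \<in> ?S}"
  have split: "const_ser c * x + (a - const_ser c) * x = a * x" "const_ser c * x + x * (a -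
      const_ser c) = x * a"
    for a x :: "'a ser" and c
    unfolding left_diff_distrib right_diff_distrib const_ser_commute[of x c] by simp_all
  have J_S: "x \<in> ?S" if "x \<in> J 3 (Suc k)" for x
  proof (rule nspan_eqv[OF _ nspan_zero])
    show "x \<simeq>\<^bsub>J 3 (Suc k)\<^esub> 0"
      unfolding eqv_def using that by simp
  qed
  have mul: "a * x \<in> ?K" "x * a \<in> ?K" if "x \<in> ?K" for a x
  proof -
    have x: "x \<in> J 3 k" "x \<in> ?S" using that by simp_all
    have "(a - const_ser (coef a [])) * x \<in> ?S" "x * (a - const_ser (coef a [])) \<in> ?S"
      by (rule J_S, rule J_raise[OF x(1)], simp add: coef_const_ser)+
    from this[THEN nspan_add[OF nspan_const_ser[OF x(2), of "coef a []"]]]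
    have "a * x \<in> ?S" "x * a \<in> ?S"
      unfolding split .
    then show "a * x \<in> ?K" "x * a \<in> ?K"
      using that by (simp_all add: J.lmul J.rmul)
  qed
  have "two_sided_ideal ?K"
    by (rule two_sided_ideal.intro)
      (simp add: J.zero nspan_zero, simp add: J.add nspan_add, erule mul, erule mul)
  with assms have "subst_lin 3 ser_gen x \<in> ?K"
  proof (rule J_induct)
    fix x :: "'a ser"
    assume x: "vanish k x"
    define y where "y = subst_lin 3 ser_gen x"
    \<comment> \<open>The part of degree \<open>Suc k\<close>: lower degrees vanish and higher ones
      are discarded by \<open>J 3 (Suc k)\<close>.\<close>
    define z where "z = Ser (\<lambda>w. if length w = Suc k then coef y w else 0)"
    have y: "valid 3 (coef y)" "vanish k y"
      using x by (simp_all add: y_def vanish_subst_lin)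
    have z: "z \<in> ?S"
      using y by (intro nspan_homogeneous) (auto simp: z_def valid_def)
    have "vanish (Suc k) (y - z)"
      using y(2) by (auto simp: z_def vanish_def le_Suc_eq)
    then have "y \<simeq>\<^bsub>J 3 (Suc k)\<^esub> z"
      unfolding eqv_def by (rule J_vanish)
    then have "y \<in> ?S"
      using z by (rule nspan_eqv)
    then have "x \<in> ?S"
      unfolding y_def by (rule nspan_eqv[OF eqv_subst_lin_ser_gen])
    then show "x \<in> ?K"
      using J_vanish[OF x] by simp
  next
    show "Ser ` pb_rels 3 \<subseteq> ?K"
      by (intro subsetI CollectI conjI J_S J_rel)
  qed
  then have "subst_lin 3 ser_gen x \<in> ?S" by blast
  then show ?thesis
    by (rule nspan_eqv[OF eqv_subst_lin_ser_gen])
qed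

section \<open>Actions of the algebras\<close>

text \<open>A module over the algebra on \<open>n\<close> strands: the last two assumptions are its
  defining relations, with \<open>min\<close> and \<open>max\<close> because a generator is an
  increasing pair. The operators need not respect any grading of the module.\<close>

locale word_action = module scale
  for scale :: "'a::comm_ring_1 \<Rightarrow> 'v::ab_group_add \<Rightarrow> 'v" (infixr \<open>*s\<close> 75) +
  fixes n :: nat and act :: "nat \<Rightarrow> nat \<Rightarrow> 'v \<Rightarrow> 'v"
  assumes act_add: "act i j (v + w) = act i j v + act i j w"
    and act_scale: "act i j (b *s v) = b *s act i j v"
    and act_disjoint: "distinct [i, j, k, l] \<Longrightarrow> {i, j, k, l} \<subseteq> {1..n} \<Longrightarrow>
      act (min i j) (max i j) (act (min k l) (max k l) v) =
      act (min k l) (max k l) (act (min i j) (max i j) v)"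
    and act_triple: "distinct [i, j, k] \<Longrightarrow> {i, j, k} \<subseteq> {1..n} \<Longrightarrow>
      act (min i j) (max i j) (act (min i k) (max i k) v + act (min j k) (max j k) v) =
      act (min i k) (max i k) (act (min i j) (max i j) v) +
      act (min j k) (max j k) (act (min i j) (max i j) v)"
begin

text \<open>The operator by which the part of degree \<open>d\<close> of a series acts.\<close>
primrec graded_act :: "nat \<Rightarrow> 'a ser \<Rightarrow> 'v \<Rightarrow> 'v" where
  "graded_act 0 x v = coef x [] *s v"
| "graded_act (Suc d) x v = (\<Sum>(i, j)\<in>gens n. act i j (graded_act d (lquot (i, j) x) v))"

lemma act_0 [simp]: "act i j 0 = 0"
  using act_scale[of i j 0 0] by simp

lemma act_sum: "act i j (sum f A) = (\<Sum>k\<in>A. act i j (f k))"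
  by (induction A rule: infinite_finite_induct) (simp_all add: act_add)

lemma graded_act_0 [simp]: "graded_act d 0 v = 0"
  by (induction d) (simp_all add: case_prod_beta)

lemma graded_act_add: "graded_act d (x + y) v = graded_act d x v + graded_act d y v"
  by (induction d arbitrary: x y)
    (simp_all add: scale_left_distrib act_add case_prod_beta sum.distrib)

lemma graded_act_const_ser_mult: "graded_act d (const_ser b * x) v = b *s graded_act d x v"
  by (induction d arbitrary: x)
    (simp_all add: lquot_mult coef_const_ser act_scale case_prod_beta scale_sum_right)

lemma graded_act_diff: "graded_act d (x - y) v = graded_act d x v - graded_act d y v"
  using graded_act_add[of d "x - y" y v] by simp

lemma graded_act_sum: "graded_act d (sum f A) v = (\<Sum>k\<in>A. graded_act d (f k) v)"
  by (induction A rule: infinite_finite_induct) (simp_all add: graded_act_add)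

lemma graded_act_arg_0 [simp]: "graded_act d x 0 = 0"
  by (induction d arbitrary: x) (simp_all add: case_prod_beta)

lemma graded_act_arg_scale: "graded_act d x (b *s v) = b *s graded_act d x v"
  by (induction d arbitrary: x)
    (simp_all add: act_scale case_prod_beta scale_sum_right mult.commute)

lemma graded_act_mult: "graded_act d (x * y) v = (\<Sum>i\<le>d. graded_act i x (graded_act (d - i) y v))"
proof (induction d arbitrary: x)
  case (Suc d)
  have "graded_act (Suc d) (x * y) v = coef x [] *s graded_act (Suc d) y v
      + (\<Sum>(k, l)\<in>gens n. \<Sum>i\<le>d. act k l (graded_act i (lquot (k, l) x) (graded_act (d - i) y v)))"
    by (simp add: lquot_mult graded_act_add graded_act_const_ser_mult Suc act_add act_scale
        act_sum case_prod_beta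
        sum.distrib scale_sum_right)
  also have "(\<Sum>(k, l)\<in>gens n. \<Sum>i\<le>d. act k l (graded_act i (lquot (k, l) x) (graded_act (d - i) y
      v)))
      = (\<Sum>i\<le>d. graded_act (Suc i) x (graded_act (d - i) y v))"
    by (simp add: case_prod_beta) (rule sum.swap)
  finally show ?case
    by (simp add: sum.atMost_Suc_shift del: sum.atMost_Suc)
qed simp

lemma graded_act_vanish: "vanish m x \<Longrightarrow> d \<le> m \<Longrightarrow> graded_act d x v = 0"
proof (induction d arbitrary: m x)
  case (Suc d)
  have "graded_act d (lquot a x) v = 0" for a
    using Suc.prems by (intro Suc.IH[of "m - 1"]) (auto simp: vanish_def)
  then show ?case by (simp add: case_prod_beta)
qed (simp add: vanish_def)

lemma graded_act_subst_lin_ser_gen: "graded_act d (subst_lin n ser_gen x) v = graded_act d x v"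
proof (induction d arbitrary: x)
  case (Suc d)
  have "lquot b (subst_lin n ser_gen x) = subst_lin n ser_gen (lquot b x)" if "b \<in> gens n" for b
  proof -
    have "lquot b (subst_lin n ser_gen x) = (\<Sum>a\<in>gens n. if a = b then subst_lin n ser_gen (lquot b
        x) else 0)"
      unfolding lquot_subst_lin by (intro sum.cong) (auto simp: coef_ser_gen)
    then show ?thesis using that by simp
  qed
  then show ?case
    by (auto simp: Suc intro!: sum.cong)
qed simp

lemma graded_act_linear_form: "linear_form x \<Longrightarrow> d \<noteq> 1 \<Longrightarrow> graded_act d x v = 0"
proof (cases d)
  case (Suc e)
  assume "linear_form x" "d \<noteq> 1"
  then show ?thesis
    using Suc by (cases e) (simp_all add: lquot_linear_form case_prod_beta)
qed simp

lemma graded_act_linear_form_mult: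
  assumes "linear_form x" shows "graded_act (Suc d) (x * y) v = graded_act 1 x (graded_act d y v)"
      "graded_act 0 (x * y) v = 0"
proof -
  have "graded_act (Suc d) (x * y) v = (\<Sum>i\<le>Suc d. if i = 1 then graded_act 1 x (graded_act d y v)
      else 0)"
    unfolding graded_act_mult using graded_act_linear_form[OF assms] by (intro sum.cong) auto
  then show "graded_act (Suc d) (x * y) v = graded_act 1 x (graded_act d y v)" by simp
qed (use assms in simp)

lemma graded_act_tgen:
  assumes "i \<noteq> j" "{i, j} \<subseteq> {1..n}"
  shows "graded_act 1 (tgen i j) v = act (min i j) (max i j) v"
proof -
  let ?p = "(min i j, max i j)"
  have "graded_act 1 (tgen i j) v = (\<Sum>a\<in>gens n. if a = ?p then act (min i j) (max i j) v else 0)"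
    unfolding One_nat_def graded_act.simps by (intro sum.cong refl) (auto split: prod.splits)
  then show ?thesis
    using minmax_gens[OF assms] by simp
qed

lemma graded_act_tsum:
  assumes "A \<subseteq> {1..n}" "B \<subseteq> {1..n}" "A \<inter> B = {}"
  shows "graded_act 1 (tsum A B) v = (\<Sum>i\<in>A. \<Sum>j\<in>B. act (min i j) (max i j) v)"
  unfolding tsum_def graded_act_sum by (intro sum.cong refl graded_act_tgen) (use assms in auto)

definition ker :: "nat \<Rightarrow> 'a ser set" where
  "ker m = {x. \<forall>d\<le>m. \<forall>v. graded_act d x v = 0}"

lemma kerI: "(\<And>d v. d \<le> m \<Longrightarrow> graded_act d x v = 0) \<Longrightarrow> x \<in> ker m"
  by (simp add: ker_def)

lemma kerD: "x \<in> ker m \<Longrightarrow> d \<le> m \<Longrightarrow> graded_act d x v = 0"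
  by (simp add: ker_def)

text \<open>In degree \<open>d\<close> a product involves only parts of degree at most
  \<open>d\<close> of each factor, so bounding the degree by \<open>m\<close> still gives a
  two-sided ideal.\<close>

lemma ideal_ker: "two_sided_ideal (ker m)"
proof
  fix x y a :: "'a ser"
  show "0 \<in> ker m" by (rule kerI) simp
  show "x \<in> ker m \<Longrightarrow> y \<in> ker m \<Longrightarrow> x + y \<in> ker m"
    by (rule kerI) (simp add: graded_act_add kerD)
  show "x \<in> ker m \<Longrightarrow> a * x \<in> ker m" "x \<in> ker m \<Longrightarrow> x * a \<in> ker m"
    by (rule kerI; simp add: graded_act_mult kerD)+
qed

lemma graded_act_linear_form_linear_form:
  assumes "linear_form x" "linear_form y"
  shows "graded_act d (x * y) v = (if d = 2 then graded_act 1 x (graded_act 1 y v) else 0)"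
proof (cases d)
  case (Suc e)
  have "graded_act d (x * y) v = graded_act 1 x (graded_act e y v)"
    unfolding Suc by (rule graded_act_linear_form_mult(1)[OF assms(1)])
  then show ?thesis
    using graded_act_linear_form[OF assms(2), of e v] Suc by (cases "e = 1") auto
qed (use assms in simp)

text \<open>Relators are homogeneous of degree 2, so only \<open>d = 2\<close> has content, and
  there the module assumptions apply.\<close>

lemma J_ker: "x \<in> J n m \<Longrightarrow> x \<in> ker m"
proof -
  assume "x \<in> J n m"
  then have "subst_lin n ser_gen x \<in> ker m"
    using ideal_ker
  proof (rule J_induct)
    show "vanish m x \<Longrightarrow> x \<in> ker m" for x
      by (rule kerI) (rule graded_act_vanish)
    show "Ser ` pb_rels n \<subseteq> ker m"
    proof (rule subsetI, rule kerI)
      fix x :: "'a ser" and d v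
      assume "x \<in> Ser ` pb_rels n"
      then consider (1) i j k l where "x = tgen i j * tgen k l - tgen k l * tgen i j"
          "distinct [i, j, k, l]" "{i, j, k, l} \<subseteq> {1..n}"
        | (2) i j k where "x = tgen i j * (tgen i k + tgen j k) - (tgen i k + tgen j k) * tgen i j"
          "distinct [i, j, k]" "{i, j, k} \<subseteq> {1..n}"
        unfolding Ser_rels by (elim UnE CollectE exE conjE) (rule that(1) that(2); assumption)+
      then show "graded_act d x v = 0"
      proof cases
        case 1
        then show ?thesis
          using act_disjoint[OF 1(2,3), of v] by (simp add: graded_act_diff
              graded_act_linear_form_linear_form linear_form_ser_gen graded_act_tgen del:
              graded_act.simps One_nat_def)
      next
        case 2
        then show ?thesis
          using act_triple[OF 2(2,3), of v]
          by (simp add: distrib_left distrib_right graded_act_add graded_act_diff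
              graded_act_linear_form_linear_form linear_form_ser_gen graded_act_tgen act_add del:
              graded_act.simps One_nat_def)
      qed
    qed
  qed
  then show ?thesis
    by (simp add: ker_def graded_act_subst_lin_ser_gen)
qed

lemma graded_act_eqv:
  assumes "x \<simeq>\<^bsub>J n m\<^esub> y"
  shows "graded_act m x v = graded_act m y v"
  using kerD[OF J_ker, of "x - y" m m v] assms by (simp add: eqv_def graded_act_diff)

lemma graded_act_cable3_power: "graded_act i (cable3 A B C (tgen 2 3 ^ i)) v = (graded_act 1 (tsum
    B C) ^^ i) v"
proof (induction i)
  case (Suc i)
  have "graded_act (Suc i) (cable3 A B C (tgen 2 3 ^ Suc i)) v = graded_act (Suc i) (tsum B C *
      cable3 A B C (tgen 2 3 ^ i)) v"
    by simp
  also have "\<dots> = graded_act 1 (tsum B C) (graded_act i (cable3 A B C (tgen 2 3 ^ i)) v)"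
    by (rule graded_act_linear_form_mult) simp
  finally show ?case by (simp only: Suc funpow.simps o_apply)
qed simp

lemma graded_act_cable3_word_prod:
  "graded_act (length u + i) (cable3 A B C (word_prod u * tgen 2 3 ^ i)) v =
    foldr (\<lambda>b. if b then graded_act 1 (tsum A C) else graded_act 1 (tsum A B)) u ((graded_act 1
        (tsum B C) ^^ i) v)"
proof (induction u)
  case Nil
  show ?case using graded_act_cable3_power[of i A B C v] by (simp del: graded_act.simps One_nat_def)
next
  case (Cons b u)
  have "graded_act (length (b # u) + i) (cable3 A B C (word_prod (b # u) * tgen 2 3 ^ i)) v =
      graded_act (Suc (length u + i)) ((if b then tsum A C else tsum A B) * cable3 A B C
          (word_prod u * tgen 2 3 ^ i)) v"
    by (simp add: mult.assoc del: graded_act.simps)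
  also have "\<dots> = graded_act 1 (if b then tsum A C else tsum A B) (graded_act (length u + i)
      (cable3 A B C (word_prod u * tgen 2 3 ^ i)) v)"
    by (rule graded_act_linear_form_mult) simp
  finally show ?case
    unfolding Cons by (simp del: graded_act.simps One_nat_def)
qed

lemma graded_act_cable3_nform:
  "graded_act k (cable3 A B C (nform k c)) v = (\<Sum>u\<in>words_upto k. c u *s
    foldr (\<lambda>b. if b then graded_act 1 (tsum A C) else graded_act 1 (tsum A B)) u ((graded_act 1
        (tsum B C) ^^ (k - length u)) v))"
proof -
  have "graded_act k (cable3 A B C (nform k c)) v =
      (\<Sum>u\<in>words_upto k. c u *s graded_act k (cable3 A B C (word_prod u * tgen 2 3 ^ (k - length
          u))) v)"
    by (simp add: nform_def graded_act_sum graded_act_const_ser_mult del: graded_act.simps)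
  also have "\<dots> = (\<Sum>u\<in>words_upto k. c u *s
    foldr (\<lambda>b. if b then graded_act 1 (tsum A C) else graded_act 1 (tsum A B)) u ((graded_act 1
        (tsum B C) ^^ (k - length u)) v))"
  proof (intro sum.cong refl)
    fix u :: "bool list" assume "u \<in> words_upto k"
    then have "length u + (k - length u) = k"
      by (simp add: words_upto_def)
    then show "c u *s graded_act k (cable3 A B C (word_prod u * tgen 2 3 ^ (k - length u))) v = c
        u *s
    foldr (\<lambda>b. if b then graded_act 1 (tsum A C) else graded_act 1 (tsum A B)) u ((graded_act 1
        (tsum B C) ^^ (k - length u)) v)"
      using graded_act_cable3_word_prod[of u "k - length u" A B C v] by simp
  qed
  finally show ?thesis .
qed

end

section \<open>The four-strand action on words in three letters\<close>

datatype strand = S2 | S3 | S4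

definition scale_fun :: "'a::comm_ring_1 \<Rightarrow> ('b \<Rightarrow> 'a) \<Rightarrow> 'b \<Rightarrow> 'a" where
  "scale_fun c v = (\<lambda>w. c * v w)"

definition prepend :: "strand set \<Rightarrow> (strand list \<Rightarrow> 'a::comm_ring_1) \<Rightarrow> strand list \<Rightarrow> 'a" where
  "prepend P v w = (case w of [] \<Rightarrow> 0 | a # u \<Rightarrow> if a \<in> P then v u else 0)"

abbreviation "prepend1 a \<equiv> prepend {a}"

text \<open>In coordinates: the derivation of the free algebra with \<open>a \<mapsto> [a, b]\<close>, \<open>b \<mapsto> [b, a]\<close>
  that kills the third letter.\<close>
fun pair_deriv :: "strand \<Rightarrow> strand \<Rightarrow> (strand list \<Rightarrow> 'a::comm_ring_1) \<Rightarrow> strand list \<Rightarrow> 'a" where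
  "pair_deriv a b v [] = 0"
| "pair_deriv a b v [c] = 0"
| "pair_deriv a b v (c # d # w) = (if c = a \<and> d = b then v (a # w) - v (b # w)
     else if c = b \<and> d = a then v (b # w) - v (a # w) else 0) + pair_deriv a b (\<lambda>u. v (c # u)) (d
         # w)"

lemma prepend_simps [simp]:
  "prepend P v [] = 0" "prepend P v (a # u) = (if a \<in> P then v u else 0)"
  by (simp_all add: prepend_def)

lemma prepend_add: "prepend P (v + w) = prepend P v + prepend P w"
  and prepend_diff: "prepend P (v - w) = prepend P v - prepend P w"
  and prepend_scale: "prepend P (scale_fun c v) = scale_fun c (prepend P v)"
  by (auto simp: fun_eq_iff prepend_def scale_fun_def split: list.split)

lemma pair_deriv_add_pt: "pair_deriv a b (\<lambda>u. v u + w u) z = pair_deriv a b v z + pair_deriv a b w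
    z"
  by (induction a b v z arbitrary: w rule: pair_deriv.induct) simp_all

lemma pair_deriv_scale_pt: "pair_deriv a b (\<lambda>u. c * v u) z = c * pair_deriv a b v z"
  by (induction a b v z rule: pair_deriv.induct) (simp_all add: algebra_simps)

lemma pair_deriv_add: "pair_deriv a b (v + w) = pair_deriv a b v + pair_deriv a b w"
  using pair_deriv_add_pt[of a b v w] by (simp add: fun_eq_iff plus_fun_def)

lemma pair_deriv_scale: "pair_deriv a b (scale_fun c v) = scale_fun c (pair_deriv a b v)"
  using pair_deriv_scale_pt[of a b c v] by (simp add: fun_eq_iff scale_fun_def)

lemma pair_deriv_diff: "pair_deriv a b (v - w) = pair_deriv a b v - pair_deriv a b w"
  using pair_deriv_add[of a b "v - w" w] by (simp add: algebra_simps)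

lemma prepend_0 [simp]: "prepend P 0 = 0"
  using prepend_diff[of P 0 0] by simp

lemma pair_deriv_0 [simp]: "pair_deriv a b 0 = 0"
  using pair_deriv_diff[of a b 0 0] by simp

lemma pair_deriv_0_pt: "pair_deriv a b (\<lambda>u. 0) z = 0"
  using pair_deriv_scale_pt[of a b 0 "\<lambda>_. 0" z] by simp

lemma pair_deriv_commute: "pair_deriv a b v = pair_deriv b a v"
proof (cases "a = b")
  case False
  have "pair_deriv a b v w = pair_deriv b a v w" for w
    using False by (induction a b v w rule: pair_deriv.induct) simp_all
  then show ?thesis by (simp add: fun_eq_iff)
qed simp

text \<open>Leibniz rule for left multiplication by a letter. It supplies the relations between t^1j
  and the generators acting as derivations.\<close>

lemma pair_deriv_prepend:
  assumes "a \<noteq> b"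
  shows "pair_deriv a b (prepend1 c v) = prepend1 c (pair_deriv a b v) +
    (if c = a then prepend1 a (prepend1 b v) - prepend1 b (prepend1 a v)
     else if c = b then prepend1 b (prepend1 a v) - prepend1 a (prepend1 b v) else 0)"
proof
  fix w
  show "pair_deriv a b (prepend1 c v) w = (prepend1 c (pair_deriv a b v) +
    (if c = a then prepend1 a (prepend1 b v) - prepend1 b (prepend1 a v)
     else if c = b then prepend1 b (prepend1 a v) - prepend1 a (prepend1 b v) else 0)) w"
  proof (cases w rule: remdups_adj.cases)
    case (3 d e u)
    have "pair_deriv a b (\<lambda>u. prepend1 c v (d # u)) (e # u) = (if d = c then pair_deriv a b v (e #
        u) else 0)"
      by (simp add: pair_deriv_0_pt)
    then show ?thesis
      using 3 assms by auto
  qed simp_all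
qed

definition unit_word :: "strand list \<Rightarrow> 'a::comm_ring_1" where
  "unit_word w = (if w = [] then 1 else 0)"

lemma pair_deriv_unit_word: "pair_deriv a b unit_word = 0"
proof
  fix w show "pair_deriv a b unit_word w = (0 :: strand list \<Rightarrow> 'a) w"
    by (cases w rule: remdups_adj.cases) (simp_all add: unit_word_def pair_deriv_0_pt)
qed

lemma word_decomp:
  fixes v :: "strand list \<Rightarrow> 'a::comm_ring_1"
  shows "v = scale_fun (v []) unit_word + prepend1 S2 (\<lambda>u. v (S2 # u))
    + prepend1 S3 (\<lambda>u. v (S3 # u)) + prepend1 S4 (\<lambda>u. v (S4 # u))"
proof
  fix w
  show "v w = (scale_fun (v []) unit_word + prepend1 S2 (\<lambda>u. v (S2 # u))
    + prepend1 S3 (\<lambda>u. v (S3 # u)) + prepend1 S4 (\<lambda>u. v (S4 # u))) w"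
  proof (cases w)
    case (Cons a u)
    then show ?thesis by (cases a) (simp_all add: scale_fun_def unit_word_def)
  qed (simp add: scale_fun_def unit_word_def)
qed

text \<open>The difference of both sides is a commutator of derivations that kills every letter. It
  therefore commutes with left multiplication by letters, and since it also kills 1, it vanishes on
  all words.\<close>

lemma pair_deriv_triple:
  fixes v :: "strand list \<Rightarrow> 'a::comm_ring_1"
  assumes abc: "distinct [a, b, c]"
  shows "pair_deriv a b (pair_deriv a c v) + pair_deriv a b (pair_deriv b c v) = pair_deriv a c
      (pair_deriv a b v) + pair_deriv b c (pair_deriv a b v)"
proof -
  define K where "K v = pair_deriv a b (pair_deriv a c v) + pair_deriv a b (pair_deriv b c v) -
      pair_deriv a c (pair_deriv a b v) - pair_deriv b c (pair_deriv a b v)"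
    for v :: "strand list \<Rightarrow> 'a"
  have K_add: "K (v + w) = K v + K w" for v w
    by (simp add: K_def pair_deriv_add)
  have K_unit: "K (scale_fun r unit_word) = 0" for r
  proof -
    have "scale_fun r (0 :: strand list \<Rightarrow> 'a) = 0"
      by (simp add: scale_fun_def fun_eq_iff)
    then show ?thesis
      by (simp add: K_def pair_deriv_scale pair_deriv_unit_word)
  qed
  have K_prepend: "K (prepend1 d v) = prepend1 d (K v)" for d v
  proof -
    have "d = a \<or> d = b \<or> d = c"
      using abc by (cases a; cases b; cases c; cases d) simp_all
    moreover have "a \<noteq> b" "b \<noteq> a" "a \<noteq> c" "c \<noteq> a" "b \<noteq> c" "c \<noteq> b"
      using abc by auto
    ultimately show ?thesis
      by (elim disjE)
        (simp_all add: K_def pair_deriv_prepend pair_deriv_add pair_deriv_diff prepend_add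
            prepend_diff algebra_simps)
  qed
  have "K v w = 0" for w
  proof (induction w arbitrary: v)
    case Nil
    show ?case by (simp add: K_def)
  next
    case (Cons d w)
    have "K v (d # w) = K (scale_fun (v []) unit_word + prepend1 S2 (\<lambda>u. v (S2 # u))
        + prepend1 S3 (\<lambda>u. v (S3 # u)) + prepend1 S4 (\<lambda>u. v (S4 # u))) (d # w)"
      using word_decomp[of v] by simp
    also have "\<dots> = K (\<lambda>u. v (d # u)) w"
      unfolding K_add K_unit K_prepend by (cases d) simp_all
    finally show ?case using Cons by simp
  qed
  then have "K v = 0" by (simp add: fun_eq_iff)
  then show ?thesis by (simp add: K_def algebra_simps)
qed

text \<open>\<open>t\<^sup>1\<^sup>j\<close> multiplies by the letter \<open>j\<close> and the other generators act as derivations. The extra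
  identity in \<open>t\<^sup>2\<^sup>4\<close> makes the powers of \<open>t\<^sup>2\<^sup>3\<close> in a normal form visible.\<close>
definition act4 :: "nat \<Rightarrow> nat \<Rightarrow> (strand list \<Rightarrow> 'a::comm_ring_1) \<Rightarrow> strand list \<Rightarrow> 'a" where
  "act4 i j v = (if i = 1 then prepend1 (if j = 2 then S2 else if j = 3 then S3 else S4) v
     else if i = 2 then (if j = 3 then pair_deriv S2 S3 v else pair_deriv S2 S4 v + v) else
         pair_deriv S3 S4 v)"

lemma module_scale_fun: "module (scale_fun :: 'a::comm_ring_1 \<Rightarrow> ('b \<Rightarrow> 'a) \<Rightarrow> _)"
  by unfold_locales (simp_all add: scale_fun_def fun_eq_iff algebra_simps)

lemma scale_fun_add: "scale_fun c (v + w) = scale_fun c v + scale_fun c w"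
  by (simp add: scale_fun_def fun_eq_iff algebra_simps)

lemma in_Icc4: "{i, j, k} \<subseteq> {1..4::nat} \<Longrightarrow> (i = 1 \<or> i = 2 \<or> i = 3 \<or> i = 4) \<and>
    (j = 1 \<or> j = 2 \<or> j = 3 \<or> j = 4) \<and> (k = 1 \<or> k = 2 \<or> k = 3 \<or> k = 4)"
  by auto

interpretation act4: word_action scale_fun 4 act4
proof (intro word_action.intro module_scale_fun word_action_axioms.intro)
  fix i j k l :: nat and v w :: "strand list \<Rightarrow> 'a" and b
  show "act4 i j (v + w) = act4 i j v + act4 i j w"
    by (simp add: act4_def prepend_add pair_deriv_add)
  show "act4 i j (scale_fun b v) = scale_fun b (act4 i j v)"
    by (simp add: act4_def prepend_scale pair_deriv_scale scale_fun_add)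
  assume "distinct [i, j, k, l]" "{i, j, k, l} \<subseteq> {1..4}"
  then have "i \<noteq> j" "i \<noteq> k" "i \<noteq> l" "j \<noteq> k" "j \<noteq> l" "k \<noteq> l"
    "(i = 1 \<or> i = 2 \<or> i = 3 \<or> i = 4) \<and> (j = 1 \<or> j = 2 \<or> j = 3 \<or> j = 4) \<and> (k = 1 \<or> k = 2 \<or> k = 3 \<or>
        k = 4)"
    "l = 1 \<or> l = 2 \<or> l = 3 \<or> l = 4"
    using in_Icc4[of i j k] in_Icc4[of l l l] by simp_all
  then show "act4 (min i j) (max i j) (act4 (min k l) (max k l) v) =
      act4 (min k l) (max k l) (act4 (min i j) (max i j) v)"
    by (elim conjE disjE) (simp_all add: act4_def pair_deriv_prepend prepend_add)
next
  fix i j k :: nat and v :: "strand list \<Rightarrow> 'a"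
  have sym: "pair_deriv S3 S2 v = pair_deriv S2 S3 v" "pair_deriv S4 S2 v = pair_deriv S2 S4 v"
      "pair_deriv S4 S3 v = pair_deriv S3 S4 v"
    for v :: "strand list \<Rightarrow> 'a"
    by (rule pair_deriv_commute)+
  note triples = pair_deriv_triple[of S2 S3 S4 v] pair_deriv_triple[of S2 S4 S3 v]
      pair_deriv_triple[of S3 S4 S2 v]
  assume "distinct [i, j, k]" "{i, j, k} \<subseteq> {1..4}"
  then have "i \<noteq> j" "i \<noteq> k" "j \<noteq> k"
    "(i = 1 \<or> i = 2 \<or> i = 3 \<or> i = 4) \<and> (j = 1 \<or> j = 2 \<or> j = 3 \<or> j = 4) \<and> (k = 1 \<or> k = 2 \<or> k = 3 \<or>
        k = 4)"
    using in_Icc4[of i j k] by simp_all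
  then show "act4 (min i j) (max i j) (act4 (min i k) (max i k) v + act4 (min j k) (max j k) v) =
      act4 (min i k) (max i k) (act4 (min i j) (max i j) v) +
      act4 (min j k) (max j k) (act4 (min i j) (max i j) v)"
    using triples
    by (elim conjE disjE)
      (simp_all add: act4_def pair_deriv_prepend prepend_add pair_deriv_add sym algebra_simps)
qed

text \<open>The action through the commutative quotient: \<open>t\<^sup>1\<^sup>3\<close> and \<open>t\<^sup>2\<^sup>3\<close> shift the two exponents.\<close>
definition act3 :: "nat \<Rightarrow> nat \<Rightarrow> (nat \<times> nat \<Rightarrow> 'a::comm_ring_1) \<Rightarrow> nat \<times> nat \<Rightarrow> 'a" where
  "act3 i j v = (if j = 2 then v
     else if i = 1 then (\<lambda>(p, q). if p = 0 then 0 else v (p - 1, q))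
     else (\<lambda>(p, q). if q = 0 then 0 else v (p, q - 1)))"

lemma act3_commute: "act3 i j (act3 k l v) = act3 k l (act3 i j v)"
  by (auto simp: act3_def fun_eq_iff)

lemma act3_add: "act3 i j (v + w) = act3 i j v + act3 i j w"
  by (auto simp: act3_def fun_eq_iff)

interpretation act3: word_action scale_fun 3 act3
proof (intro word_action.intro module_scale_fun word_action_axioms.intro)
  fix i j k l :: nat and v w :: "nat \<times> nat \<Rightarrow> 'a" and b
  show "act3 i j (v + w) = act3 i j v + act3 i j w"
    by (rule act3_add)
  show "act3 i j (scale_fun b v) = scale_fun b (act3 i j v)"
    by (auto simp: act3_def fun_eq_iff scale_fun_def)
  show "act3 (min i j) (max i j) (act3 (min k l) (max k l) v) =
      act3 (min k l) (max k l) (act3 (min i j) (max i j) v)"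
    by (rule act3_commute)
  show "act3 (min i j) (max i j) (act3 (min i k) (max i k) v + act3 (min j k) (max j k) v) =
      act3 (min i k) (max i k) (act3 (min i j) (max i j) v) +
      act3 (min j k) (max j k) (act3 (min i j) (max i j) v)"
    unfolding act3_add by (simp only: act3_commute[of "min i j" "max i j"])
qed

section \<open>Vanishing of the defect\<close>

lemma sum_fun_apply: "sum f A w = (\<Sum>a\<in>A. f a w)" for f :: "'b \<Rightarrow> 'c \<Rightarrow> 'a::comm_monoid_add"
  by (induction A rule: infinite_finite_induct) simp_all

text \<open>Since the letter sets are disjoint, \<open>w\<close> determines \<open>u\<close>: a
  given word receives a contribution from only one normal form.\<close>

lemma list_all2_letters:
  assumes "P \<inter> Q = {}"
  shows "list_all2 (\<lambda>b a. a \<in> (if b then Q else P)) u w \<longleftrightarrow>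
    set w \<subseteq> P \<union> Q \<and> u = map (\<lambda>a. a \<in> Q) w"
proof (induction w arbitrary: u)
  case (Cons a w)
  have "a \<notin> P \<or> a \<notin> Q" using assms by blast
  then show ?case
    by (cases u) (auto simp: Cons split: if_splits)
qed simp

text \<open>Coefficient at \<open>w\<close> of a cabled normal form applied to 1: \<open>P\<close>
  and \<open>Q\<close> are the letter sets of the images of t12 and t13, and \<open>e\<close> is the
  eigenvalue on 1 of the image of t23. For \<open>e = 0\<close> and words of length at most
  \<open>N\<close>, the convention 0^0 = 1 keeps exactly those of length \<open>N\<close>.\<close>

definition letter_value ::
  "nat \<Rightarrow> (bool list \<Rightarrow> 'a::comm_ring_1) \<Rightarrow> strand set \<Rightarrow> strand set \<Rightarrow> 'a \<Rightarrow> strand list \<Rightarrow> 'a" where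
  "letter_value N c P Q e w =
    (if set w \<subseteq> P \<union> Q then c (map (\<lambda>a. a \<in> Q) w) * e ^ (N - length w) else 0)"

lemma foldr_prepend:
  "foldr (\<lambda>b. if b then prepend Q else prepend P) u (scale_fun e unit_word) w =
    (if list_all2 (\<lambda>b a. a \<in> (if b then Q else P)) u w then e else 0)"
proof (induction u arbitrary: w)
  case Nil
  show ?case by (simp add: scale_fun_def unit_word_def)
next
  case (Cons b u)
  then show ?case by (cases w) simp_all
qed

lemma act4_nform:
  fixes c :: "bool list \<Rightarrow> 'a::comm_ring_1"
  assumes PQ: "P \<inter> Q = {}" and len: "length w \<le> N"
    and P: "\<And>v :: strand list \<Rightarrow> 'a. act4.graded_act 1 (tsum A B) v = prepend P v"
    and Q: "\<And>v :: strand list \<Rightarrow> 'a. act4.graded_act 1 (tsum A C) v = prepend Q v"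
    and e: "act4.graded_act 1 (tsum B C) unit_word = scale_fun (e :: 'a) unit_word"
  shows "act4.graded_act N (cable3 A B C (nform N c)) unit_word w = letter_value N c P Q e w"
proof -
  have ei: "(act4.graded_act 1 (tsum B C) ^^ i) unit_word = scale_fun (e ^ i) unit_word" for i
  proof (induction i)
    case (Suc i)
    have "act4.graded_act 1 (tsum B C) (scale_fun (e ^ i) unit_word) = scale_fun (e ^ i)
        (scale_fun e unit_word)"
      by (simp only: act4.graded_act_arg_scale e)
    then show ?case
      by (simp only: funpow.simps o_apply Suc) (simp add: scale_fun_def mult_ac)
  qed (simp add: scale_fun_def fun_eq_iff)
  have PQ': "(\<lambda>b. if b then act4.graded_act 1 (tsum A C) else act4.graded_act 1 (tsum A B)) =
      (\<lambda>b. if b then prepend Q else (prepend P :: (strand list \<Rightarrow> 'a) \<Rightarrow> _))"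
  proof -
    have "act4.graded_act 1 (tsum A B) = (prepend P :: (strand list \<Rightarrow> 'a) \<Rightarrow> _)"
      by (rule ext) (rule P)
    moreover have "act4.graded_act 1 (tsum A C) = (prepend Q :: (strand list \<Rightarrow> 'a) \<Rightarrow> _)"
      by (rule ext) (rule Q)
    ultimately show ?thesis by (simp only:)
  qed
  let ?u = "map (\<lambda>a. a \<in> Q) w"
  have "act4.graded_act N (cable3 A B C (nform N c)) unit_word w = (\<Sum>u\<in>words_upto N. c u *
     (if set w \<subseteq> P \<union> Q \<and> u = ?u then e ^ (N - length u) else 0))"
    unfolding act4.graded_act_cable3_nform PQ' ei sum_fun_apply
    by (simp only: scale_fun_def[of "c _"] foldr_prepend list_all2_letters[OF PQ])
  also have "\<dots> = (\<Sum>u\<in>words_upto N. if u = ?u then letter_value N c P Q e w else 0)"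
    by (intro sum.cong refl) (simp add: letter_value_def)
  also have "\<dots> = letter_value N c P Q e w"
    using len by (subst sum.delta[OF finite_words_upto]) (simp add: words_upto_def)
  finally show ?thesis .
qed

text \<open>Derivations kill 1, so the eigenvalue is 1 for the two pairs of bundles containing the
  chord from 2 to 4, which carries the extra identity, and 0 for the other pairs.\<close>

lemma act4_forms:
  "act4.graded_act 1 (tsum {1} {2}) v = prepend {S2} v" "act4.graded_act 1 (tsum {1} {3}) v =
      prepend {S3} v"
  "act4.graded_act 1 (tsum {1} {4}) v = prepend {S4} v" "act4.graded_act 1 (tsum {1} {2, 3}) v =
      prepend {S2, S3} v"
  "act4.graded_act 1 (tsum {1} {3, 4}) v = prepend {S3, S4} v"
  "act4.graded_act 1 (tsum {2} {3}) unit_word = scale_fun 0 unit_word"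
  "act4.graded_act 1 (tsum {3} {2}) unit_word = scale_fun 0 unit_word"
  "act4.graded_act 1 (tsum {3} {4}) unit_word = scale_fun 0 unit_word"
  "act4.graded_act 1 (tsum {2} {3, 4}) unit_word = scale_fun 1 unit_word"
  "act4.graded_act 1 (tsum {2, 3} {4}) unit_word = scale_fun 1 unit_word"
proof -
  have Un: "prepend {S2, S3} v = prepend1 S2 v + prepend1 S3 v"
    "prepend {S3, S4} v = prepend1 S3 v + prepend1 S4 v"
    by (auto simp: fun_eq_iff prepend_def split: list.split)
  show "act4.graded_act 1 (tsum {1} {2}) v = prepend {S2} v" "act4.graded_act 1 (tsum {1} {3}) v =
      prepend {S3} v"
    "act4.graded_act 1 (tsum {1} {4}) v = prepend {S4} v" "act4.graded_act 1 (tsum {1} {2, 3}) v =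
        prepend {S2, S3} v"
    "act4.graded_act 1 (tsum {1} {3, 4}) v = prepend {S3, S4} v"
    unfolding Un by (subst act4.graded_act_tsum; simp add: act4_def)+
  have scale: "scale_fun 0 unit_word = 0" "scale_fun 1 v = v" for v
    by (simp_all add: scale_fun_def fun_eq_iff)
  show "act4.graded_act 1 (tsum {2} {3}) unit_word = scale_fun 0 unit_word"
    "act4.graded_act 1 (tsum {3} {2}) unit_word = scale_fun 0 unit_word"
    "act4.graded_act 1 (tsum {3} {4}) unit_word = scale_fun 0 unit_word"
    "act4.graded_act 1 (tsum {2} {3, 4}) unit_word = scale_fun 1 unit_word"
    "act4.graded_act 1 (tsum {2, 3} {4}) unit_word = scale_fun 1 unit_word"
    unfolding scale by (subst act4.graded_act_tsum; simp add: act4_def pair_deriv_unit_word)+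
qed

definition origin :: "nat \<times> nat \<Rightarrow> 'a::comm_ring_1" where
  "origin = (\<lambda>(p, q). if p = 0 \<and> q = 0 then 1 else 0)"

text \<open>\<open>p\<close> counts t13 and \<open>q\<close> counts t23. The number of t12 is then N
  - p - q, so letting t12 act as the identity loses no information.\<close>

lemma act3_nform:
  "act3.graded_act N (cable3 {1} {2} {3} (nform N c)) origin (p, q) =
    (\<Sum>u\<in>words_upto N. if length (filter id u) = p \<and> N - length u = q then c u else 0)"
proof -
  have forms: "act3.graded_act 1 (tsum {1} {2}) v = v"
    "act3.graded_act 1 (tsum {1} {3}) v = (\<lambda>(p, q). if p = 0 then 0 else v (p - 1, q))"
    "act3.graded_act 1 (tsum {2} {3}) v = (\<lambda>(p, q). if q = 0 then 0 else v (p, q - 1))"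
    for v :: "nat \<times> nat \<Rightarrow> 'a"
    by (subst act3.graded_act_tsum; simp add: act3_def)+
  have pow: "(act3.graded_act 1 (tsum {2} {3}) ^^ i) origin = (\<lambda>(p, q). if p = 0 \<and> q = i then 1
      else (0 :: 'a))" for i
    by (induction i) (auto simp: origin_def forms[unfolded One_nat_def] fun_eq_iff simp del:
        act3.graded_act.simps)
  have fold: "foldr (\<lambda>b. if b then act3.graded_act 1 (tsum {1} {3}) else act3.graded_act 1 (tsum
      {1} {2})) u
      (\<lambda>(p, q). if p = 0 \<and> q = i then 1 else 0) (p, q) =
    (if length (filter id u) = p \<and> i = q then 1 else (0 :: 'a))" for u i p q
    by (induction u arbitrary: p q)
      (auto simp: forms[unfolded One_nat_def] split: if_splits simp del: act3.graded_act.simps)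
  show ?thesis
    unfolding act3.graded_act_cable3_nform sum_fun_apply pow
    by (intro sum.cong refl) (simp only: scale_fun_def fold, simp)
qed

text \<open>A function on words in two letters is read as a function on subsets \<open>{i. u ! i}\<close> of
  positions. The cocycle equation makes it constant along inclusions of proper nonempty subsets;
  the symmetry links a point with its complement, and the last equation kills the common value.\<close>
lemma coefficients_vanish:
  fixes c :: "bool list \<Rightarrow> 'a::comm_ring_1"
  assumes Qalg: "\<And>k::nat. 0 < k \<Longrightarrow> of_nat k dvd (1::'a)"
    and N: "0 < N"
    and cocycle: "\<And>w. length w \<le> N \<Longrightarrow>
      letter_value N c {S2} {S3, S4} 1 w + letter_value N c {S3} {S4} 0 w =
      letter_value N c {S2, S3} {S4} 1 w + letter_value N c {S2} {S3} 0 w"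
    and sym: "\<And>w. length w = N \<Longrightarrow> letter_value N c {S3} {S2} 0 w = letter_value N c {S2} {S3} 0 w"
    and abelian: "\<And>p q.
      (\<Sum>u\<in>words_upto N. if length (filter id u) = p \<and> N - length u = q then c u else 0) = 0"
    and u: "length u \<le> N"
  shows "c u = 0"
proof (cases "length u = N")
  case False
  \<comment> \<open>Below length \<open>N\<close> both terms with eigenvalue 0 disappear. On a word
    in \<open>S3\<close>, \<open>S4\<close> the first bundling sees a single letter and the other
    one sees \<open>v\<close>.\<close>
  have const: "c v = c (replicate (length u) True)" if "length v = length u" for v
  proof -
    let ?w = "map (\<lambda>b. if b then S4 else S3) v"
    have "map (\<lambda>a. a \<in> {S3, S4}) ?w = replicate (length u) True"
      using that by (auto simp: list_eq_iff_nth_eq)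
    moreover have "map (\<lambda>a. a \<in> {S4}) ?w = v"
      by (auto simp: list_eq_iff_nth_eq)
    moreover have "letter_value N c P Q 0 ?w = 0" for P Q
      using False u that by (simp add: letter_value_def zero_power)
    moreover have "set ?w \<subseteq> {S2} \<union> {S3, S4}" "set ?w \<subseteq> {S2, S3} \<union> {S4}"
      by auto
    moreover have "length ?w \<le> N"
      using u that by simp
    ultimately show ?thesis
      using cocycle[of ?w] unfolding letter_value_def[of _ _ _ _ 1]
      by (simp only: if_True power_one mult_1_right add_0_right)
  qed
  \<comment> \<open>Without t13 the commutative quotient isolates one normal form, and its
    coefficient is the common value.\<close>
  have "0 = (\<Sum>v\<in>words_upto N. if length (filter id v) = 0 \<and> N - length v = N - length u then c v
      else 0)"
    by (rule abelian[symmetric])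
  also have "\<dots> = (\<Sum>v\<in>words_upto N. if v = replicate (length u) False then c v else 0)"
  proof (intro sum.cong refl)
    fix v assume "v \<in> words_upto N"
    then have "N - length v = N - length u \<longleftrightarrow> length v = length u"
      using u by (auto simp: words_upto_def)
    moreover have "length (filter id v) = 0 \<longleftrightarrow> (\<forall>b\<in>set v. b = False)"
      by (auto simp: filter_empty_conv)
    ultimately have "(length (filter id v) = 0 \<and> N - length v = N - length u) = (v = replicate
        (length u) False)"
      using replicate_length_same[of v False] by auto
    then show "(if length (filter id v) = 0 \<and> N - length v = N - length u then c v else 0) =
        (if v = replicate (length u) False then c v else 0)"
      by simp
  qed
  also have "\<dots> = c (replicate (length u) False)"
    using u by (subst sum.delta[OF finite_words_upto]) (simp add: words_upto_def)
  finally show ?thesis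
    using const[of u] const[of "replicate (length u) False"] by simp
next
  case True
  define char where "char S = map (\<lambda>i. i \<in> S) [0..<N]" for S :: "nat set"
  define f where "f S = c (char S)" for S
  have len: "length (char S) = N" for S
    by (simp add: char_def)
  \<comment> \<open>At length \<open>N\<close> all powers of the eigenvalues are 1, including 0^0,
    so all four terms are present.\<close>
  have cocycle': "(if set w \<subseteq> {S2, S3, S4} then c (map (\<lambda>a. a \<in> {S3, S4}) w) else 0) +
      (if set w \<subseteq> {S3, S4} then c (map (\<lambda>a. a \<in> {S4}) w) else 0) =
      (if set w \<subseteq> {S2, S3, S4} then c (map (\<lambda>a. a \<in> {S4}) w) else 0) +
      (if set w \<subseteq> {S2, S3} then c (map (\<lambda>a. a \<in> {S3}) w) else 0)" if "length w = N" for w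
  proof -
    have "e ^ (N - length w) = 1" for e :: 'a
      using that by simp
    moreover have "{S2} \<union> {S3, S4} = {S2, S3, S4}" "{S3} \<union> {S4} = {S3, S4}"
      "{S2, S3} \<union> {S4} = {S2, S3, S4}" "{S2} \<union> {S3} = {S2, S3}"
      by auto
    ultimately show ?thesis
      using cocycle[of w] that unfolding letter_value_def by (simp only: mult_1_right order.refl)
  qed
  have all: "set w \<subseteq> {S2, S3, S4}" for w
    using strand.exhaust by blast
  \<comment> \<open>\<open>S4\<close> marks \<open>S'\<close>, \<open>S3\<close> the rest of
    \<open>S\<close>, and \<open>S2\<close> the complement of \<open>S\<close>. As \<open>S2\<close>
    and \<open>S4\<close> both occur, the two terms restricted to two letters vanish.\<close>
  have mono: "f S = f S'" if S: "S' \<subseteq> S" "S' \<noteq> {}" "S \<subset> {..<N}" for S S'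
  proof -
    let ?w = "map (\<lambda>i. if i \<in> S' then S4 else if i \<in> S then S3 else S2) [0..<N]"
    have "map (\<lambda>a. a \<in> {S3, S4}) ?w = char S" "map (\<lambda>a. a \<in> {S4}) ?w = char S'"
      using S(1) by (auto simp: char_def)
    moreover have "S2 \<in> set ?w" "S4 \<in> set ?w"
      using S by force+
    then have "\<not> set ?w \<subseteq> {S3, S4}" "\<not> set ?w \<subseteq> {S2, S3}"
      by blast+
    ultimately show ?thesis
      using cocycle'[of ?w] all[of ?w] by (simp add: f_def del: map_map list.map_comp set_map)
  qed
  \<comment> \<open>On a power of \<open>S4\<close> the left side is twice this value and the right
    side once.\<close>
  have full: "f {..<N} = 0"
  proof -
    let ?w = "replicate N S4"
    have "map (\<lambda>a. a \<in> {S3, S4}) ?w = char {..<N}" "map (\<lambda>a. a \<in> {S4}) ?w = char {..<N}"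
      by (auto simp: char_def list_eq_iff_nth_eq)
    moreover have "\<not> set ?w \<subseteq> {S2, S3}" "set ?w \<subseteq> {S3, S4}" "set ?w \<subseteq> {S2, S3, S4}"
      using N by auto
    ultimately show ?thesis
      using cocycle'[of ?w] by (simp add: f_def del: map_replicate set_replicate)
  qed
  have compl: "f ({..<N} - S) = f S" for S
  proof -
    let ?w = "map (\<lambda>i. if i \<in> S then S3 else S2) [0..<N]"
    have "map (\<lambda>a. a \<in> {S3}) ?w = char S" "map (\<lambda>a. a \<in> {S2}) ?w = char ({..<N} - S)"
      by (auto simp: char_def)
    moreover have "set ?w \<subseteq> {S3} \<union> {S2}" "set ?w \<subseteq> {S2} \<union> {S3}"
      by auto
    ultimately show ?thesis
      using sym[of ?w] unfolding letter_value_def by (simp add: f_def del: map_map list.map_comp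
          set_map)
  qed
  \<comment> \<open>{p} lies in the complement of {q}, which has the same value as {q}.\<close>
  have point: "f {p} = f {q}" if "p < N" "q < N" for p q
  proof (cases "p = q")
    case False
    then have "f ({..<N} - {q}) = f {p}"
      using that by (intro mono) auto
    then show ?thesis by (simp add: compl)
  qed simp
  have char_inj: "char S = char S' \<longleftrightarrow> S \<inter> {..<N} = S' \<inter> {..<N}" for S S'
    by (auto simp: char_def list_eq_iff_nth_eq set_eq_iff)
  have char_nth: "v = char {i. i < N \<and> v ! i}" if "length v = N" for v
    using that by (auto simp: char_def list_eq_iff_nth_eq)
  \<comment> \<open>Exactly one t13 and no t23: the sum runs over the \<open>N\<close> singletons,
    whose values agree.\<close>
  have "0 = (\<Sum>v\<in>words_upto N. if length (filter id v) = 1 \<and> N - length v = 0 then c v else 0)"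
    by (rule abelian[symmetric])
  also have "\<dots> = (\<Sum>v\<in>{v \<in> words_upto N. length (filter id v) = 1 \<and> N - length v = 0}. c v)"
    by (rule sum.inter_filter[symmetric]) simp
  also have "{v \<in> words_upto N. length (filter id v) = 1 \<and> N - length v = 0} = (\<lambda>q. char {q}) `
      {..<N}"
  proof (intro set_eqI iffI)
    fix v assume "v \<in> {v \<in> words_upto N. length (filter id v) = 1 \<and> N - length v = 0}"
    then have v: "length v = N" "card {i. i < N \<and> v ! i} = 1"
      by (auto simp: words_upto_def length_filter_conv_card)
    then obtain q where q: "{i. i < N \<and> v ! i} = {q}"
      using card_1_singletonE by blast
    then show "v \<in> (\<lambda>q. char {q}) ` {..<N}"
      using char_nth[OF v(1)] by auto
  next
    fix v assume "v \<in> (\<lambda>q. char {q}) ` {..<N}"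
    then obtain q where q: "q < N" "v = char {q}" by auto
    then have "{i. i < length v \<and> id (v ! i)} = {q}"
      by (auto simp: char_def)
    then have "length (filter id v) = 1"
      by (simp only: length_filter_conv_card) simp
    then show "v \<in> {v \<in> words_upto N. length (filter id v) = 1 \<and> N - length v = 0}"
      using q by (simp add: words_upto_def len)
  qed
  also have "sum c ((\<lambda>q. char {q}) ` {..<N}) = (\<Sum>q<N. f {q})"
    by (subst sum.reindex) (auto simp: inj_on_def char_inj f_def)
  also have "\<dots> = (\<Sum>q<N. f {0})"
    using N by (intro sum.cong refl point) auto
  finally have "of_nat N * f {0} = 0"
    by simp
  moreover obtain r :: 'a where "1 = of_nat N * r"
    using Qalg[OF N] by (rule dvdE)
  ultimately have "f {0} = 0"
    by (metis mult.assoc mult.commute mult.left_neutral mult_zero_right)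
  then have proper: "f S = 0" if S: "S \<noteq> {}" "S \<subset> {..<N}" for S
  proof -
    obtain q where q: "q \<in> S" using S by blast
    then have "f S = f {q}"
      using S by (intro mono) auto
    also have "\<dots> = f {0}"
      using q S N by (intro point) auto
    finally show ?thesis
      using \<open>f {0} = 0\<close> by simp
  qed
  have f0: "f S = 0" if "S \<subseteq> {..<N}" for S
    using that proper full compl[of "{..<N}"] by (cases "S = {}"; cases "S = {..<N}") auto
  have "f {i. i < N \<and> u ! i} = 0" by (rule f0) auto
  then show ?thesis
    using char_nth[OF True] by (simp add: f_def)
qed

section \<open>The commutative quotient and the induction on the degree\<close>

lemma linear_form_commute_act3:
  assumes "linear_form x" "linear_form y"
  shows "x * y \<simeq>\<^bsub>act3.ker m\<^esub> y * x"
proof -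
  have "act3.graded_act 1 x (act3.graded_act 1 y v) = act3.graded_act 1 y (act3.graded_act 1 x v)"
      for v
    unfolding One_nat_def act3.graded_act.simps case_prod_beta act3.act_sum act3.act_scale
      module.scale_sum_right[OF module_scale_fun]
    by (subst sum.swap) (simp add: act3_commute module.scale_scale[OF module_scale_fun]
        mult.commute)
  then show ?thesis
    unfolding eqv_def by (intro act3.kerI) (simp add: act3.graded_act_diff
        act3.graded_act_linear_form_linear_form assms del: act3.graded_act.simps One_nat_def)
qed

lemma cable3_123: "cable3 {1} {2} {3} x = subst_lin 3 ser_gen x"
  unfolding cable3_def cable_def by (intro subst_lin_cong) (auto simp: gens_3 blocks3_def
      tsum_singleton, simp add: numeral_2_eq_2)

context pentagon_hexagon
begin

text \<open>Linear forms act by commuting operators, so Gamma moves past \<open>x\<close> and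
  cancels against its inverse. The defect thus acts as t12 + t13 - t12 - t13.\<close>

lemma conj_act3:
  assumes "disj3 3 A B C" "linear_form x"
  shows "H A B C * x * G A B C \<simeq>\<^bsub>act3.ker m\<^esub> x"
proof -
  interpret K: two_sided_ideal "act3.ker m"
    by (rule act3.ideal_ker)
  have "G A B C * x \<simeq>\<^bsub>act3.ker m\<^esub> x * G A B C"
    unfolding cable3_def cable_def
    by (rule subst_lin_commutes[OF act3.ideal_ker g]) (auto intro: linear_form_commute_act3
        assms(2) split: prod.splits)
  then have "H A B C * (x * G A B C) \<simeq>\<^bsub>act3.ker m\<^esub> H A B C * (G A B C * x)"
    by (intro K.eqv_lmul K.eqv_sym[of "G A B C * x"])
  also have "\<dots> = H A B C * G A B C * x"
    by (simp add: mult.assoc)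
  also have "\<dots> \<simeq>\<^bsub>act3.ker m\<^esub> 1 * x"
    using GH(2)[OF assms(1)] unfolding eqv_def[of "_ * _" "J 3 m"]
    by (intro K.eqv_rmul) (simp add: eqv_def act3.J_ker)
  finally show ?thesis by (simp add: mult.assoc)
qed

lemma defect_act3: "cabling_defect \<in> act3.ker m"
proof -
  interpret K: two_sided_ideal "act3.ker m"
    by (rule act3.ideal_ker)
  have D: "disj3 3 {1} {2} {3}" "disj3 3 {1} {3} {2}"
    by (auto simp: disj3_def)
  have "cable3 {1} {2} {3} cabling_defect \<simeq>\<^bsub>act3.ker m\<^esub> tsum {1} {2} + tsum {1} {3} - tsum {1} {2}
      - tsum {1} {3}"
    unfolding cable3_defect[OF D(1)] by (intro K.eqv_diff conj_act3 D linear_form_tsum K.eqv_refl)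
  then have "subst_lin 3 ser_gen cabling_defect \<in> act3.ker m"
    unfolding eqv_def cable3_123 by simp
  then show ?thesis
    by (simp add: act3.ker_def act3.graded_act_subst_lin_ser_gen)
qed

lemma defect_vanishes:
  assumes Qalg: "\<And>k::nat. 0 < k \<Longrightarrow> of_nat k dvd (1::'a)"
  shows "k \<le> m \<Longrightarrow> cabling_defect \<in> J 3 k"
proof (induction k)
  case 0
  show ?case
    by (rule J_vanish) (simp add: vanish_def cabling_defect_def coef_ser_gen)
next
  case (Suc k)
  let ?N = "Suc k"
  have Dk: "cabling_defect \<in> J 3 k" using Suc by simp
  \<comment> \<open>Any choice of coefficients will do: uniqueness is not claimed, and the chosen
    ones are shown to be zero.\<close>
  obtain c where c: "cabling_defect \<simeq>\<^bsub>J 3 ?N\<^esub> nform ?N c"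
    using J_nspan[OF Dk] unfolding nspan_def by blast
  \<comment> \<open>\<open>F\<close> is evaluated in two ways: the defect satisfies the cocycle
    equation and the symmetry, while the normal form expresses the same values through
    \<open>c\<close>.\<close>
  define F where "F A B C w = act4.graded_act ?N (cable3 A B C cabling_defect) unit_word w" for A
      B C w
  have F: "F A B C w = act4.graded_act ?N (cable3 A B C (nform ?N c)) unit_word w" if "disj3 4 A B
      C" for A B C w
    unfolding F_def using act4.graded_act_eqv[OF cable3_eqv[OF that c]] by simp
  have D: "disj3 4 {1} {2} {3, 4}" "disj3 4 {1} {3} {4}" "disj3 4 {1} {2, 3} {4}" "disj3 4 {1} {2}
      {3}"
    "disj3 4 {1} {3} {2}"
    by (auto simp: disj3_def)
  have vals: "F {1} {2} {3, 4} w = letter_value ?N c {S2} {S3, S4} 1 w"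
    "F {1} {3} {4} w = letter_value ?N c {S3} {S4} 0 w"
    "F {1} {2, 3} {4} w = letter_value ?N c {S2, S3} {S4} 1 w"
    "F {1} {2} {3} w = letter_value ?N c {S2} {S3} 0 w"
    "F {1} {3} {2} w = letter_value ?N c {S3} {S2} 0 w" if "length w \<le> ?N" for w
    unfolding D[THEN F] using that
    by (intro act4_nform act4_forms; simp)+
  have "c u = 0" if "length u \<le> ?N" for u
  proof (rule coefficients_vanish[OF Qalg _ _ _ _ that])
    fix w :: "strand list"
    assume w: "length w \<le> ?N"
    have "F {1} {2} {3, 4} w + F {1} {3} {4} w = F {1} {2, 3} {4} w + F {1} {2} {3} w"
      using fun_cong[OF act4.graded_act_eqv[OF defect_cocycle[OF Suc.prems Dk], of unit_word], of w]
      unfolding F_def act4.graded_act_add by simp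
    then show "letter_value ?N c {S2} {S3, S4} 1 w + letter_value ?N c {S3} {S4} 0 w =
      letter_value ?N c {S2, S3} {S4} 1 w + letter_value ?N c {S2} {S3} 0 w"
      unfolding vals[OF w] .
  next
    fix w :: "strand list"
    assume "length w = ?N"
    then have w: "length w \<le> ?N" by simp
    show "letter_value ?N c {S3} {S2} 0 w = letter_value ?N c {S2} {S3} 0 w"
      unfolding vals[OF w, symmetric] F_def cable3_defect_132[OF D(4)] ..
  next
    fix p q
    have "disj3 3 {1} {2} {3}" by (auto simp: disj3_def)
    then have "act3.graded_act ?N (cable3 {1} {2} {3} (nform ?N c)) origin (p, q) =
        act3.graded_act ?N (cable3 {1} {2} {3} cabling_defect) origin (p, q)"
      using act3.graded_act_eqv[OF cable3_eqv[OF _ c], of "{1}" "{2}" "{3}" origin] by simp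
    also have "cable3 {1} {2} {3} cabling_defect = subst_lin 3 ser_gen cabling_defect"
      by (rule cable3_123)
    also have "act3.graded_act ?N (subst_lin 3 ser_gen cabling_defect) origin = 0"
      unfolding act3.graded_act_subst_lin_ser_gen using act3.kerD[OF defect_act3 Suc.prems] .
    finally show "(\<Sum>u\<in>words_upto ?N. if length (filter id u) = p \<and> ?N - length u = q then c u else
        0) = 0"
      unfolding act3_nform by simp
  qed simp_all
  then have "nform ?N c = 0"
    by (simp add: nform_def words_upto_def)
  then show ?case
    using c by (simp add: eqv_def)
qed

end

section \<open>Translation to coefficient functions\<close>

lemma valid_iff: "valid n (coef x) \<longleftrightarrow> subst_lin n ser_gen x = x"
  using subst_lin_ser_gen_valid valid_subst_lin_ser_gen by metis

lemma cable3_valid: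
  assumes "disj3 n A B C" shows "subst_lin n ser_gen (cable3 A B C x) = cable3 A B C x"
  unfolding cable3_def cable_def subst_lin_subst_lin
proof (rule subst_lin_cong)
  fix a assume "a \<in> gens 3"
  then have "a \<in> {(1, 2), (1, 3), (2, 3)}"
    by (simp add: gens_3)
  then show "subst_lin n ser_gen (case a of (i, j) \<Rightarrow> tsum (blocks3 A B C i) (blocks3 A B C j)) =
      (case a of (i, j) \<Rightarrow> tsum (blocks3 A B C i) (blocks3 A B C j))"
    using assms by (auto simp: blocks3_def disj3_def intro!: valid_tsum)
qed

lemma pb_eq_eqv:
  assumes "subst_lin n ser_gen (Ser f) = Ser f" "subst_lin n ser_gen (Ser g) = Ser g"
  shows "pb_eq n m f g \<longleftrightarrow> Ser f \<simeq>\<^bsub>J n m\<^esub> Ser g"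
  using assms valid_iff[of n "Ser f"] valid_iff[of n "Ser g"] by (intro pb_eq_iff) simp_all

lemma Ser_sum: "Ser (sum F A) = (\<Sum>a\<in>A. Ser (F a))"
  by (rule ser_eqI) (simp add: sum_fun_apply)

lemma Ser_scale: "Ser (\<lambda>w. b * f w) = const_ser b * Ser f"
  by (rule ser_eqI) simp

lemma Ser_w_img: "Ser (w_img nc_mul nc_one \<phi> w) = prod_list (map (\<lambda>a. Ser (\<phi> a)) w)"
  by (induction w) (simp_all add: w_img_def Ser_simps)

lemma coef_prod_ser_gen: "coef (prod_list (map ser_gen w)) z = (if z = w then 1 else 0)"
proof (induction w arbitrary: z)
  case (Cons a w)
  show ?case
  proof (cases z)
    case (Cons b u)
    then show ?thesis
      by (simp add: coef_mult_Cons coef_ser_gen Cons.IH)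
  qed (simp add: coef_ser_gen)
qed simp

lemma subst_lin_prod_ser_gen:
  assumes "\<And>a. a \<in> gens n \<Longrightarrow> linear_form (\<phi> a)" "set w \<subseteq> gens n"
  shows "subst_lin n \<phi> (prod_list (map ser_gen w)) = prod_list (map \<phi> w)"
  using assms(2) by (induction w) (simp_all add: assms(1) subst_lin_ser_gen)

text \<open>\<open>nc_subst\<close> sums over the support, so it agrees with coefficientwise
  substitution when the support is finite. Validity ensures that no letters occur that
  \<open>subst_lin\<close> would drop.\<close>

lemma Ser_nc_subst:
  assumes f: "valid n f" "nc_poly f" and linear_form: "\<And>a. a \<in> gens n \<Longrightarrow> linear_form (Ser (\<phi> a))"
  shows "Ser (nc_subst \<phi> f) = subst_lin n (\<lambda>a. Ser (\<phi> a)) (Ser f)"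
proof -
  let ?W = "{w. f w \<noteq> 0}"
  have fin: "finite ?W" using f(2) by (simp add: nc_poly_def)
  have "Ser f = (\<Sum>w\<in>?W. const_ser (f w) * prod_list (map ser_gen w))"
  proof (rule ser_eqI)
    fix z
    have "coef (\<Sum>w\<in>?W. const_ser (f w) * prod_list (map ser_gen w)) z = (\<Sum>w\<in>?W. if z = w then f w
        else 0)"
      unfolding coef_sum by (intro sum.cong refl) (simp add: coef_prod_ser_gen)
    then show "coef (Ser f) z = coef (\<Sum>w\<in>?W. const_ser (f w) * prod_list (map ser_gen w)) z"
      using fin by simp
  qed
  then have "subst_lin n (\<lambda>a. Ser (\<phi> a)) (Ser f) =
      (\<Sum>w\<in>?W. const_ser (f w) * subst_lin n (\<lambda>a. Ser (\<phi> a)) (prod_list (map ser_gen w)))"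
    by simp
  also have "\<dots> = (\<Sum>w\<in>?W. const_ser (f w) * prod_list (map (\<lambda>a. Ser (\<phi> a)) w))"
  proof (intro sum.cong refl)
    fix w assume "w \<in> ?W"
    then have "set w \<subseteq> gens n" using f(1) by (simp add: valid_def)
    then show "const_ser (f w) * subst_lin n (\<lambda>a. Ser (\<phi> a)) (prod_list (map ser_gen w)) =
        const_ser (f w) * prod_list (map (\<lambda>a. Ser (\<phi> a)) w)"
      by (simp only: subst_lin_prod_ser_gen[OF linear_form])
  qed
  also have "\<dots> = Ser (nc_subst \<phi> f)"
    by (simp only: nc_subst_def p_subst_def Ser_sum Ser_scale Ser_w_img)
  finally show ?thesis ..
qed

lemma nc_subst_cable3:
  assumes f: "valid 3 f" "nc_poly f"
    and "Ser (\<phi> (1, 2)) = tsum A B" "Ser (\<phi> (1, 3)) = tsum A C" "Ser (\<phi> (2, 3)) = tsum B C"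
  shows "Ser (nc_subst \<phi> f) = cable3 A B C (Ser f)"
proof -
  have eq: "Ser (\<phi> a) = (case a of (i, j) \<Rightarrow> tsum (blocks3 A B C i) (blocks3 A B C j))" if "a \<in>
      gens 3" for a
    using that assms(3-) unfolding gens_3 by (auto simp: blocks3_def)
  then have linear_form: "linear_form (Ser (\<phi> a))" if "a \<in> gens 3" for a
    using that by (auto split: prod.splits)
  have "Ser (nc_subst \<phi> f) = subst_lin 3 (\<lambda>a. Ser (\<phi> a)) (Ser f)"
    by (rule Ser_nc_subst[OF f linear_form])
  also have "\<dots> = cable3 A B C (Ser f)"
    unfolding cable3_def cable_def by (rule subst_lin_cong) (rule eq)
  finally show ?thesis .
qed

lemma Ser_relabel:
  assumes "valid 3 f" "nc_poly f"
  shows "Ser (relabel \<sigma> f) = cable3 {\<sigma> 1} {\<sigma> 2} {\<sigma> 3} (Ser f)"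
  unfolding relabel_def
  by (rule nc_subst_cable3[OF assms]) (simp_all add: Ser_T tsum_singleton)

text \<open>d_0 and d_4 leave an outer strand free, while d_1, d_2, d_3 double the strand with that
  index.\<close>

lemma Ser_cof:
  assumes "valid 3 f" "nc_poly f"
  shows "Ser (cof 3 0 f) = cable3 {2} {3} {4} (Ser f)"
    "Ser (cof 3 1 f) = cable3 {1, 2} {3} {4} (Ser f)"
    "Ser (cof 3 2 f) = cable3 {1} {2, 3} {4} (Ser f)"
    "Ser (cof 3 3 f) = cable3 {1} {2} {3, 4} (Ser f)"
    "Ser (cof 3 4 f) = cable3 {1} {2} {3} (Ser f)"
  unfolding cof_def
  by (rule nc_subst_cable3[OF assms];
      simp add: dgen_def cof_phi_def Ser_T Ser_simps tsum_def; simp add: eval_nat_numeral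
          add.commute)+

lemma nc_poly_mul:
  assumes "nc_poly f" "nc_poly g" shows "nc_poly (nc_mul f g)"
proof -
  let ?A = "{w. f w \<noteq> 0}" and ?B = "{w. g w \<noteq> 0}"
  have "{w. nc_mul f g w \<noteq> 0} \<subseteq> (\<lambda>(u, v). u @ v) ` (?A \<times> ?B)"
  proof
    fix w assume "w \<in> {w. nc_mul f g w \<noteq> 0}"
    then obtain k where "f (take k w) * g (drop k w) \<noteq> 0"
      unfolding nc_mul_def using sum.neutral by (metis (mono_tags, lifting) mem_Collect_eq)
    then have "(take k w, drop k w) \<in> ?A \<times> ?B" by auto
    then show "w \<in> (\<lambda>(u, v). u @ v) ` (?A \<times> ?B)"
      by (rule rev_image_eqI) simp
  qed
  then show ?thesis
    using assms finite_subset unfolding nc_poly_def by blast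
qed

theorem theorem2p6:
  fixes g h :: "'a::comm_ring_1 nc" and m :: nat
  assumes Qalg: "\<And>k::nat. 0 < k \<Longrightarrow> of_nat k dvd (1::'a)"
    and m: "1 \<le> m"
    and g: "valid 3 g" "nc_poly g"
    and h: "valid 3 h" "nc_poly h"
    and inv: "pb_eq 3 m (nc_mul g h) nc_one" "pb_eq 3 m (nc_mul h g) nc_one"
    and gl: "grouplike 3 m g"
    and pent: "pb_eq 4 m (nc_mul (nc_mul (cof 3 4 g) (cof 3 2 g)) (cof 3 0 g))
                        (nc_mul (cof 3 1 g) (cof 3 3 g))"
    and hex: "pb_eq 3 m nc_one (nc_mul (nc_mul g (relabel \<sigma>132 h)) (relabel \<sigma>312 g))"
  shows "pb_eq 3 m (T 1 3 + T 2 3)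
           (nc_mul (nc_mul g (nc_mul (T 2 3) (relabel \<sigma>132 h) + nc_mul (relabel \<sigma>132 h) (T 1 3)))
                   (relabel \<sigma>312 g))
       \<and> pb_eq 3 m (T 1 2 + T 1 3)
           (nc_mul (nc_mul h (T 1 2)) g + relabel \<sigma>132 (nc_mul (nc_mul h (T 1 2)) g))"
proof -
  let ?g = "Ser g" and ?h = "Ser h"
  have gens3: "subst_lin 3 ser_gen (tgen 1 2) = tgen 1 2" "subst_lin 3 ser_gen (tgen 1 3) = tgen 1
      3" "subst_lin 3 ser_gen (tgen 2 3) = tgen 2 3"
    by (rule subst_lin_ser_gen; simp add: gens_3 linear_form_ser_gen numeral_2_eq_2)+
  have gh3: "subst_lin 3 ser_gen ?g = ?g" "subst_lin 3 ser_gen ?h = ?h"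
    using g(1) h(1) by (simp_all add: subst_lin_ser_gen_valid)
  have D: "disj3 3 {1} {3} {2}" "disj3 3 {3} {1} {2}" "disj3 4 {1} {2} {3}" "disj3 4 {1} {2, 3} {4}"
    "disj3 4 {2} {3} {4}" "disj3 4 {1, 2} {3} {4}" "disj3 4 {1} {2} {3, 4}"
    by (auto simp: disj3_def)
  note valid_cable3 = D[THEN cable3_valid]
  have perms: "Ser (relabel \<sigma>132 h) = cable3 {1} {3} {2} ?h" "Ser (relabel \<sigma>312 g) = cable3 {3}
      {1} {2} ?g"
    using Ser_relabel[OF h, of \<sigma>132] Ser_relabel[OF g, of \<sigma>312] by (simp_all add: \<sigma>132_def \<sigma>312_def)
  \<comment> \<open>\<open>relabel\<close> is a sum over the support, so the conjugate of t12 must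
    itself be checked to be a polynomial on three strands before it can be read as a
    cabling.\<close>
  have conj: "Ser (relabel \<sigma>132 (nc_mul (nc_mul h (T 1 2)) g)) = cable3 {1} {3} {2} (?h * tgen 1 2
      * ?g)"
  proof -
    let ?f = "nc_mul (nc_mul h (T 1 2)) g"
    have "finite {w. nc_gen a w \<noteq> (0 :: 'a)}" for a
      by (rule finite_subset[of _ "{[a]}"]) (auto simp: nc_gen_def)
    then have "nc_poly (T 1 2 :: 'a nc)"
      unfolding nc_poly_def T_def .
    then have "nc_poly ?f"
      by (intro nc_poly_mul g h)
    moreover have "valid 3 (coef (Ser ?f))"
      unfolding valid_iff by (simp only: Ser_simps Ser_T subst_lin_mult gens3 gh3)
    ultimately have "Ser (relabel \<sigma>132 ?f) = cable3 {\<sigma>132 1} {\<sigma>132 2} {\<sigma>132 3} (Ser ?f)"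
      by (intro Ser_relabel) simp_all
    also have "\<dots> = cable3 {1} {3} {2} (?h * tgen 1 2 * ?g)"
      by (simp only: Ser_simps Ser_T) (simp add: \<sigma>132_def)
    finally show ?thesis .
  qed
  interpret pentagon_hexagon m ?g ?h
  proof
    show "nc_poly (coef ?g)" "valid 3 (coef ?g)" "valid 3 (coef ?h)"
      using g h by simp_all
    show "?g * ?h \<simeq>\<^bsub>J 3 m\<^esub> 1" "?h * ?g \<simeq>\<^bsub>J 3 m\<^esub> 1"
      using inv by (simp_all only: pb_eq_eqv Ser_simps subst_lin_mult subst_lin_1 gh3)
    show "cable3 {1} {2} {3} ?g * cable3 {1} {2, 3} {4} ?g * cable3 {2} {3} {4} ?g
      \<simeq>\<^bsub>J 4 m\<^esub> cable3 {1, 2} {3} {4} ?g * cable3 {1} {2} {3, 4} ?g"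
      using pent by (simp only: pb_eq_eqv Ser_simps Ser_cof[OF g] subst_lin_mult valid_cable3)
    show "?g * cable3 {1} {3} {2} ?h * cable3 {3} {1} {2} ?g \<simeq>\<^bsub>J 3 m\<^esub> 1"
      using hex by (intro J.eqv_sym[of 1]) (simp only: pb_eq_eqv Ser_simps perms subst_lin_mult
          subst_lin_1 gh3 valid_cable3)
  qed
  have defect: "cabling_defect \<in> J 3 m"
    by (rule defect_vanishes[OF Qalg]) simp_all
  have "tgen 1 2 + tgen 1 3 \<simeq>\<^bsub>J 3 m\<^esub> ?h * tgen 1 2 * ?g + cable3 {1} {3} {2} (?h * tgen 1 2 * ?g)"
    using defect unfolding eqv_def cabling_defect_def diff_diff_eq .
  moreover note semiclassical[OF defect]
  ultimately show ?thesis
    by (simp only: pb_eq_eqv Ser_simps Ser_T perms conj subst_lin_mult subst_lin_add gens3 gh3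
        valid_cable3 simp_thms)
qed

end
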